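(* Let $k,L\ge 1$ be integers, $N=2^{L+1}k$, $\mathbf{A}\in\mathbb{R}^{N\times N}$, and let $\Gamma_{\mathrm r},\Gamma_{\mathrm c},\Gamma_{\mathrm d}\ge 0$ be constants. Let $\mathbf{B}\in\mathrm{HSS}(L,k)$ be the output of the (possibly randomized) greedy HSS approximation procedure (described in the context) applied to $\mathbf{A}$ with rank parameter $k$. Suppose that at each level $\ell=L,\ldots,1$ and for all $i=1,\ldots,2^\ell$ the factors $\mathbf{U}_i^{(\ell)},\mathbf{V}_i^{(\ell)}$ satisfy $$\mathbb{E}\Big[\|r_i(\mathbf{A}^{(\ell+1)})-\mathbf{U}_i^{(\ell)}(\mathbf{U}_i^{(\ell)})^{\mathsf T}r_i(\mathbf{A}^{(\ell+1)})\|_F^2\,\Big|\,\mathbf{A}^{(\ell+1)}\Big]\le\Gamma_{\mathrm r}\,\|r_i(\mathbf{A}^{(\ell+1)})-[\![ r_i(\mathbf{A}^{(\ell+1)})]\!]_k\|_F^2,$$ $$\mathbb{E}\Big[\|c_i(\mathbf{A}^{(\ell+1)})-c_i(\mathbf{A}^{(\ell+1)})\mathbf{V}_i^{(\ell)}(\mathbf{V}_i^{(\ell)})^{\mathsf T}\|_F^2\,\Big|\,\mathbf{A}^{(\ell+1)}\Big]\le\Gamma_{\mathrm c}\,\|c_i(\mathbf{A}^{(\ell+1)})-[\![ c_i(\mathbf{A}^{(\ell+1)})]\!]_k\|_F^2,$$ and the diagonal factors $\mathbf{D}_i^{(\ell)}$ satisfy $$\mathbb{E}\Big[\|(\mathbf{A}_{i,i}^{(\ell+1)}-\mathbf{D}_i^{(\ell)})-\mathbf{U}_i^{(\ell)}(\mathbf{U}_i^{(\ell)})^{\mathsf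 T}(\mathbf{A}_{i,i}^{(\ell+1)}-\mathbf{D}_i^{(\ell)})\mathbf{V}_i^{(\ell)}(\mathbf{V}_i^{(\ell)})^{\mathsf T}\|_F^2\,\Big|\,\mathbf{A}^{(\ell+1)},\mathbf{U}_i^{(\ell)},\mathbf{V}_i^{(\ell)}\Big]$$ $$\le\Gamma_{\mathrm d}\Big[\|r_i(\mathbf{A}^{(\ell+1)})-\mathbf{U}_i^{(\ell)}(\mathbf{U}_i^{(\ell)})^{\mathsf T}r_i(\mathbf{A}^{(\ell+1)})\|_F^2+\|c_i(\mathbf{A}^{(\ell+1)})-c_i(\mathbf{A}^{(\ell+1)})\mathbf{V}_i^{(\ell)}(\mathbf{V}_i^{(\ell)})^{\mathsf T}\|_F^2\Big].$$ Then $$\mathbb{E}\big[\|\mathbf{A}-\mathbf{B}\|_F^2\big]\le(\Gamma_{\mathrm r}+\Gamma_{\mathrm c})(1+\Gamma_{\mathrm d})\,L\cdot\min_{\mathbf{C}\in\mathrm{HSS}(L,k)}\|\mathbf{A}-\mathbf{C}\|_F^2 .$$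
   Context: $\|\cdot\|_F$ is the Frobenius norm; $[\![\mathbf{M}]\!]_k$ is a best rank-$k$ approximation of $\mathbf{M}$ (truncated SVD); $\mathrm{blockdiag}(\cdot)$ is the block-diagonal matrix with the listed (possibly rectangular) blocks. Blocks. A matrix $\mathbf{M}\in\mathbb{R}^{2^{\ell+1}k\times 2^{\ell+1}k}$ is partitioned into a $2^\ell\times 2^\ell$ array of blocks $\mathbf{M}_{i,j}\in\mathbb{R}^{2k\times 2k}$. Its $i$th HSS block-row is $r_i(\mathbf{M})=[\mathbf{M}_{i,1}\ \cdots\ \mathbf{M}_{i,i-1}\ \mathbf{M}_{i,i+1}\ \cdots\ \mathbf{M}_{i,2^\ell}]$ and its $i$th HSS block-column $c_i(\mathbf{M})$ is obtained by stacking vertically $\mathbf{M}_{1,i},\ldots,\mathbf{M}_{i-1,i},\mathbf{M}_{i+1,i},\ldots,\mathbf{M}_{2^\ell,i}$ (the diagonal block is omitted in both). HSS matrices. For $L\ge 0$, $\mathrm{HSS}(L,k)$ is the set of $\mathbf{B}\in\mathbb{R}^{2^{L+1}k\times 2^{L+1}k}$ for which there exist $\mathbf{D}^{(0)}\in\mathbb{R}^{2k\times 2k}$ and, for $\ell=1,\ldots,L$, matrices $\mathbf{U}^{(\ell)}=\mathrm{blockdiag}(\mathbf{U}^{(\ell)}_1,\ldots,\mathbf{U}^{(\ell)}_{2^\ell})$, $\mathbf{V}^{(\ell)}=\mathrm{blockdiag}(\mathbf{V}^{(\ell)}_1,\ldots,\mathbf{V}^{(\ell)}_{2^\ell})$,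 $\mathbf{D}^{(\ell)}=\mathrm{blockdiag}(\mathbf{D}^{(\ell)}_1,\ldots,\mathbf{D}^{(\ell)}_{2^\ell})$, with $\mathbf{U}^{(\ell)}_i,\mathbf{V}^{(\ell)}_i\in\mathbb{R}^{2k\times k}$ having orthonormal columns and $\mathbf{D}_i^{(\ell)}\in\mathbb{R}^{2k\times 2k}$, such that $\mathbf{B}^{(1)}=\mathbf{D}^{(0)}$, $\mathbf{B}^{(\ell+1)}=\mathbf{U}^{(\ell)}\mathbf{B}^{(\ell)}(\mathbf{V}^{(\ell)})^{\mathsf T}+\mathbf{D}^{(\ell)}$ for $\ell=1,\ldots,L$, and $\mathbf{B}=\mathbf{B}^{(L+1)}$ (telescoping factorization). Greedy HSS approximation procedure. Set $\mathbf{A}^{(L+1)}=\mathbf{A}$. For $\ell=L,L-1,\ldots,1$: for each $i=1,\ldots,2^\ell$ choose (possibly at random) $\mathbf{U}_i^{(\ell)},\mathbf{V}_i^{(\ell)}\in\mathbb{R}^{2k\times k}$ with orthonormal columns and $\mathbf{D}_i^{(\ell)}\in\mathbb{R}^{2k\times 2k}$; let $\mathbf{U}^{(\ell)},\mathbf{V}^{(\ell)},\mathbf{D}^{(\ell)}$ be the corresponding block-diagonal matrices; set $\mathbf{A}^{(\ell)}=(\mathbf{U}^{(\ell)})^{\mathsf T}(\mathbf{A}^{(\ell+1)}-\mathbf{D}^{(\ell)})\mathbf{V}^{(\ell)}\in\mathbb{R}^{2^\ell k\times 2^\ell k}$. Finally set $\mathbf{D}^{(0)}=\mathbf{A}^{(1)}$.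 The output $\mathbf{B}$ is the matrix with telescoping factorization given by $\mathbf{D}^{(0)}$ and $\mathbf{U}^{(\ell)},\mathbf{V}^{(\ell)},\mathbf{D}^{(\ell)}$, $\ell=1,\ldots,L$. (The factors are meant to approximately minimize the errors on the left-hand sides of the hypotheses; the hypotheses quantify this.) The matrix $\mathbf{A}$ is deterministic. *)

theory Defs
  imports
    "HOL-Probability.Probability"
    "Jordan_Normal_Form.DL_Rank"
    "Jordan_Normal_Form.DL_Submatrix"
begin

section \<open>Matrices\<close>

definition frob_norm :: "real mat \<Rightarrow> real" where
  "frob_norm X = sqrt (\<Sum>i<dim_row X. \<Sum>j<dim_col X. (X $$ (i,j))\<^sup>2)"

definition orthonormal_cols :: "real mat \<Rightarrow> bool" where
  "orthonormal_cols X \<longleftrightarrow> X\<^sup>T * X = 1\<^sub>m (dim_col X)"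

definition best_rank_approx :: "nat \<Rightarrow> real mat \<Rightarrow> real mat" where
  "best_rank_approx k X =
     arg_min (\<lambda>Y. frob_norm (X - Y))
       (\<lambda>Y. Y \<in> carrier_mat (dim_row X) (dim_col X) \<and> vec_space.rank (dim_row X) Y \<le> k)"

section \<open>HSS matrices\<close>

text \<open>Blocks are numbered from 0; at every level the blocks have size \<open>2 * k\<close>.\<close>

definition block_idx :: "nat \<Rightarrow> nat \<Rightarrow> nat set" where
  "block_idx k i = {2 * k * i ..< 2 * k * (i + 1)}"

definition diag_block :: "nat \<Rightarrow> nat \<Rightarrow> real mat \<Rightarrow> real mat" where
  "diag_block k i X = submatrix X (block_idx k i) (block_idx k i)"

definition block_row :: "nat \<Rightarrow> nat \<Rightarrow> real mat \<Rightarrow> real mat" where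
  "block_row k i X = submatrix X (block_idx k i) (- block_idx k i)"

definition block_col :: "nat \<Rightarrow> nat \<Rightarrow> real mat \<Rightarrow> real mat" where
  "block_col k i X = submatrix X (- block_idx k i) (block_idx k i)"

definition blockdiag :: "(nat \<Rightarrow> nat \<Rightarrow> real mat) \<Rightarrow> nat \<Rightarrow> real mat" where
  "blockdiag X l = diag_block_mat (map (X l) [0..<2 ^ l])"

definition hss_factors ::
  "nat \<Rightarrow> nat \<Rightarrow> (nat \<Rightarrow> nat \<Rightarrow> real mat) \<Rightarrow> (nat \<Rightarrow> nat \<Rightarrow> real mat) \<Rightarrow> (nat \<Rightarrow> nat \<Rightarrow> real mat) \<Rightarrow> bool"
where
  "hss_factors L k U V D \<longleftrightarrow>
     (\<forall>l\<in>{1..L}. \<forall>i<2 ^ l.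
        U l i \<in> carrier_mat (2 * k) k \<and> orthonormal_cols (U l i) \<and>
        V l i \<in> carrier_mat (2 * k) k \<and> orthonormal_cols (V l i) \<and>
        D l i \<in> carrier_mat (2 * k) (2 * k))"

text \<open>The index is shifted by one: \<open>telescope D0 U V D l\<close> is the matrix \<open>B\<close> of level \<open>l + 1\<close>.\<close>

primrec telescope ::
  "real mat \<Rightarrow> (nat \<Rightarrow> nat \<Rightarrow> real mat) \<Rightarrow> (nat \<Rightarrow> nat \<Rightarrow> real mat) \<Rightarrow> (nat \<Rightarrow> nat \<Rightarrow> real mat)
    \<Rightarrow> nat \<Rightarrow> real mat"
where
  "telescope D0 U V D 0 = D0"
| "telescope D0 U V D (Suc l) =
     blockdiag U (Suc l) * telescope D0 U V D l * (blockdiag V (Suc l))\<^sup>T + blockdiag D (Suc l)"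

definition HSS :: "nat \<Rightarrow> nat \<Rightarrow> real mat set" where
  "HSS L k = {telescope D0 U V D L | D0 U V D.
     D0 \<in> carrier_mat (2 * k) (2 * k) \<and> hss_factors L k U V D}"

section \<open>The greedy procedure\<close>

text \<open>Here \<open>U\<close>, \<open>V\<close>, \<open>D\<close> are the factors that the procedure has chosen (for one realisation of the
  randomness). \<open>greedy_level L A U V D l\<close> is the matrix \<open>A\<close> of level \<open>l\<close>, computed downwards from
  level \<open>L + 1\<close>.\<close>

function greedy_level ::
  "nat \<Rightarrow> real mat \<Rightarrow> (nat \<Rightarrow> nat \<Rightarrow> real mat) \<Rightarrow> (nat \<Rightarrow> nat \<Rightarrow> real mat) \<Rightarrow> (nat \<Rightarrow> nat \<Rightarrow> real mat)
    \<Rightarrow> nat \<Rightarrow> real mat"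
where
  "greedy_level L A U V D l =
     (if l > L then A
      else (blockdiag U l)\<^sup>T * (greedy_level L A U V D (l + 1) - blockdiag D l) * blockdiag V l)"
  by pat_completeness auto
termination
  by (relation "Wellfounded.measure (\<lambda>(L, A, U, V, D, l). Suc L - l)") auto

declare greedy_level.simps [simp del]

definition greedy_output ::
  "nat \<Rightarrow> real mat \<Rightarrow> (nat \<Rightarrow> nat \<Rightarrow> real mat) \<Rightarrow> (nat \<Rightarrow> nat \<Rightarrow> real mat) \<Rightarrow> (nat \<Rightarrow> nat \<Rightarrow> real mat)
    \<Rightarrow> real mat"
where
  "greedy_output L A U V D = telescope (greedy_level L A U V D 1) U V D L"

lemma greedy_output_in_HSS:
  assumes "hss_factors L k U V D" "L \<ge> 1"
  shows "greedy_output L A U V D \<in> HSS L k"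
proof -
  have "dim_col (U 1 i) = k" "dim_col (V 1 i) = k" if "i < 2" for i
  proof -
    have "1 \<in> {1..L}" "i < 2 ^ 1"
      using assms(2) that by auto
    then have "U 1 i \<in> carrier_mat (2 * k) k" "V 1 i \<in> carrier_mat (2 * k) k"
      using assms(1) unfolding hss_factors_def by blast+
    then show "dim_col (U 1 i) = k" "dim_col (V 1 i) = k"
      by auto
  qed
  from this[of 0] this[of 1]
  have "dim_col (blockdiag U 1) = 2 * k" "dim_col (blockdiag V 1) = 2 * k"
    unfolding blockdiag_def by (simp_all add: dim_diag_block_mat numeral_2_eq_2)
  then have "greedy_level L A U V D 1 \<in> carrier_mat (2 * k) (2 * k)"
    using assms(2) unfolding greedy_level.simps[of L A U V D 1] carrier_mat_def by simp
  then show ?thesis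
    using assms(1) unfolding HSS_def greedy_output_def by blast
qed

section \<open>Random matrices\<close>

text \<open>The Borel \<open>\<sigma>\<close>-algebra of the space of \<open>m\<close>-by-\<open>n\<close> matrices, generated by the entries.\<close>

definition mat_borel :: "nat \<Rightarrow> nat \<Rightarrow> real mat measure" where
  "mat_borel m n = sigma (carrier_mat m n)
     {{X \<in> carrier_mat m n. X $$ (i,j) \<in> S} | i j S. i < m \<and> j < n \<and> S \<in> sets borel}"

text \<open>\<open>cond_nn_expectation M N X f\<close> is the conditional expectation of the nonnegative random
  variable \<open>f\<close> given the \<open>N\<close>-valued random element \<open>X\<close>. It takes values in \<open>[0,\<infinity>]\<close>, so that
  no integrability has to be presupposed. (\<open>nn_cond_exp\<close> is 0 by convention if \<open>f\<close> or \<open>X\<close> is not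
  measurable; for measurable factors, all quantities of the greedy procedure are measurable.)\<close>

definition cond_nn_expectation ::
  "'w measure \<Rightarrow> 'b measure \<Rightarrow> ('w \<Rightarrow> 'b) \<Rightarrow> ('w \<Rightarrow> real) \<Rightarrow> 'w \<Rightarrow> ennreal"
where
  "cond_nn_expectation M N X f =
     nn_cond_exp M (vimage_algebra (space M) X N) (\<lambda>\<omega>. ennreal (f \<omega>))"

end

theory Submission
  imports Defs
begin

text \<open>For a level with compressing factors \<open>U\<close>, \<open>V\<close> and diagonal part \<open>D\<close>, put \<open>H = A - D\<close>. The residual
  \<open>H - U U\<^sup>T H V V\<^sup>T\<close> is orthogonal to every \<open>U X V\<^sup>T\<close>, so by Pythagoras the squared error of the
  output is the sum over the levels of the squared residuals. A diagonal block of the residual is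
  controlled by the hypothesis on \<open>D\<close>, an off-diagonal block by the row error plus the column error. The
  best rank-\<open>k\<close> errors of one level add up to at most the squared distance of the compressed
  matrix to the HSS matrices of that level, because HSS block-rows have rank at most \<open>k\<close>. This distance does
  not grow from level to level, since \<open>C \<mapsto> U\<^sup>T (C - D) V\<close> is a contraction that maps HSS matrices to HSS
  matrices. The minimum over the HSS matrices is attained because the factors of a bounded
  sequence can be normalised to be bounded.\<close>

section \<open>Frobenius geometry\<close>

text \<open>The matrices of the lower levels are random, but the comparison with the optimum holds
  realisation by realisation: in every run each level has an HSS competitor, possibly random, within
  the deterministic distance of \<open>A\<close> to its best approximation. So the law of total
  expectation is applied within each level separately and no error is amplified on the way down;
  every level pays the same amount, hence the factor \<open>L\<close> and not a power. Row and
  column errors of a level are measured against the same optimum, which gives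
  \<open>\<Gamma>\<^sub>r + \<Gamma>\<^sub>c\<close>; the diagonal adds
  \<open>\<Gamma>\<^sub>d\<close> times their sum. Two obstacles shape the algebra. Compressing an
  HSS matrix produces outer factors \<open>U\<^sup>T * W\<close> that are not orthonormal, so a QR
  factorization is required that also covers deficient rank. And the telescoping factors of a fixed
  matrix are neither unique nor bounded, because the diagonal part can cancel the compressed part;
  this blocks limits until the cancellation is removed.\<close>

definition fsq :: "real mat \<Rightarrow> real" where
  "fsq X = (\<Sum>i<dim_row X. \<Sum>j<dim_col X. (X $$ (i,j))\<^sup>2)"

definition mat_inner :: "real mat \<Rightarrow> real mat \<Rightarrow> real" where
  "mat_inner X Y = (\<Sum>i<dim_row X. \<Sum>j<dim_col X. X $$ (i,j) * Y $$ (i,j))"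

lemma fsq_nonneg: "fsq X \<ge> 0"
  unfolding fsq_def by (intro sum_nonneg) auto

lemma frob_norm_sq: "(frob_norm X)\<^sup>2 = fsq X"
  using fsq_nonneg[of X] by (simp add: frob_norm_def fsq_def)

lemma fsq_transpose: "fsq X\<^sup>T = fsq X"
  unfolding fsq_def by (simp add: sum.swap[of _ "{..<dim_row X}"])

lemma mult_entry:
  fixes A B :: "'a :: semiring_0 mat"
  assumes "A \<in> carrier_mat m p" "B \<in> carrier_mat p n" "i < m" "j < n"
  shows "(A * B) $$ (i,j) = (\<Sum>c<p. A $$ (i,c) * B $$ (c,j))"
  using assms by (auto simp: scalar_prod_def atLeast0LessThan)

lemma mat_assoc:
  fixes X Y Z :: "'a :: semiring_0 mat"
  shows "dim_col X = dim_row Y \<Longrightarrow> dim_col Y = dim_row Z \<Longrightarrow> X * Y * Z = X * (Y * Z)"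
  by (rule assoc_mult_mat[of _ "dim_row X" "dim_col X" _ "dim_col Y" _ "dim_col Z"]) auto

lemma mat_transpose_mult:
  fixes X Y :: "'a :: comm_semiring_0 mat"
  shows "dim_col X = dim_row Y \<Longrightarrow> (X * Y)\<^sup>T = Y\<^sup>T * X\<^sup>T"
  by (rule transpose_mult[of _ "dim_row X" "dim_col X" _ "dim_col Y"]) auto

lemma mat_distrib:
  fixes X Y Z :: "'a :: ring mat"
  shows "dim_col X = dim_row Y \<Longrightarrow> dim_row Y = dim_row Z \<Longrightarrow> dim_col Y = dim_col Z \<Longrightarrow> X * (Y + Z) = X * Y + X * Z"
    and "dim_col X = dim_row Y \<Longrightarrow> dim_row Y = dim_row Z \<Longrightarrow> dim_col Y = dim_col Z \<Longrightarrow> X * (Y - Z) = X * Y - X * Z"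
    and "dim_col Y = dim_row X \<Longrightarrow> dim_row Y = dim_row Z \<Longrightarrow> dim_col Y = dim_col Z \<Longrightarrow> (Y + Z) * X = Y * X + Z * X"
    and "dim_col Y = dim_row X \<Longrightarrow> dim_row Y = dim_row Z \<Longrightarrow> dim_col Y = dim_col Z \<Longrightarrow> (Y - Z) * X = Y * X - Z * X"
     apply (rule mult_add_distrib_mat[of _ "dim_row X" "dim_col X" _ "dim_col Y"]; auto)
    apply (rule mult_minus_distrib_mat[of _ "dim_row X" "dim_col X" _ "dim_col Y"]; auto)
   apply (rule add_mult_distrib_mat[of _ "dim_row Y" "dim_col Y" _ _ "dim_col X"]; auto)
  apply (rule minus_mult_distrib_mat[of _ "dim_row Y" "dim_col Y" _ _ "dim_col X"]; auto)
  done

section \<open>Adjoints, isometries and orthogonal splitting\<close>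

lemma mat_inner_transpose:
  assumes "X \<in> carrier_mat m n" "Y \<in> carrier_mat m n"
  shows "mat_inner X\<^sup>T Y\<^sup>T = mat_inner X Y"
proof -
  have "mat_inner X\<^sup>T Y\<^sup>T = (\<Sum>j<n. \<Sum>i<m. X $$ (i,j) * Y $$ (i,j))"
    using assms unfolding mat_inner_def by (auto intro!: sum.cong)
  also have "\<dots> = mat_inner X Y"
    using assms unfolding mat_inner_def by (subst sum.swap) (auto)
  finally show ?thesis .
qed

text \<open>Adjointness: with its right-hand counterpart it moves both outer factors of
  \<open>W * X * Z\<^sup>T\<close> across the inner product.\<close>

lemma mat_inner_mult_left:
  assumes W: "W \<in> carrier_mat m p" and X: "X \<in> carrier_mat p n" and Y: "Y \<in> carrier_mat m n"
  shows "mat_inner (W * X) Y = mat_inner X (W\<^sup>T * Y)"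
proof -
  have "mat_inner (W * X) Y = (\<Sum>i<m. \<Sum>j<n. \<Sum>c<p. W $$ (i,c) * X $$ (c,j) * Y $$ (i,j))"
    unfolding mat_inner_def using W X
    by (auto intro!: sum.cong simp del: index_mult_mat(1) simp: mult_entry[OF W X] sum_distrib_right)
  also have "\<dots> = (\<Sum>j<n. \<Sum>i<m. \<Sum>c<p. W $$ (i,c) * X $$ (c,j) * Y $$ (i,j))"
    by (rule sum.swap)
  also have "\<dots> = (\<Sum>j<n. \<Sum>c<p. \<Sum>i<m. W $$ (i,c) * X $$ (c,j) * Y $$ (i,j))"
    by (intro sum.cong refl sum.swap)
  also have "\<dots> = (\<Sum>c<p. \<Sum>j<n. \<Sum>i<m. W $$ (i,c) * X $$ (c,j) * Y $$ (i,j))"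
    by (rule sum.swap)
  also have "\<dots> = mat_inner X (W\<^sup>T * Y)"
    unfolding mat_inner_def using W X Y mult_entry[of "W\<^sup>T" p m Y n]
    by (auto intro!: sum.cong simp del: index_mult_mat(1) simp: sum_distrib_left ac_simps)
  finally show ?thesis .
qed

lemma mat_inner_mult_right:
  assumes X: "X \<in> carrier_mat m p" and Z: "Z \<in> carrier_mat n p" and Y: "Y \<in> carrier_mat m n"
  shows "mat_inner (X * Z\<^sup>T) Y = mat_inner X (Y * Z)"
proof -
  have XZ: "X * Z\<^sup>T \<in> carrier_mat m n" and YZ: "Y * Z \<in> carrier_mat m p"
    using assms by auto
  have "mat_inner (X * Z\<^sup>T) Y = mat_inner (Z * X\<^sup>T) Y\<^sup>T"
    using mat_inner_transpose[OF XZ Y] assms by (simp add: transpose_mult[of X m p])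
  also have "\<dots> = mat_inner X\<^sup>T (Z\<^sup>T * Y\<^sup>T)"
    using assms by (intro mat_inner_mult_left[of _ n p _ m]) auto
  also have "\<dots> = mat_inner X\<^sup>T (Y * Z)\<^sup>T"
    using assms by (simp add: transpose_mult[of Y m n])
  also have "\<dots> = mat_inner X (Y * Z)"
    using X YZ by (rule mat_inner_transpose)
  finally show ?thesis .
qed

lemma fsq_mat_inner: "fsq X = mat_inner X X"
  by (simp add: fsq_def mat_inner_def power2_eq_square)

lemma mat_inner_zero: "X \<in> carrier_mat m n \<Longrightarrow> mat_inner X (0\<^sub>m m n) = 0"
  by (auto simp: mat_inner_def)

text \<open>The cross term has \<open>Y\<close> first, so that for \<open>Y\<close> of the form
  \<open>W * X * Z\<^sup>T\<close> the adjoint rules apply to it directly.\<close>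

lemma fsq_add:
  assumes "X \<in> carrier_mat m n" "Y \<in> carrier_mat m n"
  shows "fsq (X + Y) = fsq X + fsq Y + 2 * mat_inner Y X"
  using assms unfolding fsq_def mat_inner_def
  by (simp add: power2_sum sum.distrib sum_distrib_left algebra_simps)

lemma fsq_isometry:
  assumes "W \<in> carrier_mat m p" "W\<^sup>T * W = 1\<^sub>m p" "X \<in> carrier_mat p n"
  shows "fsq (W * X) = fsq X"
proof -
  have "fsq (W * X) = mat_inner X (W\<^sup>T * (W * X))"
    unfolding fsq_mat_inner using assms by (intro mat_inner_mult_left) auto
  also have "W\<^sup>T * (W * X) = X"
    using assms by (subst assoc_mult_mat[symmetric, of _ p m _ p _ n]) auto
  finally show ?thesis by (simp add: fsq_mat_inner)
qed

lemma fsq_isometry_right: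
  assumes "Z \<in> carrier_mat m p" "Z\<^sup>T * Z = 1\<^sub>m p" "X \<in> carrier_mat n p"
  shows "fsq (X * Z\<^sup>T) = fsq X"
proof -
  have "fsq (X * Z\<^sup>T) = fsq (X * Z\<^sup>T)\<^sup>T" by (simp add: fsq_transpose)
  also have "(X * Z\<^sup>T)\<^sup>T = Z * X\<^sup>T" using assms by (simp add: transpose_mult[of X n p])
  also have "fsq \<dots> = fsq X\<^sup>T" using assms by (intro fsq_isometry[of _ m p]) auto
  finally show ?thesis by (simp add: fsq_transpose)
qed

text \<open>By adjointness the cross term is the inner product of \<open>X\<close> with
  \<open>W\<^sup>T * E * Z\<close>, which vanishes; the isometries \<open>W\<close> and
  \<open>Z\<close> preserve the norm of \<open>X\<close>.\<close>

lemma fsq_pythagoras: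
  assumes "W \<in> carrier_mat m p" "W\<^sup>T * W = 1\<^sub>m p"
    and "Z \<in> carrier_mat n q" "Z\<^sup>T * Z = 1\<^sub>m q"
    and "E \<in> carrier_mat m n" "X \<in> carrier_mat p q" "W\<^sup>T * E * Z = 0\<^sub>m p q"
  shows "fsq (E + W * X * Z\<^sup>T) = fsq E + fsq X"
proof -
  have "fsq (E + W * X * Z\<^sup>T) = fsq E + fsq (W * X * Z\<^sup>T) + 2 * mat_inner (W * X * Z\<^sup>T) E"
    using assms by (intro fsq_add[of _ m n]) auto
  also have "mat_inner (W * X * Z\<^sup>T) E = mat_inner (W * X) (E * Z)"
    using assms by (intro mat_inner_mult_right[of _ m q _ n]) auto
  also have "\<dots> = mat_inner X (W\<^sup>T * (E * Z))"
    using assms by (intro mat_inner_mult_left[of _ m p _ q]) auto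
  also have "W\<^sup>T * (E * Z) = 0\<^sub>m p q"
    using assms by (subst assoc_mult_mat[symmetric, of _ p m _ n _ q]) auto
  also have "mat_inner X (0\<^sub>m p q) = 0"
    using assms by (intro mat_inner_zero)
  also have "fsq (W * X * Z\<^sup>T) = fsq (W * X)"
    using assms by (intro fsq_isometry_right[of _ n q _ m]) auto
  also have "\<dots> = fsq X"
    using assms by (intro fsq_isometry[of _ m p _ q]) auto
  finally show ?thesis by simp
qed

text \<open>Lifting by \<open>W\<close> and \<open>Z\<close> and compressing again is the identity,
  so the compression of \<open>G\<close> cancels against that of its lifted compression.\<close>

lemma residual_orthogonal:
  assumes "W \<in> carrier_mat m p" "W\<^sup>T * W = 1\<^sub>m p"
    and "Z \<in> carrier_mat n q" "Z\<^sup>T * Z = 1\<^sub>m q" and G: "(G :: real mat) \<in> carrier_mat m n"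
  shows "W\<^sup>T * (G - W * (W\<^sup>T * G * Z) * Z\<^sup>T) * Z = 0\<^sub>m p q"
proof -
  define K where "K = W\<^sup>T * G * Z"
  have K: "K \<in> carrier_mat p q" unfolding K_def using assms by auto
  note d = carrier_matD[OF assms(1)] carrier_matD[OF assms(3)] carrier_matD[OF G] carrier_matD[OF K]
  have WW: "W\<^sup>T * (W * Y) = Y" if "dim_row Y = p" for Y
    using that d mat_assoc[of "W\<^sup>T" W Y] by (simp add: assms)
  have "W\<^sup>T * (G - W * K * Z\<^sup>T) * Z = W\<^sup>T * (G * Z) - K * (Z\<^sup>T * Z)"
    using d by (simp add: mat_assoc mat_distrib WW del: assms(4))
  also have "\<dots> = K - K" using K d by (simp add: K_def assms mat_assoc)
  finally show ?thesis using K by (simp add: K_def[symmetric])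
qed

text \<open>\<open>G\<close> splits orthogonally into its residual and the lifted compression, and
  the latter has the norm of the compression.\<close>

lemma fsq_compress_le:
  assumes "W \<in> carrier_mat m p" "W\<^sup>T * W = 1\<^sub>m p"
    and "Z \<in> carrier_mat n q" "Z\<^sup>T * Z = 1\<^sub>m q" and G: "G \<in> carrier_mat m n"
  shows "fsq (W\<^sup>T * G * Z) \<le> fsq G"
proof -
  define K where "K = W\<^sup>T * G * Z"
  have K: "K \<in> carrier_mat p q" unfolding K_def using assms by auto
  define E where "E = G - W * K * Z\<^sup>T"
  have E: "E \<in> carrier_mat m n" unfolding E_def using assms K by auto
  have "G = E + W * K * Z\<^sup>T"
    unfolding E_def using assms K by (intro eq_matI) auto
  then have "fsq G = fsq (E + W * K * Z\<^sup>T)" by simp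
  also have "\<dots> = fsq E + fsq K"
    using residual_orthogonal[OF assms] assms K E
    by (intro fsq_pythagoras[of _ m p _ n q]) (auto simp: E_def K_def)
  finally show ?thesis using fsq_nonneg[of E] by (simp add: K_def)
qed

text \<open>The two parts of \<open>G - P G Q = (G - P G) + P (G - G Q)\<close> are orthogonal.\<close>

lemma fsq_two_sided_le:
  assumes W: "W \<in> carrier_mat m p" "W\<^sup>T * W = 1\<^sub>m p"
    and Z: "Z \<in> carrier_mat n q" and G: "G \<in> carrier_mat m n"
  shows "fsq (G - W * W\<^sup>T * G * Z * Z\<^sup>T) \<le> fsq (G - W * W\<^sup>T * G) + fsq (G - G * Z * Z\<^sup>T)"
proof -
  define Y where "Y = G - G * Z * Z\<^sup>T"
  define E where "E = G - W * W\<^sup>T * G"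
  have c: "Y \<in> carrier_mat m n" "E \<in> carrier_mat m n" unfolding Y_def E_def using assms by auto
  note d = carrier_matD[OF W(1)] carrier_matD[OF Z] carrier_matD[OF G] carrier_matD[OF c(1)]
  \<comment> \<open>The identity matrix serves as the second isometry, so the two-sided lemmas can
    be used for a projection acting from the left only.\<close>
  have "W * (W\<^sup>T * Y) * (1\<^sub>m n)\<^sup>T = W * W\<^sup>T * G - W * W\<^sup>T * G * Z * Z\<^sup>T"
    using d c by (simp add: Y_def mat_assoc mat_distrib)
  then have 1: "G - W * W\<^sup>T * G * Z * Z\<^sup>T = E + W * (W\<^sup>T * Y) * (1\<^sub>m n)\<^sup>T"
    unfolding E_def using assms by (intro eq_matI) auto
  have 2: "W\<^sup>T * E * 1\<^sub>m n = 0\<^sub>m p n"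
  proof -
    have "G - W * (W\<^sup>T * G * 1\<^sub>m n) * (1\<^sub>m n)\<^sup>T = E"
      unfolding E_def using d by (simp add: mat_assoc)
    then show ?thesis using residual_orthogonal[OF W, of "1\<^sub>m n" n n G] assms by simp
  qed
  have "fsq (G - W * W\<^sup>T * G * Z * Z\<^sup>T) = fsq E + fsq (W\<^sup>T * Y)"
    unfolding 1 using assms c 2 by (intro fsq_pythagoras[of _ m p _ n n]) auto
  also have "fsq (W\<^sup>T * Y) \<le> fsq Y"
    using fsq_compress_le[OF W, of "1\<^sub>m n" n n Y] c W by simp
  finally show ?thesis by (simp add: Y_def E_def)
qed

section \<open>Block-diagonal matrices\<close>

text \<open>Equal block sizes permit an entry formula by \<open>div\<close> and \<open>mod\<close>
  in place of the recursion over a list in \<open>diag_block_mat\<close>.\<close>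

definition bdm :: "nat \<Rightarrow> nat \<Rightarrow> nat \<Rightarrow> (nat \<Rightarrow> real mat) \<Rightarrow> real mat" where
  "bdm n m p f = mat (n * m) (n * p)
     (\<lambda>(a,b). if a div m = b div p then f (a div m) $$ (a mod m, b mod p) else 0)"

text \<open>Height and width of the blocks are separate parameters because half-compressed products
  have blocks with \<open>k\<close> rows and \<open>2 * k\<close> columns, or the reverse.\<close>

definition blk :: "nat \<Rightarrow> nat \<Rightarrow> nat \<Rightarrow> nat \<Rightarrow> real mat \<Rightarrow> real mat" where
  "blk m p i j X = mat m p (\<lambda>(a,b). X $$ (i * m + a, j * p + b))"

lemma dim_bdm [simp]: "dim_row (bdm n m p f) = n * m" "dim_col (bdm n m p f) = n * p"
  by (simp_all add: bdm_def)

lemma bdm_carrier [simp]: "bdm n m p f \<in> carrier_mat (n * m) (n * p)"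
  by (simp add: bdm_def)

lemma dim_blk [simp]: "dim_row (blk m p i j X) = m" "dim_col (blk m p i j X) = p"
  by (simp_all add: blk_def)

lemma blk_carrier [simp]: "blk m p i j X \<in> carrier_mat m p"
  by (simp add: blk_def)

lemma block_index_less: "i < n \<Longrightarrow> a < m \<Longrightarrow> i * m + a < n * (m::nat)"
proof -
  assume "i < n" "a < m"
  then have "i * m + a < Suc i * m" by simp
  also have "\<dots> \<le> n * m" using \<open>i < n\<close> by (intro mult_right_mono) auto
  finally show ?thesis .
qed

lemma sum_blocks: "(\<Sum>c<n * p. g c) = (\<Sum>i<n. \<Sum>r<p. g (i * p + r))" for p :: nat
  unfolding sum.nat_group[symmetric]
proof (rule sum.cong[OF refl])
  fix i
  show "sum g {i * p..<i * p + p} = (\<Sum>r<p. g (i * p + r))"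
    using sum.shift_bounds_nat_ivl[of g 0 "i * p" p] by (simp add: atLeast0LessThan add.commute)
qed

lemma bdm_cong: "(\<And>i. i < n \<Longrightarrow> f i = g i) \<Longrightarrow> bdm n m p f = bdm n m p g"
  unfolding bdm_def by (intro eq_matI) (auto simp: less_mult_imp_div_less)

lemma eq_blkI:
  assumes "X \<in> carrier_mat (n * m) (n' * p)" "Y \<in> carrier_mat (n * m) (n' * p)"
    and eq: "\<And>i j. i < n \<Longrightarrow> j < n' \<Longrightarrow> blk m p i j X = blk m p i j Y"
  shows "X = Y"
proof (intro eq_matI)
  fix a b assume "a < dim_row Y" "b < dim_col Y"
  then have ab: "a < n * m" "b < n' * p" using assms by auto
  then have pos: "m > 0" "p > 0" by (auto intro: Nat.gr0I)
  have "blk m p (a div m) (b div p) X $$ (a mod m, b mod p)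
      = blk m p (a div m) (b div p) Y $$ (a mod m, b mod p)"
    using ab by (subst eq) (auto simp: less_mult_imp_div_less)
  then show "X $$ (a, b) = Y $$ (a, b)" using pos by (simp add: blk_def)
qed (use assms in auto)

lemma blk_bdm:
  assumes "i < n" "j < n" "f i \<in> carrier_mat m p"
  shows "blk m p i j (bdm n m p f) = (if i = j then f i else 0\<^sub>m m p)"
  using assms by (intro eq_matI) (auto simp: blk_def bdm_def block_index_less)

lemma blk_minus:
  assumes "X \<in> carrier_mat (n * m) (n' * p)" "Y \<in> carrier_mat (n * m) (n' * p)" "i < n" "j < n'"
  shows "blk m p i j (X - Y) = blk m p i j X - blk m p i j Y"
  using assms by (intro eq_matI) (auto simp: blk_def block_index_less)

lemma blk_transpose:
  assumes "X \<in> carrier_mat (n * m) (n' * p)" "i < n" "j < n'"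
  shows "blk p m j i X\<^sup>T = (blk m p i j X)\<^sup>T"
  using assms by (intro eq_matI) (auto simp: blk_def block_index_less)

lemma transpose_bdm:
  assumes "\<And>i. i < n \<Longrightarrow> f i \<in> carrier_mat m p"
  shows "(bdm n m p f)\<^sup>T = bdm n p m (\<lambda>i. (f i)\<^sup>T)"
proof (intro eq_matI)
  fix a b assume "a < dim_row (bdm n p m (\<lambda>i. (f i)\<^sup>T))" "b < dim_col (bdm n p m (\<lambda>i. (f i)\<^sup>T))"
  then have ab: "a < n * p" "b < n * m" by auto
  then have "a mod p < p" "b mod m < m" by (auto intro!: mod_less_divisor Nat.gr0I)
  moreover have "a div p < n" using ab by (simp add: less_mult_imp_div_less)
  ultimately show "(bdm n m p f)\<^sup>T $$ (a, b) = bdm n p m (\<lambda>i. (f i)\<^sup>T) $$ (a, b)"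
    using ab assms[of "a div p"] by (auto simp: bdm_def)
qed auto

text \<open>In the sum over the inner index only the group of block \<open>i\<close> survives. The
  columns of \<open>X\<close> may be partitioned arbitrarily, even into a single block.\<close>

lemma blk_bdm_mult:
  assumes f: "f i \<in> carrier_mat m p" and X: "X \<in> carrier_mat (n * p) (n' * q)"
    and i: "i < n" and j: "j < n'"
  shows "blk m q i j (bdm n m p f * X) = f i * blk p q i j X"
proof (intro eq_matI)
  fix a b assume "a < dim_row (f i * blk p q i j X)" "b < dim_col (f i * blk p q i j X)"
  then have a: "a < m" and b: "b < q" using f by auto
  have "blk m q i j (bdm n m p f * X) $$ (a,b) = (\<Sum>c<n * p. bdm n m p f $$ (i * m + a, c) * X $$ (c, j * q + b))"
    using a b i j mult_entry[OF bdm_carrier X, of "i * m + a" m "j * q + b" f]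
    by (simp add: blk_def block_index_less del: index_mult_mat(1))
  also have "\<dots> = (\<Sum>i'<n. \<Sum>r<p. (if i' = i then f i $$ (a, r) * X $$ (i * p + r, j * q + b) else 0))"
    unfolding sum_blocks
    by (intro sum.cong refl) (use a i in \<open>auto simp: bdm_def block_index_less\<close>)
  also have "\<dots> = (\<Sum>i'<n. if i' = i then (\<Sum>r<p. f i $$ (a, r) * X $$ (i * p + r, j * q + b)) else 0)"
    by (intro sum.cong refl) auto
  also have "\<dots> = (\<Sum>r<p. f i $$ (a, r) * X $$ (i * p + r, j * q + b))"
    using i by simp
  also have "\<dots> = (f i * blk p q i j X) $$ (a,b)"
    using a b by (subst mult_entry[OF f blk_carrier]) (auto simp: blk_def)
  finally show "blk m q i j (bdm n m p f * X) $$ (a, b) = (f i * blk p q i j X) $$ (a,b)" .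
qed (use f in auto)

text \<open>The transpose of the rule for multiplication from the left.\<close>

lemma blk_mult_bdm_transpose:
  assumes g: "\<And>j. j < n' \<Longrightarrow> g j \<in> carrier_mat q p" and X: "X \<in> carrier_mat (n * m) (n' * p)"
    and i: "i < n" and j: "j < n'"
  shows "blk m q i j (X * (bdm n' q p g)\<^sup>T) = blk m p i j X * (g j)\<^sup>T"
proof -
  have "blk m q i j (X * (bdm n' q p g)\<^sup>T) = (blk q m j i (bdm n' q p g * X\<^sup>T))\<^sup>T"
    using X i j by (subst blk_transpose[of _ n' q n m, symmetric]) (auto simp: mat_transpose_mult)
  also have "\<dots> = (g j * blk p m j i X\<^sup>T)\<^sup>T"
    using assms by (subst blk_bdm_mult[of _ _ _ _ _ _ n]) auto
  also have "\<dots> = blk m p i j X * (g j)\<^sup>T"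
    using g[OF j] blk_transpose[OF X i j] by (simp add: mat_transpose_mult)
  finally show ?thesis .
qed

lemma blk_mult_bdm:
  assumes g: "\<And>j. j < n' \<Longrightarrow> g j \<in> carrier_mat p q" and X: "X \<in> carrier_mat (n * m) (n' * p)"
    and i: "i < n" and j: "j < n'"
  shows "blk m q i j (X * bdm n' p q g) = blk m p i j X * g j"
  using blk_mult_bdm_transpose[of n' "\<lambda>i. (g i)\<^sup>T" q p X n m i j] transpose_bdm[of n' g p q] assms
  by (metis transpose_transpose carrier_matD transpose_carrier_mat)

lemma bdm_mult:
  assumes f: "\<And>i. i < n \<Longrightarrow> f i \<in> carrier_mat m p" and g: "\<And>i. i < n \<Longrightarrow> g i \<in> carrier_mat p q"
  shows "bdm n m p f * bdm n p q g = bdm n m q (\<lambda>i. f i * g i)"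
proof (rule eq_blkI[of _ n m n q])
  fix i j assume ij: "i < n" "j < n"
  have "f i * 0\<^sub>m p q = 0\<^sub>m m q" using f[OF ij(1)] by simp
  then show "blk m q i j (bdm n m p f * bdm n p q g) = blk m q i j (bdm n m q (\<lambda>i. f i * g i))"
    using ij f[OF ij(1)] g[OF ij(1)] g[OF ij(2)]
    by (subst blk_bdm_mult[of _ _ _ _ _ _ n]) (auto simp: blk_bdm)
qed (auto simp: carrier_matI)

lemma bdm_one: "bdm n k k (\<lambda>_. 1\<^sub>m k) = 1\<^sub>m (n * k)"
proof (intro eq_matI)
  fix a b assume "a < dim_row (1\<^sub>m (n * k) :: real mat)" "b < dim_col (1\<^sub>m (n * k) :: real mat)"
  then have ab: "a < n * k" "b < n * k" by auto
  then have "a mod k < k" "b mod k < k" by (auto intro!: mod_less_divisor Nat.gr0I)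
  moreover have "a = b \<longleftrightarrow> a div k = b div k \<and> a mod k = b mod k"
    by (metis div_mult_mod_eq)
  ultimately show "bdm n k k (\<lambda>_. 1\<^sub>m k) $$ (a, b) = 1\<^sub>m (n * k) $$ (a, b)"
    using ab unfolding bdm_def by (cases "a = b") simp_all
qed auto

lemma bdm_add:
  assumes f: "\<And>i. i < n \<Longrightarrow> f i \<in> carrier_mat m p" and g: "\<And>i. i < n \<Longrightarrow> g i \<in> carrier_mat m p"
  shows "bdm n m p f + bdm n m p g = bdm n m p (\<lambda>i. f i + g i)"
proof (intro eq_matI)
  fix a b assume "a < dim_row (bdm n m p (\<lambda>i. f i + g i))" "b < dim_col (bdm n m p (\<lambda>i. f i + g i))"
  then have ab: "a < n * m" "b < n * p" by auto
  then have "a mod m < m" "b mod p < p" by (auto intro!: mod_less_divisor Nat.gr0I)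
  moreover have "a div m < n" using ab by (simp add: less_mult_imp_div_less)
  ultimately show "(bdm n m p f + bdm n m p g) $$ (a,b) = bdm n m p (\<lambda>i. f i + g i) $$ (a,b)"
    using ab carrier_matD[OF f[of "a div m"]] carrier_matD[OF g[of "a div m"]]
    by (cases "a div m = b div p") (simp_all add: bdm_def)
qed auto

lemma bdm_minus:
  assumes f: "\<And>i. i < n \<Longrightarrow> f i \<in> carrier_mat m p" and g: "\<And>i. i < n \<Longrightarrow> g i \<in> carrier_mat m p"
  shows "bdm n m p f - bdm n m p g = bdm n m p (\<lambda>i. f i - g i)"
proof (intro eq_matI)
  fix a b assume "a < dim_row (bdm n m p (\<lambda>i. f i - g i))" "b < dim_col (bdm n m p (\<lambda>i. f i - g i))"
  then have ab: "a < n * m" "b < n * p" by auto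
  then have "a mod m < m" "b mod p < p" by (auto intro!: mod_less_divisor Nat.gr0I)
  moreover have "a div m < n" using ab by (simp add: less_mult_imp_div_less)
  ultimately show "(bdm n m p f - bdm n m p g) $$ (a,b) = bdm n m p (\<lambda>i. f i - g i) $$ (a,b)"
    using ab carrier_matD[OF f[of "a div m"]] carrier_matD[OF g[of "a div m"]]
    by (cases "a div m = b div p") (simp_all add: bdm_def)
qed auto

lemma bdm_orthonormal:
  assumes "\<And>i. i < n \<Longrightarrow> f i \<in> carrier_mat m p" "\<And>i. i < n \<Longrightarrow> (f i)\<^sup>T * f i = 1\<^sub>m p"
  shows "(bdm n m p f)\<^sup>T * bdm n m p f = 1\<^sub>m (n * p)"
proof -
  have "(bdm n m p f)\<^sup>T * bdm n m p f = bdm n p p (\<lambda>i. (f i)\<^sup>T * f i)"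
    using assms by (simp add: transpose_bdm bdm_mult)
  also have "\<dots> = bdm n p p (\<lambda>_. 1\<^sub>m p)" using assms by (intro bdm_cong) auto
  finally show ?thesis by (simp add: bdm_one)
qed

text \<open>Two neighbouring small blocks form one block of the next coarser level. This is how
  block-diagonal factors with \<open>k\<close>-by-\<open>k\<close> blocks become factors with the
  \<open>2 * k\<close>-by-\<open>2 * k\<close> blocks of the level below.\<close>

lemma bdm_pair: "bdm (2 * n) k p f = bdm n (2 * k) (2 * p) (\<lambda>i. bdm 2 k p (\<lambda>j. f (2 * i + j)))"
proof (intro eq_matI)
  fix a b assume "a < dim_row (bdm n (2 * k) (2 * p) (\<lambda>i. bdm 2 k p (\<lambda>j. f (2 * i + j))))"
    "b < dim_col (bdm n (2 * k) (2 * p) (\<lambda>i. bdm 2 k p (\<lambda>j. f (2 * i + j))))"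
  then have ab: "a < 2 * n * k" "b < 2 * n * p" by (auto simp: ac_simps)
  have *: "2 * (c div (2 * q)) + (c mod (2 * q)) div q = c div q" "c mod (2 * q) mod q = c mod q"
    "c mod (2 * q) < 2 * q" if "c < 2 * n * q" for c q :: nat
  proof -
    have "q > 0" using that by (auto intro: Nat.gr0I)
    then show "c mod (2 * q) < 2 * q" by simp
    show "c mod (2 * q) mod q = c mod q" by (simp add: mod_mod_cancel)
    have "c div q = (c div (2 * q) * (2 * q) + c mod (2 * q)) div q"
      by (simp only: div_mult_mod_eq)
    also have "\<dots> = (c mod (2 * q) + (2 * (c div (2 * q))) * q) div q" by (simp add: ac_simps)
    also have "\<dots> = 2 * (c div (2 * q)) + (c mod (2 * q)) div q"
      using \<open>q > 0\<close> by (subst div_mult_self1) auto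
    finally show "2 * (c div (2 * q)) + (c mod (2 * q)) div q = c div q" by simp
  qed
  have r: "c mod (2 * q) div q < 2" if "c < 2 * n * q" for c q :: nat
    using *(3)[OF that] by (simp add: less_mult_imp_div_less mult.commute)
  \<comment> \<open>A number determines its half and its parity: two small blocks coincide exactly
    when they lie in the same pair and at the same position in it.\<close>
  have "2 * x + u = 2 * y + v \<longleftrightarrow> x = y \<and> u = v" if "u < 2" "v < 2" for x y u v :: nat
    using that by presburger
  from this[OF r[OF ab(1)] r[OF ab(2)], of "a div (2 * k)" "b div (2 * p)"]
  have eq: "a div k = b div p \<longleftrightarrow> a div (2 * k) = b div (2 * p) \<and> a mod (2 * k) div k = b mod (2 * p) div p"
    by (simp only: *(1)[OF ab(1)] *(1)[OF ab(2)])
  have ab': "a < n * (2 * k)" "b < n * (2 * p)" using ab by (simp_all add: ac_simps)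
  show "bdm (2 * n) k p f $$ (a,b) = bdm n (2 * k) (2 * p) (\<lambda>i. bdm 2 k p (\<lambda>j. f (2 * i + j))) $$ (a,b)"
    unfolding bdm_def
    by (simp only: index_mat(1)[OF ab] index_mat(1)[OF ab'] split_conv eq *[OF ab(1)] *[OF ab(2)]
        index_mat(1)[OF *(3)[OF ab(1)] *(3)[OF ab(2)]] if_cancel split: if_split) blast
qed auto

lemma fsq_blk:
  assumes "X \<in> carrier_mat (n * m) (n' * p)"
  shows "fsq X = (\<Sum>i<n. \<Sum>j<n'. fsq (blk m p i j X))"
proof -
  have "fsq X = (\<Sum>i<n. \<Sum>a<m. \<Sum>j<n'. \<Sum>b<p. (X $$ (i * m + a, j * p + b))\<^sup>2)"
    using assms by (simp add: fsq_def sum_blocks)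
  also have "\<dots> = (\<Sum>i<n. \<Sum>j<n'. \<Sum>a<m. \<Sum>b<p. (X $$ (i * m + a, j * p + b))\<^sup>2)"
    by (intro sum.cong refl sum.swap)
  finally show ?thesis by (simp add: fsq_def blk_def)
qed

text \<open>Induction on the number of blocks, splitting off the first one: beyond it, subtracting
  the block size lowers the quotient by one and keeps the remainder.\<close>

lemma diag_block_mat_bdm:
  assumes "\<And>i. i < n \<Longrightarrow> f i \<in> carrier_mat m p"
  shows "diag_block_mat (map f [0..<n]) = bdm n m p f"
  using assms
proof (induction n arbitrary: f)
  case 0
  then show ?case by (intro eq_matI) auto
next
  case (Suc n)
  define R where "R = bdm n m p (\<lambda>i. f (Suc i))"
  have IH: "diag_block_mat (map (\<lambda>i. f (Suc i)) [0..<n]) = R"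
    unfolding R_def using Suc by auto
  have f0: "f 0 \<in> carrier_mat m p" using Suc by auto
  have "map f [0..<Suc n] = f 0 # map (\<lambda>i. f (Suc i)) [0..<n]"
    by (simp add: upt_conv_Cons map_Suc_upt[symmetric] del: upt_Suc)
  then have "diag_block_mat (map f [0..<Suc n])
      = four_block_mat (f 0) (0\<^sub>m m (n * p)) (0\<^sub>m (n * m) p) R"
    using f0 by (simp add: IH Let_def R_def)
  also have "\<dots> = bdm (Suc n) m p f"
  proof (intro eq_matI)
    fix a b assume "a < dim_row (bdm (Suc n) m p f)" "b < dim_col (bdm (Suc n) m p f)"
    then have ab: "a < m + n * m" "b < p + n * p" by auto
    then have pos: "m > 0" "p > 0" by (auto intro: Nat.gr0I)
    have *: "(c < q \<longrightarrow> c div q = 0 \<and> c mod q = c) \<and> (\<not> c < q \<longrightarrow> c div q = Suc ((c - q) div q) \<and> c mod q = (c - q) mod q)"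
      if "q > 0" for c q :: nat
      using that by (auto simp: le_div_geq le_mod_geq not_less)
    show "four_block_mat (f 0) (0\<^sub>m m (n * p)) (0\<^sub>m (n * m) p) R $$ (a,b) = bdm (Suc n) m p f $$ (a,b)"
      using ab f0 *[OF pos(1), of a] *[OF pos(2), of b] by (auto simp: bdm_def R_def)
  qed (use f0 in \<open>auto simp: R_def\<close>)
  finally show ?case .
qed

section \<open>QR factorization and rank\<close>

text \<open>Vectors are plain functions of which only the first \<open>m\<close> values count; this
  avoids dimension conditions during orthogonalisation.\<close>

definition dot :: "nat \<Rightarrow> (nat \<Rightarrow> real) \<Rightarrow> (nat \<Rightarrow> real) \<Rightarrow> real" where
  "dot m u v = (\<Sum>a<m. u a * v a)"

lemma dot_minus_right: "dot m u (\<lambda>a. v a - w a) = dot m u v - dot m u w"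
  by (simp add: dot_def algebra_simps sum_subtractf)

lemma dot_scale_right: "dot m u (\<lambda>a. v a * c) = dot m u v * c"
  by (simp add: dot_def sum_distrib_right mult.assoc)

lemma dot_sum_right: "dot m u (\<lambda>a. \<Sum>i\<in>I. v i a) = (\<Sum>i\<in>I. dot m u (v i))"
  unfolding dot_def sum_distrib_left by (rule sum.swap)

text \<open>The new vector is the normalised component of \<open>x\<close> orthogonal to the given
  ones. If that component is zero, any unit vector orthogonal to them will do, with coefficient
  \<open>d = 0\<close>; one exists because \<open>j < m\<close>. This second case makes the later QR
  factorization work for linearly dependent columns.\<close>

lemma extend_orthonormal:
  fixes q :: "nat \<Rightarrow> nat \<Rightarrow> real"
  assumes q: "\<And>i i'. i < j \<Longrightarrow> i' < j \<Longrightarrow> dot m (q i) (q i') = (if i = i' then 1 else 0)"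
    and jm: "j < m"
  shows "\<exists>u d. dot m u u = 1 \<and> (\<forall>i<j. dot m (q i) u = 0) \<and>
    (\<forall>a<m. x a = (\<Sum>i<j. q i a * dot m (q i) x) + u a * d)"
proof -
  define res where "res y = (\<lambda>a. y a - (\<Sum>i<j. q i a * dot m (q i) y))" for y :: "nat \<Rightarrow> real"
  have orth: "dot m (q i) (res y) = 0" if "i < j" for i y
  proof -
    have "dot m (q i) (res y) = dot m (q i) y - (\<Sum>i'<j. dot m (q i) (q i') * dot m (q i') y)"
      unfolding res_def dot_minus_right dot_sum_right dot_scale_right ..
    also have "(\<Sum>i'<j. dot m (q i) (q i') * dot m (q i') y) = (\<Sum>i'<j. if i' = i then dot m (q i) y else 0)"
      by (intro sum.cong refl) (use that q in auto)
    finally show ?thesis using that by simp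
  qed
  have normalise: "\<exists>s>0. dot m (\<lambda>a. y a * s) (\<lambda>a. y a * s) = 1" if "dot m y y \<noteq> 0" for y
  proof (intro exI conjI)
    have "dot m y y \<ge> 0" by (auto simp: dot_def intro: sum_nonneg)
    with that have pos: "dot m y y > 0" by simp
    then show "1 / sqrt (dot m y y) > 0" by simp
    have scale: "dot m (\<lambda>a. y a * s) (\<lambda>a. y a * s) = dot m y y * (s * s)" for s
      by (simp add: dot_def sum_distrib_left sum_distrib_right ac_simps)
    have "dot m y y * (1 / sqrt (dot m y y) * (1 / sqrt (dot m y y))) = 1"
      using pos by simp
    then show "dot m (\<lambda>a. y a * (1 / sqrt (dot m y y))) (\<lambda>a. y a * (1 / sqrt (dot m y y))) = 1"
      by (simp only: scale)
  qed
  show ?thesis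
  proof (cases "dot m (res x) (res x) = 0")
    case False
    then obtain s where s: "s > 0" "dot m (\<lambda>a. res x a * s) (\<lambda>a. res x a * s) = 1"
      using normalise by blast
    have "x a = (\<Sum>i<j. q i a * dot m (q i) x) + res x a * s * (1 / s)" for a
      using s(1) by (simp add: res_def)
    then show ?thesis using s(2) orth
      by (intro exI[of _ "\<lambda>a. res x a * s"] exI[of _ "1 / s"]) (simp add: dot_scale_right)
  next
    case True
    then have "res x a = 0" if "a < m" for a
      using that by (simp add: dot_def sum_nonneg_eq_0_iff)
    then have x: "x a = (\<Sum>i<j. q i a * dot m (q i) x)" if "a < m" for a
      using that by (simp add: res_def)
    define e where "e t = (\<lambda>a. if a = t then 1 else 0 :: real)" for t :: nat
    \<comment> \<open>A trace argument: if every unit vector had zero diagonal residual, the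
      projection onto the span of the \<open>q i\<close> would have trace \<open>m\<close>, whereas
      its trace is \<open>j\<close>.\<close>
    have "\<exists>t<m. res (e t) t \<noteq> 0"
    proof (rule ccontr)
      assume "\<not> ?thesis"
      then have "res (e t) t = 0" if "t < m" for t using that by auto
      moreover have "dot m (q i) (e t) = q i t" if "t < m" for i t
        using that by (simp add: dot_def e_def if_distrib cong: if_cong)
      ultimately have "(\<Sum>i<j. q i t * q i t) = 1" if "t < m" for t
        using that by (force simp: res_def e_def)
      then have "real m = (\<Sum>t<m. \<Sum>i<j. q i t * q i t)" by simp
      also have "\<dots> = (\<Sum>i<j. dot m (q i) (q i))" unfolding dot_def by (rule sum.swap)
      also have "\<dots> = real j" using q by simp
      finally show False using jm by simp
    qed
    then obtain t where t: "t < m" "res (e t) t \<noteq> 0" by blast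
    then have "dot m (res (e t)) (res (e t)) \<noteq> 0"
      by (auto simp: dot_def sum_nonneg_eq_0_iff)
    then obtain s where s: "s > 0" "dot m (\<lambda>a. res (e t) a * s) (\<lambda>a. res (e t) a * s) = 1"
      using normalise by blast
    then show ?thesis using x orth
      by (intro exI[of _ "\<lambda>a. res (e t) a * s"] exI[of _ 0]) (simp add: dot_scale_right)
  qed
qed

lemma gram_schmidt_exists:
  fixes x :: "nat \<Rightarrow> nat \<Rightarrow> real"
  assumes "j \<le> m"
  shows "\<exists>q T. (\<forall>i<j. \<forall>i'<j. dot m (q i) (q i') = (if i = i' then 1 else 0)) \<and>
    (\<forall>i<j. \<forall>a<m. x i a = (\<Sum>i'<j. q i' a * T i' i))"
  using assms
proof (induction j)
  case 0
  then show ?case by auto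
next
  case (Suc j)
  then have jm: "j < m" by simp
  from Suc.IH[OF less_imp_le[OF jm]] obtain q T where
    qT: "(\<forall>i<j. \<forall>i'<j. dot m (q i) (q i') = (if i = i' then 1 else 0)) \<and>
      (\<forall>i<j. \<forall>a<m. x i a = (\<Sum>i'<j. q i' a * T i' i))" by (elim exE)
  then have q: "dot m (q i) (q i') = (if i = i' then 1 else 0)" if "i < j" "i' < j" for i i'
    using that by blast
  have T: "x i a = (\<Sum>i'<j. q i' a * T i' i)" if "i < j" "a < m" for i a
    using qT that by blast
  obtain u d where ud: "dot m u u = 1 \<and> (\<forall>i<j. dot m (q i) u = 0) \<and>
      (\<forall>a<m. x j a = (\<Sum>i<j. q i a * dot m (q i) (x j)) + u a * d)"
    using extend_orthonormal[of j m q "x j", OF _ jm] q by blast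
  have u: "dot m u u = 1" "dot m (q i) u = 0" if "i < j" for i
    using ud that by blast+
  have d: "x j a = (\<Sum>i<j. q i a * dot m (q i) (x j)) + u a * d" if "a < m" for a
    using ud that by blast
  have u': "dot m u (q i) = 0" if "i < j" for i
    using u(2)[OF that] by (simp add: dot_def mult.commute)
  define q' where "q' = q(j := u)"
  \<comment> \<open>Earlier columns keep their coefficients and get 0 against \<open>u\<close>;
    column \<open>j\<close> gets its inner products with the earlier vectors, and \<open>d\<close>
    against \<open>u\<close>.\<close>
  define T' where "T' = (\<lambda>i' i. if i' < j then (if i < j then T i' i else dot m (q i') (x j))
    else (if i < j then 0 else d))"
  have "dot m (q' i) (q' i') = (if i = i' then 1 else 0)" if "i < Suc j" "i' < Suc j" for i i'
    using that q[of i i'] u(2)[of i] u'[of i'] ud by (cases "i = j"; cases "i' = j") (simp_all add: q'_def)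
  moreover have "x i a = (\<Sum>i'<Suc j. q' i' a * T' i' i)" if "i < Suc j" "a < m" for i a
  proof (cases "i = j")
    case True
    have "(\<Sum>i'<j. q' i' a * T' i' j) = (\<Sum>i'<j. q i' a * dot m (q i') (x j))"
      by (intro sum.cong) (auto simp: q'_def T'_def)
    then show ?thesis using True d[OF that(2)] by (simp add: q'_def T'_def)
  next
    case False
    then have ij: "i < j" using that by simp
    have "(\<Sum>i'<j. q' i' a * T' i' i) = (\<Sum>i'<j. q i' a * T i' i)"
      using ij by (intro sum.cong) (auto simp: q'_def T'_def)
    then show ?thesis using ij T[OF ij that(2)] by (simp add: q'_def T'_def)
  qed
  ultimately show ?case by blast
qed

text \<open>No rank condition on \<open>X\<close>: \<open>T\<close> may be singular. The form suits
  products such as \<open>R i * U i\<close> with an arbitrary \<open>R i\<close>.\<close>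

lemma qr_exists:
  assumes X: "X \<in> carrier_mat m k" and "k \<le> m"
  shows "\<exists>Q T. Q \<in> carrier_mat m k \<and> T \<in> carrier_mat k k \<and> Q\<^sup>T * Q = 1\<^sub>m k \<and> X = Q * (T :: real mat)"
proof -
  obtain q T where q: "\<And>i i'. i < k \<Longrightarrow> i' < k \<Longrightarrow> dot m (q i) (q i') = (if i = i' then 1 else 0)"
    and T: "\<And>i a. i < k \<Longrightarrow> a < m \<Longrightarrow> X $$ (a,i) = (\<Sum>i'<k. q i' a * T i' i)"
    using gram_schmidt_exists[OF \<open>k \<le> m\<close>, of "\<lambda>i a. X $$ (a,i)"] by blast
  define Q where "Q = mat m k (\<lambda>(a,i). q i a)"
  define R where "R = mat k k (\<lambda>(i,j). T i j)"
  have Q: "Q \<in> carrier_mat m k" and R: "R \<in> carrier_mat k k" by (auto simp: Q_def R_def)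
  have "Q\<^sup>T * Q = 1\<^sub>m k"
  proof (intro eq_matI)
    fix i j assume "i < dim_row (1\<^sub>m k :: real mat)" "j < dim_col (1\<^sub>m k :: real mat)"
    then have ij: "i < k" "j < k" by auto
    then show "(Q\<^sup>T * Q) $$ (i,j) = 1\<^sub>m k $$ (i,j)"
      using q[OF ij] mult_entry[of "Q\<^sup>T" k m Q k i j] Q by (simp add: Q_def dot_def)
  qed (use Q in auto)
  moreover have "X = Q * R"
  proof (intro eq_matI)
    fix a i assume "a < dim_row (Q * R)" "i < dim_col (Q * R)"
    then have ai: "a < m" "i < k" using Q R by auto
    then show "X $$ (a,i) = (Q * R) $$ (a,i)"
      using T[OF ai(2) ai(1)] mult_entry[OF Q R ai] by (simp add: Q_def R_def)
  qed (use X Q R in auto)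
  ultimately show ?thesis using Q R by blast
qed

text \<open>A maximal independent set of columns has at most \<open>k\<close> elements and spans all
  columns. With the converse below, the constraint set of \<open>best_rank_approx\<close> becomes a
  set of products, to which QR and limits apply.\<close>

lemma rank_factorization:
  fixes Y :: "real mat"
  assumes Y: "Y \<in> carrier_mat m n" and r: "vec_space.rank m Y \<le> k"
  shows "\<exists>X Z. X \<in> carrier_mat m k \<and> Z \<in> carrier_mat k n \<and> Y = X * Z"
proof -
  interpret vec_space "TYPE(real)" m .
  have cV: "set (cols Y) \<subseteq> carrier_vec m" using cols_dim Y by blast
  obtain S where S: "maximal S (\<lambda>T. T \<subseteq> set (cols Y) \<and> lin_indpt T)"
    using maximal_exists_superset[of "set (cols Y)" "\<lambda>T. T \<subseteq> set (cols Y) \<and> lin_indpt T" "{}"]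
    by (metis (no_types, lifting) List.finite_set empty_subsetI finite_basis_exists subset_li_is_li fin_dim basis_def)
  then have SY: "S \<subseteq> set (cols Y)" and Sli: "lin_indpt S" by (auto simp: maximal_def)
  have Sc: "S \<subseteq> carrier_vec m" and fin: "finite S" using SY cV finite_subset by auto
  have card: "card S \<le> k" using rank_card_indpt[OF Y S] r by simp
  have "v \<in> span S" if "v \<in> set (cols Y)" for v
  proof (rule ccontr)
    assume v: "v \<notin> span S"
    have vc: "v \<in> carrier_vec m" using that cV by auto
    have "lin_indpt (S \<union> {v})"
      using lin_dep_iff_in_span[of S v] Sc Sli vc v span_mem[of S v] by auto
    moreover have "v \<notin> S" using v Sc span_mem by auto
    ultimately show False using S that SY unfolding maximal_def by blast
  qed
  then have "\<exists>a. \<forall>i<m. col Y j $ i = (\<Sum>x\<in>S. a x * x $ i)" if "j < n" for j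
  proof -
    have "col Y j \<in> span S"
      using that Y \<open>\<And>v. v \<in> set (cols Y) \<Longrightarrow> v \<in> span S\<close> by (auto simp: cols_def)
    then obtain a where "lincomb a S = col Y j" using fin Sc finite_in_span by metis
    then show ?thesis using lincomb_index[OF _ Sc, of _ a] by metis
  qed
  then obtain c where c: "\<And>j i. j < n \<Longrightarrow> i < m \<Longrightarrow> col Y j $ i = (\<Sum>x\<in>S. c j x * x $ i)" by metis
  obtain e where e: "bij_betw e {..<card S} S"
    using ex_bij_betw_nat_finite[OF fin] by (auto simp: atLeast0LessThan)
  \<comment> \<open>The rank may be smaller than \<open>k\<close>; the missing columns are filled
    with zeros.\<close>
  define X where "X = mat m k (\<lambda>(i,t). if t < card S then e t $ i else 0)"
  define Z where "Z = mat k n (\<lambda>(t,j). c j (e t))"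
  have XZ: "X \<in> carrier_mat m k" "Z \<in> carrier_mat k n" by (auto simp: X_def Z_def)
  have "Y = X * Z"
  proof (intro eq_matI)
    fix i j assume "i < dim_row (X * Z)" "j < dim_col (X * Z)"
    then have ij: "i < m" "j < n" using XZ by auto
    have "Y $$ (i,j) = (\<Sum>x\<in>S. c j x * x $ i)" using c[OF ij(2,1)] ij Y by simp
    also have "\<dots> = (\<Sum>t<card S. c j (e t) * e t $ i)"
      by (rule sum.reindex_bij_betw[OF e, symmetric])
    also have "\<dots> = (\<Sum>t<k. X $$ (i,t) * Z $$ (t,j))"
      using card ij by (intro sum.mono_neutral_cong_left) (auto simp: X_def Z_def)
    also have "\<dots> = (X * Z) $$ (i,j)" by (rule mult_entry[OF XZ ij, symmetric])
    finally show "Y $$ (i,j) = (X * Z) $$ (i,j)" .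
  qed (use Y XZ in auto)
  then show ?thesis using XZ by blast
qed

text \<open>The product is a sum of \<open>k\<close> matrices of rank at most one, column times row,
  and the rank is subadditive; \<open>P t\<close> is the partial sum of the first \<open>t\<close>
  of them.\<close>

lemma rank_mult_le:
  fixes X Z :: "real mat"
  assumes X: "X \<in> carrier_mat m k" and Z: "Z \<in> carrier_mat k n"
  shows "vec_space.rank m (X * Z) \<le> k"
proof -
  interpret vec_space "TYPE(real)" m .
  define P where "P t = mat m n (\<lambda>(i,j). \<Sum>c<t. X $$ (i,c) * Z $$ (c,j))" for t
  have "rank (P t) \<le> t" for t
  proof (induction t)
    case 0
    have "P 0 = 0\<^sub>m m n" by (auto simp: P_def)
    then show ?case using rank_0I by simp
  next
    case (Suc t)
    define G where "G = mat m n (\<lambda>(i,j). X $$ (i,t) * Z $$ (t,j))"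
    have "P (Suc t) = P t + G" by (auto simp: P_def G_def)
    then have "rank (P (Suc t)) \<le> rank (P t) + rank G"
      using rank_subadditive[of "P t" n G] by (simp add: P_def G_def)
    also have "rank G \<le> 1"
      by (rule rank_le_1_product_entries[of G n "\<lambda>i. X $$ (i,t)" "\<lambda>j. Z $$ (t,j)"]) (auto simp: G_def)
    finally show ?case using Suc by simp
  qed
  moreover have "X * Z = P k"
    using X Z mult_entry[OF X Z] by (intro eq_matI) (auto simp: P_def simp del: index_mult_mat(1))
  ultimately show ?thesis by simp
qed

section \<open>The class of HSS matrices\<close>

definition orthonormal_family :: "nat \<Rightarrow> nat \<Rightarrow> (nat \<Rightarrow> real mat) \<Rightarrow> bool" where
  "orthonormal_family k n U \<longleftrightarrow> (\<forall>i<n. U i \<in> carrier_mat (2 * k) k \<and> (U i)\<^sup>T * U i = 1\<^sub>m k)"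

lemma orthonormal_familyD:
  assumes "orthonormal_family k n U"
  shows "i < n \<Longrightarrow> U i \<in> carrier_mat (2 * k) k" "i < n \<Longrightarrow> (U i)\<^sup>T * U i = 1\<^sub>m k"
    "(bdm n (2 * k) k U)\<^sup>T * bdm n (2 * k) k U = 1\<^sub>m (n * k)"
  using assms by (auto simp: orthonormal_family_def intro!: bdm_orthonormal)

lemma hss_factors_Suc:
  "hss_factors (Suc l) k U V D \<longleftrightarrow> hss_factors l k U V D \<and>
     orthonormal_family k (2 ^ Suc l) (U (Suc l)) \<and> orthonormal_family k (2 ^ Suc l) (V (Suc l)) \<and>
     (\<forall>i<2 ^ Suc l. D (Suc l) i \<in> carrier_mat (2 * k) (2 * k))"
  unfolding hss_factors_def orthonormal_family_def orthonormal_cols_def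
  by (auto simp: atLeastAtMostSuc_conv simp del: power_Suc)

text \<open>Lets a new finest level be written over a family of factors without disturbing the
  coarser matrix.\<close>

lemma telescope_cong:
  assumes "\<And>j. j \<in> {1..l} \<Longrightarrow> U j = U' j" "\<And>j. j \<in> {1..l} \<Longrightarrow> V j = V' j" "\<And>j. j \<in> {1..l} \<Longrightarrow> D j = D' j"
  shows "telescope D0 U V D l = telescope D0 U' V' D' l"
  using assms by (induction l) (auto simp: blockdiag_def)

lemma blockdiag_bdm:
  assumes "\<And>i. i < 2 ^ l \<Longrightarrow> X l i \<in> carrier_mat m p"
  shows "blockdiag X l = bdm (2 ^ l) m p (X l)"
  unfolding blockdiag_def using assms by (rule diag_block_mat_bdm)

lemma blockdiag_bdm_Suc:
  assumes "n = 2 ^ Suc l" "\<And>i. i < n \<Longrightarrow> X (Suc l) i \<in> carrier_mat m p"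
  shows "blockdiag X (Suc l) = bdm n m p (X (Suc l))"
  unfolding assms(1) using assms(2) unfolding assms(1) by (rule blockdiag_bdm)

lemma HSS_0: "HSS 0 k = carrier_mat (2 * k) (2 * k)"
  unfolding HSS_def hss_factors_def by auto

text \<open>With the elimination rule that follows, it replaces the telescoping definition by an
  induction that handles the factors of a single level.\<close>

lemma HSS_SucI:
  fixes n l :: nat
  defines "n \<equiv> 2 ^ Suc l"
  assumes B: "B \<in> HSS l k" and U: "orthonormal_family k n U" and V: "orthonormal_family k n V"
    and D: "\<And>i. i < n \<Longrightarrow> D i \<in> carrier_mat (2 * k) (2 * k)"
  shows "bdm n (2 * k) k U * B * (bdm n (2 * k) k V)\<^sup>T + bdm n (2 * k) (2 * k) D \<in> HSS (Suc l) k"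
proof -
  obtain D0 U0 V0 D1 where B0: "B = telescope D0 U0 V0 D1 l"
    and D0: "D0 \<in> carrier_mat (2 * k) (2 * k)" and h: "hss_factors l k U0 V0 D1"
    using B unfolding HSS_def by auto
  let ?U = "U0(Suc l := U)" and ?V = "V0(Suc l := V)" and ?D = "D1(Suc l := D)"
  have "telescope D0 ?U ?V ?D l = B" unfolding B0 by (rule telescope_cong) auto
  moreover have h': "hss_factors (Suc l) k ?U ?V ?D"
    unfolding hss_factors_Suc using h U V D by (simp add: hss_factors_def n_def del: power_Suc)
  moreover have "blockdiag ?U (Suc l) = bdm n (2 * k) k U" "blockdiag ?V (Suc l) = bdm n (2 * k) k V"
    "blockdiag ?D (Suc l) = bdm n (2 * k) (2 * k) D"
    using orthonormal_familyD(1)[OF U] orthonormal_familyD(1)[OF V] D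
      blockdiag_bdm_Suc[OF n_def[THEN meta_eq_to_obj_eq], of ?U "2 * k" k]
      blockdiag_bdm_Suc[OF n_def[THEN meta_eq_to_obj_eq], of ?V "2 * k" k]
      blockdiag_bdm_Suc[OF n_def[THEN meta_eq_to_obj_eq], of ?D "2 * k" "2 * k"] by simp_all
  ultimately have "telescope D0 ?U ?V ?D (Suc l)
      = bdm n (2 * k) k U * B * (bdm n (2 * k) k V)\<^sup>T + bdm n (2 * k) (2 * k) D" by simp
  from this[symmetric] show ?thesis unfolding HSS_def mem_Collect_eq using D0 h' by (intro exI conjI)
qed

lemma HSS_SucE:
  fixes n l :: nat
  defines "n \<equiv> 2 ^ Suc l"
  assumes "C \<in> HSS (Suc l) k"
  obtains U V D B where "B \<in> HSS l k" "orthonormal_family k n U" "orthonormal_family k n V"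
    "\<And>i. i < n \<Longrightarrow> D i \<in> carrier_mat (2 * k) (2 * k)"
    "C = bdm n (2 * k) k U * B * (bdm n (2 * k) k V)\<^sup>T + bdm n (2 * k) (2 * k) D"
proof -
  obtain D0 U V D where C: "C = telescope D0 U V D (Suc l)"
    and D0: "D0 \<in> carrier_mat (2 * k) (2 * k)" and h: "hss_factors (Suc l) k U V D"
    using assms unfolding HSS_def by auto
  have h': "hss_factors l k U V D" "orthonormal_family k n (U (Suc l))" "orthonormal_family k n (V (Suc l))"
    "\<And>i. i < n \<Longrightarrow> D (Suc l) i \<in> carrier_mat (2 * k) (2 * k)"
    using h unfolding hss_factors_Suc n_def by auto
  have "blockdiag U (Suc l) = bdm n (2 * k) k (U (Suc l))" "blockdiag V (Suc l) = bdm n (2 * k) k (V (Suc l))"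
    "blockdiag D (Suc l) = bdm n (2 * k) (2 * k) (D (Suc l))"
    using orthonormal_familyD(1)[OF h'(2)] orthonormal_familyD(1)[OF h'(3)] h'(4)
    by (auto intro!: blockdiag_bdm_Suc[OF n_def[THEN meta_eq_to_obj_eq]])
  then have "C = bdm n (2 * k) k (U (Suc l)) * telescope D0 U V D l * (bdm n (2 * k) k (V (Suc l)))\<^sup>T
      + bdm n (2 * k) (2 * k) (D (Suc l))" unfolding C by simp
  moreover have "telescope D0 U V D l \<in> HSS l k" unfolding HSS_def using D0 h' by blast
  ultimately show ?thesis using that h' by blast
qed

lemma HSS_carrier: "C \<in> HSS l k \<Longrightarrow> C \<in> carrier_mat (2 ^ l * (2 * k)) (2 ^ l * (2 * k))"
proof (cases l)
  case 0
  then show "C \<in> HSS l k \<Longrightarrow> ?thesis" by (simp add: HSS_0)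
next
  case (Suc l')
  assume "C \<in> HSS l k"
  then show ?thesis unfolding Suc by (elim HSS_SucE) auto
qed

text \<open>The finest diagonal factor absorbs the summand; at level 0 every matrix of the right
  size belongs to the class.\<close>

lemma HSS_add_bdm:
  assumes C: "C \<in> HSS l k" and D: "\<And>i. i < 2 ^ l \<Longrightarrow> D i \<in> carrier_mat (2 * k) (2 * k)"
  shows "C + bdm (2 ^ l) (2 * k) (2 * k) D \<in> HSS l k"
proof (cases l)
  case 0
  then show ?thesis using C by (auto simp: HSS_0)
next
  case (Suc l')
  define n :: nat where "n = 2 ^ Suc l'"
  obtain U V D' B where *: "B \<in> HSS l' k" "orthonormal_family k n U" "orthonormal_family k n V"
    "\<And>i. i < n \<Longrightarrow> D' i \<in> carrier_mat (2 * k) (2 * k)"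
    "C = bdm n (2 * k) k U * B * (bdm n (2 * k) k V)\<^sup>T + bdm n (2 * k) (2 * k) D'"
    using C unfolding Suc n_def by (elim HSS_SucE) blast
  have B: "B \<in> carrier_mat (n * k) (n * k)" using HSS_carrier[OF *(1)] by (simp add: n_def ac_simps)
  have D'': "D i \<in> carrier_mat (2 * k) (2 * k)" if "i < n" for i using D that by (simp add: Suc n_def)
  have "C + bdm n (2 * k) (2 * k) D
      = bdm n (2 * k) k U * B * (bdm n (2 * k) k V)\<^sup>T + (bdm n (2 * k) (2 * k) D' + bdm n (2 * k) (2 * k) D)"
    unfolding *(5) using B by (intro assoc_add_mat[of _ "n * (2 * k)" "n * (2 * k)"]) auto
  also have "bdm n (2 * k) (2 * k) D' + bdm n (2 * k) (2 * k) D = bdm n (2 * k) (2 * k) (\<lambda>i. D' i + D i)"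
    using *(4) D'' by (rule bdm_add)
  finally show ?thesis
    using HSS_SucI[OF *(1), of U V "\<lambda>i. D' i + D i"] *(2-4) D'' by (simp add: Suc n_def del: power_Suc)
qed

text \<open>\<open>B\<close> lives in the block structure of level \<open>l\<close>; the factors \<open>R U = Q T\<close> are reorthonormalised
  and \<open>T\<close> is absorbed by the next coarser level.\<close>

lemma HSS_mult_bdm:
  assumes "C \<in> HSS l k" "\<And>i. i < 2 ^ l \<Longrightarrow> R i \<in> carrier_mat (2 * k) (2 * k)"
    "\<And>i. i < 2 ^ l \<Longrightarrow> S i \<in> carrier_mat (2 * k) (2 * k)"
  shows "bdm (2 ^ l) (2 * k) (2 * k) R * C * (bdm (2 ^ l) (2 * k) (2 * k) S)\<^sup>T \<in> HSS l k"
  using assms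
proof (induction l arbitrary: C R S)
  case 0
  then show ?case by (auto simp: HSS_0)
next
  case (Suc l)
  define n :: nat where "n = 2 ^ Suc l"
  have n2: "n = 2 * 2 ^ l" by (simp add: n_def)
  obtain U V D B where *: "B \<in> HSS l k" "orthonormal_family k n U" "orthonormal_family k n V"
    "\<And>i. i < n \<Longrightarrow> D i \<in> carrier_mat (2 * k) (2 * k)"
    "C = bdm n (2 * k) k U * B * (bdm n (2 * k) k V)\<^sup>T + bdm n (2 * k) (2 * k) D"
    using Suc.prems(1) unfolding n_def by (elim HSS_SucE) blast
  have B: "B \<in> carrier_mat (n * k) (n * k)" using HSS_carrier[OF *(1)] by (simp add: n_def ac_simps)
  have R: "R i \<in> carrier_mat (2 * k) (2 * k)" and S: "S i \<in> carrier_mat (2 * k) (2 * k)"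
    and U: "U i \<in> carrier_mat (2 * k) k" and V: "V i \<in> carrier_mat (2 * k) k" if "i < n" for i
    using Suc.prems that orthonormal_familyD(1)[OF *(2)] orthonormal_familyD(1)[OF *(3)] by (auto simp: n_def)
  have "\<exists>Q T. Q \<in> carrier_mat (2 * k) k \<and> T \<in> carrier_mat k k \<and> Q\<^sup>T * Q = 1\<^sub>m k \<and> R i * U i = Q * T"
    if "i < n" for i using R[OF that] U[OF that] by (intro qr_exists) auto
  then obtain Q T where Q: "\<And>i. i < n \<Longrightarrow> Q i \<in> carrier_mat (2 * k) k" and T: "\<And>i. i < n \<Longrightarrow> T i \<in> carrier_mat k k"
    and QQ: "\<And>i. i < n \<Longrightarrow> (Q i)\<^sup>T * Q i = 1\<^sub>m k" and QT: "\<And>i. i < n \<Longrightarrow> R i * U i = Q i * T i" by metis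
  have "\<exists>Q T. Q \<in> carrier_mat (2 * k) k \<and> T \<in> carrier_mat k k \<and> Q\<^sup>T * Q = 1\<^sub>m k \<and> S i * V i = Q * T"
    if "i < n" for i using S[OF that] V[OF that] by (intro qr_exists) auto
  then obtain P T' where P: "\<And>i. i < n \<Longrightarrow> P i \<in> carrier_mat (2 * k) k" and T': "\<And>i. i < n \<Longrightarrow> T' i \<in> carrier_mat k k"
    and PP: "\<And>i. i < n \<Longrightarrow> (P i)\<^sup>T * P i = 1\<^sub>m k" and PT: "\<And>i. i < n \<Longrightarrow> S i * V i = P i * T' i" by metis
  define bR bS bD where "bR = bdm n (2 * k) (2 * k) R" and "bS = bdm n (2 * k) (2 * k) S"
    and "bD = bdm n (2 * k) (2 * k) D"
  define bU bV bQ bP where "bU = bdm n (2 * k) k U" and "bV = bdm n (2 * k) k V"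
    and "bQ = bdm n (2 * k) k Q" and "bP = bdm n (2 * k) k P"
  define bT bT' where "bT = bdm n k k T" and "bT' = bdm n k k T'"
  note defs = bR_def bS_def bD_def bU_def bV_def bQ_def bP_def bT_def bT'_def
  have d: "dim_row bR = n * (2 * k)" "dim_col bR = n * (2 * k)" "dim_row bS = n * (2 * k)" "dim_col bS = n * (2 * k)"
    "dim_row bD = n * (2 * k)" "dim_col bD = n * (2 * k)"
    "dim_row bU = n * (2 * k)" "dim_col bU = n * k" "dim_row bV = n * (2 * k)" "dim_col bV = n * k"
    "dim_row bQ = n * (2 * k)" "dim_col bQ = n * k" "dim_row bP = n * (2 * k)" "dim_col bP = n * k"
    "dim_row bT = n * k" "dim_col bT = n * k" "dim_row bT' = n * k" "dim_col bT' = n * k"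
    "dim_row B = n * k" "dim_col B = n * k"
    unfolding defs using B by auto
  have RU: "bR * bU = bQ * bT"
    unfolding defs by (simp add: bdm_mult R U Q T QT cong: bdm_cong)
  have SV: "bV\<^sup>T * bS\<^sup>T = bT'\<^sup>T * bP\<^sup>T"
  proof -
    have "bS * bV = bP * bT'"
      unfolding defs by (simp add: bdm_mult S V P T' PT cong: bdm_cong)
    then have "(bS * bV)\<^sup>T = (bP * bT')\<^sup>T" by simp
    then show ?thesis by (simp add: mat_transpose_mult d)
  qed
  have "bR * C * bS\<^sup>T = (bR * bU) * B * (bV\<^sup>T * bS\<^sup>T) + bR * bD * bS\<^sup>T"
    unfolding *(5) bU_def[symmetric] bV_def[symmetric] bD_def[symmetric]
    by (simp add: mat_distrib mat_assoc d)
  also have "\<dots> = bQ * (bT * B * bT'\<^sup>T) * bP\<^sup>T + bR * bD * bS\<^sup>T"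
    unfolding RU SV by (simp add: mat_assoc d)
  also have "bR * bD * bS\<^sup>T = bdm n (2 * k) (2 * k) (\<lambda>i. R i * D i * (S i)\<^sup>T)"
    unfolding defs using R S *(4) mult_carrier_mat[OF R *(4)] by (simp add: transpose_bdm bdm_mult)
  finally have eq: "bR * C * bS\<^sup>T = bQ * (bT * B * bT'\<^sup>T) * bP\<^sup>T + bdm n (2 * k) (2 * k) (\<lambda>i. R i * D i * (S i)\<^sup>T)" .
  have RDS: "R i * D i * (S i)\<^sup>T \<in> carrier_mat (2 * k) (2 * k)" if "i < n" for i
    using R[OF that] S[OF that] *(4)[OF that] unfolding carrier_mat_def by simp
  \<comment> \<open>The triangular role of \<open>T\<close> is irrelevant here: paired up, its
    blocks are arbitrary square blocks of level \<open>l\<close>, exactly what the induction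
    hypothesis accepts.\<close>
  have "bT * B * bT'\<^sup>T \<in> HSS l k"
    unfolding bT_def bT'_def n2 bdm_pair by (rule Suc.IH[OF *(1)]) simp_all
  then have "bR * C * bS\<^sup>T \<in> HSS (Suc l) k"
    unfolding eq bQ_def bP_def n_def
    by (rule HSS_SucI) (use Q QQ P PP RDS in \<open>simp_all add: orthonormal_family_def n_def\<close>)
  then show ?case by (simp add: bR_def bS_def n_def del: power_Suc)
qed

text \<open>For \<open>C = W B Z\<^sup>T + E\<close> the result is
  \<open>(U\<^sup>T W) B (Z\<^sup>T V) + U\<^sup>T (E - D) V\<close>. All new factors are
  block-diagonal with \<open>k\<close>-by-\<open>k\<close> blocks, hence after pairing
  block-diagonal at level \<open>l\<close>, where such multiplications and additions preserve the
  class.\<close>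

lemma HSS_compress:
  fixes n l :: nat
  defines "n \<equiv> 2 ^ Suc l"
  assumes C: "C \<in> HSS (Suc l) k" and UV: "orthonormal_family k n U" "orthonormal_family k n V"
    and D: "\<And>i. i < n \<Longrightarrow> D i \<in> carrier_mat (2 * k) (2 * k)"
  shows "(bdm n (2 * k) k U)\<^sup>T * (C - bdm n (2 * k) (2 * k) D) * bdm n (2 * k) k V \<in> HSS l k"
proof -
  obtain W Z E B where *: "B \<in> HSS l k" "orthonormal_family k n W" "orthonormal_family k n Z"
    "\<And>i. i < n \<Longrightarrow> E i \<in> carrier_mat (2 * k) (2 * k)"
    "C = bdm n (2 * k) k W * B * (bdm n (2 * k) k Z)\<^sup>T + bdm n (2 * k) (2 * k) E"
    using C unfolding n_def by (elim HSS_SucE) blast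
  have n2: "n = 2 * 2 ^ l" by (simp add: n_def)
  have B: "B \<in> carrier_mat (n * k) (n * k)" using HSS_carrier[OF *(1)] by (simp add: n_def ac_simps)
  note o = orthonormal_familyD(1)[OF UV(1)] orthonormal_familyD(1)[OF UV(2)]
    orthonormal_familyD(1)[OF *(2)] orthonormal_familyD(1)[OF *(3)]
  define bU bV bW bZ where "bU = bdm n (2 * k) k U" and "bV = bdm n (2 * k) k V"
    and "bW = bdm n (2 * k) k W" and "bZ = bdm n (2 * k) k Z"
  define bD bE where "bD = bdm n (2 * k) (2 * k) D" and "bE = bdm n (2 * k) (2 * k) E"
  note defs = bU_def bV_def bW_def bZ_def bD_def bE_def
  have d: "dim_row bU = n * (2 * k)" "dim_col bU = n * k" "dim_row bV = n * (2 * k)" "dim_col bV = n * k"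
    "dim_row bW = n * (2 * k)" "dim_col bW = n * k" "dim_row bZ = n * (2 * k)" "dim_col bZ = n * k"
    "dim_row bD = n * (2 * k)" "dim_col bD = n * (2 * k)" "dim_row bE = n * (2 * k)" "dim_col bE = n * (2 * k)"
    "dim_row B = n * k" "dim_col B = n * k"
    unfolding defs using B by auto
  have UED: "(U i)\<^sup>T * (E i - D i) \<in> carrier_mat k (2 * k)" if "i < n" for i
    using o(1)[OF that] *(4)[OF that] D[OF that] unfolding carrier_mat_def by simp
  have "bW * B * bZ\<^sup>T + bE - bD = bW * B * bZ\<^sup>T + (bE - bD)"
    by (intro eq_matI) (auto simp: d)
  then have "bU\<^sup>T * (C - bD) * bV = (bU\<^sup>T * bW) * B * (bZ\<^sup>T * bV) + bU\<^sup>T * (bE - bD) * bV"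
    unfolding *(5) bW_def[symmetric] bZ_def[symmetric] bE_def[symmetric]
    by (simp add: mat_distrib(1,3) mat_assoc d)
  also have "bZ\<^sup>T * bV = (bV\<^sup>T * bZ)\<^sup>T" by (simp add: mat_transpose_mult d)
  also have "bU\<^sup>T * bW = bdm n k k (\<lambda>i. (U i)\<^sup>T * W i)"
    unfolding defs using o by (simp add: transpose_bdm bdm_mult)
  also have "bV\<^sup>T * bZ = bdm n k k (\<lambda>i. (V i)\<^sup>T * Z i)"
    unfolding defs using o by (simp add: transpose_bdm bdm_mult)
  also have "bU\<^sup>T * (bE - bD) * bV = bdm n k k (\<lambda>i. (U i)\<^sup>T * (E i - D i) * V i)"
    unfolding defs using o *(4) D UED by (simp add: transpose_bdm bdm_mult bdm_minus minus_carrier_mat)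
  finally have eq: "bU\<^sup>T * (C - bD) * bV = bdm n k k (\<lambda>i. (U i)\<^sup>T * W i) * B * (bdm n k k (\<lambda>i. (V i)\<^sup>T * Z i))\<^sup>T
    + bdm n k k (\<lambda>i. (U i)\<^sup>T * (E i - D i) * V i)" .
  have "bU\<^sup>T * (C - bD) * bV \<in> HSS l k"
    unfolding eq n2 bdm_pair by (intro HSS_add_bdm HSS_mult_bdm *(1)) simp_all
  then show ?thesis by (simp add: defs)
qed

section \<open>HSS block-rows and block-columns\<close>

lemma mat_transpose_minus:
  fixes X Y :: "'a :: group_add mat"
  shows "dim_row X = dim_row Y \<Longrightarrow> dim_col X = dim_col Y \<Longrightarrow> (X - Y)\<^sup>T = X\<^sup>T - Y\<^sup>T"
  by (intro eq_matI) auto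

lemma mat_transpose_add:
  fixes X Y :: "'a :: plus mat"
  shows "dim_row X = dim_row Y \<Longrightarrow> dim_col X = dim_col Y \<Longrightarrow> (X + Y)\<^sup>T = X\<^sup>T + Y\<^sup>T"
  by (intro eq_matI) auto

text \<open>Turns sums over the positions in a submatrix into sums over the original indices. The
  cutoff \<open>m\<close> makes the index set finite when \<open>I\<close> is the complement of a
  block.\<close>

lemma bij_betw_pick:
  "bij_betw (pick I) {..<card {i. i < m \<and> i \<in> I}} {i. i < m \<and> i \<in> I}" (is "bij_betw _ {..<card ?K} _")
proof (rule bij_betw_byWitness[where f' = "\<lambda>i. card {a\<in>I. a < i}"])
  \<comment> \<open>\<open>card I\<close> is 0 for an infinite \<open>I\<close>, hence the
    disjunction.\<close>
  have ok: "a < card I \<or> infinite I" if "a < card ?K" for a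
  proof (cases "finite I")
    case True
    then have "card ?K \<le> card I" by (intro card_mono) auto
    then show ?thesis using that by simp
  qed simp
  show "\<forall>a\<in>{..<card ?K}. card {a'\<in>I. a' < pick I a} = a"
    using ok card_pick by auto
  show "\<forall>i\<in>?K. pick I (card {a\<in>I. a < i}) = i"
    using pick_card_in_set by auto
  show "pick I ` {..<card ?K} \<subseteq> ?K"
    using ok pick_in_set pick_le[of _ m I] by auto
  show "(\<lambda>i. card {a\<in>I. a < i}) ` ?K \<subseteq> {..<card ?K}"
    by (auto intro!: psubset_card_mono)
qed

lemma block_idx_iff: "k > 0 \<Longrightarrow> c \<in> block_idx k i \<longleftrightarrow> c div (2 * k) = i"
  unfolding block_idx_def
  using div_less_iff_less_mult[of "2 * k" c "Suc i"] less_eq_div_iff_mult_less_eq[of "2 * k" i c]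
  by (auto simp: ac_simps)

lemma pick_block_idx:
  assumes "a < 2 * k"
  shows "pick (block_idx k i) a = i * (2 * k) + a"
proof -
  have "{b \<in> block_idx k i. b < i * (2 * k) + a} = {i * (2 * k)..<i * (2 * k) + a}"
    using assms by (auto simp: block_idx_def algebra_simps)
  then have "card {b \<in> block_idx k i. b < i * (2 * k) + a} = a" by simp
  moreover have "i * (2 * k) + a \<in> block_idx k i"
    using assms by (auto simp: block_idx_def algebra_simps)
  ultimately show ?thesis using pick_card_in_set by metis
qed

lemma block_idx_within:
  assumes "i < n"
  shows "{c. c < n * (2 * k) \<and> c \<in> block_idx k i} = block_idx k i"
proof -
  have "Suc i * (2 * k) \<le> n * (2 * k)" using assms by (intro mult_right_mono) auto
  then show ?thesis by (auto simp: block_idx_def mult.commute)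
qed

lemma card_block_idx: "card (block_idx k i) = 2 * k"
  by (simp add: block_idx_def algebra_simps)

text \<open>\<open>block_row\<close> with the height \<open>p\<close> of the blocks decoupled from the width of the HSS block, since a
  compressed factor has blocks of height \<open>k\<close>.\<close>

definition off_rows :: "nat \<Rightarrow> nat \<Rightarrow> nat \<Rightarrow> real mat \<Rightarrow> real mat" where
  "off_rows p k i X = mat p (card {j. j < dim_col X \<and> j \<in> - block_idx k i})
     (\<lambda>(a,b). X $$ (i * p + a, pick (- block_idx k i) b))"

lemma dim_off_rows [simp]:
  "dim_row (off_rows p k i X) = p"
  "dim_col (off_rows p k i X) = card {j. j < dim_col X \<and> j \<in> - block_idx k i}"
  by (simp_all add: off_rows_def)

lemma block_row_off_rows:
  assumes "dim_row X = n * (2 * k)" "i < n"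
  shows "block_row k i X = off_rows (2 * k) k i X"
  unfolding block_row_def submatrix_def off_rows_def assms(1) block_idx_within[OF assms(2)] card_block_idx
  by (intro cong_mat refl) (simp add: pick_block_idx)

lemma off_rows_minus:
  assumes "X \<in> carrier_mat (n * p) m" "Y \<in> carrier_mat (n * p) m" "i < n"
  shows "off_rows p k i (X - Y) = off_rows p k i X - off_rows p k i Y"
proof (intro eq_matI)
  fix a b assume "a < dim_row (off_rows p k i X - off_rows p k i Y)" "b < dim_col (off_rows p k i X - off_rows p k i Y)"
  then have a: "a < p" and b: "b < card {j. j < m \<and> j \<in> - block_idx k i}"
    using assms by auto
  have "i * p + a < n * p" "pick (- block_idx k i) b < m"
    using block_index_less[OF \<open>i < n\<close> a] pick_le[OF b] by auto
  then show "off_rows p k i (X - Y) $$ (a,b) = (off_rows p k i X - off_rows p k i Y) $$ (a,b)"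
    using a b carrier_matD[OF assms(1)] carrier_matD[OF assms(2)] by (simp add: off_rows_def)
qed (use assms in auto)

text \<open>In the rows of block \<open>i\<close>, a block-diagonal matrix is zero at every column
  that is kept.\<close>

lemma off_rows_add_bdm:
  assumes "X \<in> carrier_mat (n * (2 * k)) (n * (2 * k))" "i < n"
  shows "off_rows (2 * k) k i (X + bdm n (2 * k) (2 * k) D) = off_rows (2 * k) k i X"
proof (intro eq_matI)
  fix a b assume "a < dim_row (off_rows (2 * k) k i X)" "b < dim_col (off_rows (2 * k) k i X)"
  then have a: "a < 2 * k" and b: "b < card {j. j < n * (2 * k) \<and> j \<in> - block_idx k i}"
    using assms by auto
  define y where "y = pick (- block_idx k i) b"
  have "y \<in> {j. j < n * (2 * k) \<and> j \<in> - block_idx k i}"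
    unfolding y_def using b by (intro bij_betwE[OF bij_betw_pick, rule_format]) simp
  moreover have k: "k > 0" using a by auto
  ultimately have y: "y < n * (2 * k)" "y div (2 * k) \<noteq> i" by (auto simp: block_idx_iff)
  then have "bdm n (2 * k) (2 * k) D $$ (i * (2 * k) + a, y) = 0"
    using a k block_index_less[OF assms(2) a] by (simp add: bdm_def)
  then show "off_rows (2 * k) k i (X + bdm n (2 * k) (2 * k) D) $$ (a,b) = off_rows (2 * k) k i X $$ (a,b)"
    using a b y(1) assms block_index_less[OF assms(2) a] carrier_matD[OF assms(1)]
    by (simp add: off_rows_def y_def)
qed (use assms in auto)

lemma off_rows_bdm_mult:
  assumes f: "f i \<in> carrier_mat m p" and X: "X \<in> carrier_mat (n * p) q" and i: "i < n"
  shows "off_rows m k i (bdm n m p f * X) = f i * off_rows p k i X"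
proof (intro eq_matI)
  fix a b assume "a < dim_row (f i * off_rows p k i X)" "b < dim_col (f i * off_rows p k i X)"
  then have a: "a < m" and b: "b < card {j. j < q \<and> j \<in> - block_idx k i}"
    using f X by auto
  define y where "y = pick (- block_idx k i) b"
  have y: "y < q" using b pick_le unfolding y_def by blast
  \<comment> \<open>All \<open>q\<close> columns are regarded as one block, so the blockwise product
    rule reaches the column \<open>y\<close> independently of the HSS partition.\<close>
  have "off_rows m k i (bdm n m p f * X) $$ (a,b) = blk m q i 0 (bdm n m p f * X) $$ (a,y)"
    using a b y X by (auto simp: off_rows_def blk_def y_def)
  also have "\<dots> = (f i * blk p q i 0 X) $$ (a,y)"
    using blk_bdm_mult[of f i m p X n 1 q 0] f X i by simp
  also have "\<dots> = (\<Sum>c<p. f i $$ (a,c) * blk p q i 0 X $$ (c,y))"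
    by (rule mult_entry[OF f blk_carrier a y])
  also have "\<dots> = (\<Sum>c<p. f i $$ (a,c) * off_rows p k i X $$ (c,b))"
    using b y X by (intro sum.cong) (auto simp: off_rows_def blk_def y_def)
  also have "\<dots> = (f i * off_rows p k i X) $$ (a,b)"
    using X a b by (intro mult_entry[OF f, symmetric]) auto
  finally show "off_rows m k i (bdm n m p f * X) $$ (a,b) = (f i * off_rows p k i X) $$ (a,b)" .
qed (use f X in auto)

lemma fsq_off_rows:
  assumes X: "X \<in> carrier_mat (n * (2 * k)) (n * (2 * k))" and i: "i < n"
  shows "fsq (off_rows (2 * k) k i X) = (\<Sum>j\<in>{..<n} - {i}. fsq (blk (2 * k) (2 * k) i j X))"
proof (cases "k = 0")
  case True
  then show ?thesis by (simp add: fsq_def)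
next
  case False
  let ?J = "{j. j < n * (2 * k) \<and> j \<in> - block_idx k i}"
  have "fsq (off_rows (2 * k) k i X)
      = (\<Sum>a<2 * k. \<Sum>b<card ?J. (X $$ (i * (2 * k) + a, pick (- block_idx k i) b))\<^sup>2)"
    using X by (simp add: fsq_def off_rows_def)
  also have "\<dots> = (\<Sum>a<2 * k. \<Sum>c\<in>?J. (X $$ (i * (2 * k) + a, c))\<^sup>2)"
    by (intro sum.cong refl sum.reindex_bij_betw[OF bij_betw_pick])
  also have "\<dots> = (\<Sum>a<2 * k. \<Sum>c<n * (2 * k). if c div (2 * k) \<noteq> i then (X $$ (i * (2 * k) + a, c))\<^sup>2 else 0)"
    using False by (intro sum.cong refl sum.mono_neutral_cong_left) (auto simp: block_idx_iff)
  also have "\<dots> = (\<Sum>a<2 * k. \<Sum>j<n. \<Sum>b<2 * k. if j \<noteq> i then (X $$ (i * (2 * k) + a, j * (2 * k) + b))\<^sup>2 else 0)"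
    unfolding sum_blocks[of _ n "2 * k"] by (intro sum.cong refl) auto
  also have "\<dots> = (\<Sum>j<n. \<Sum>a<2 * k. \<Sum>b<2 * k. if j \<noteq> i then (X $$ (i * (2 * k) + a, j * (2 * k) + b))\<^sup>2 else 0)"
    by (rule sum.swap)
  also have "\<dots> = (\<Sum>j\<in>{..<n} - {i}. \<Sum>a<2 * k. \<Sum>b<2 * k. (X $$ (i * (2 * k) + a, j * (2 * k) + b))\<^sup>2)"
    by (intro sum.mono_neutral_cong_right) auto
  finally show ?thesis by (simp add: fsq_def blk_def)
qed

text \<open>Splits the error of a whole block-row into contributions of single blocks, the form in
  which row and column errors can be combined. Later \<open>W\<close> is a projection
  \<open>U i * (U i)\<^sup>T\<close>.\<close>

lemma fsq_block_row_residual: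
  assumes X: "X \<in> carrier_mat (n * (2 * k)) (n * (2 * k))" and i: "i < n"
    and W: "W \<in> carrier_mat (2 * k) (2 * k)"
  shows "fsq (block_row k i X - W * block_row k i X)
    = (\<Sum>j\<in>{..<n} - {i}. fsq (blk (2 * k) (2 * k) i j X - W * blk (2 * k) (2 * k) i j X))"
proof -
  \<comment> \<open>Only the copy of \<open>W\<close> at position \<open>i\<close> matters;
    repeating it everywhere makes the local product a part of a global one.\<close>
  define P where "P = bdm n (2 * k) (2 * k) (\<lambda>_. W)"
  have PX: "P * X \<in> carrier_mat (n * (2 * k)) (n * (2 * k))" unfolding P_def using X by auto
  have "block_row k i X - W * block_row k i X = off_rows (2 * k) k i (X - P * X)"
    using X i off_rows_minus[OF X PX i] off_rows_bdm_mult[OF W X i]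
    by (simp add: block_row_off_rows[of X n] P_def)
  then have "fsq (block_row k i X - W * block_row k i X)
      = (\<Sum>j\<in>{..<n} - {i}. fsq (blk (2 * k) (2 * k) i j (X - P * X)))"
    using fsq_off_rows[OF minus_carrier_mat[OF PX] i, of X] by simp
  also have "\<dots> = (\<Sum>j\<in>{..<n} - {i}. fsq (blk (2 * k) (2 * k) i j X - W * blk (2 * k) (2 * k) i j X))"
    using blk_bdm_mult[of "\<lambda>_. W" i "2 * k" "2 * k" X n n "2 * k", folded P_def] W X i
    by (intro sum.cong refl) (simp add: blk_minus[OF X PX])
  finally show ?thesis .
qed

lemma fsq_block_row:
  assumes "X \<in> carrier_mat (n * (2 * k)) (n * (2 * k))" "i < n"
  shows "fsq (block_row k i X) = (\<Sum>j\<in>{..<n} - {i}. fsq (blk (2 * k) (2 * k) i j X))"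
  using assms fsq_off_rows[OF assms] by (simp add: block_row_off_rows[of X n])

lemma block_row_minus:
  assumes "X \<in> carrier_mat (n * (2 * k)) (n * (2 * k))" "Y \<in> carrier_mat (n * (2 * k)) (n * (2 * k))" "i < n"
  shows "block_row k i (X - Y) = block_row k i X - block_row k i Y"
  using assms off_rows_minus[OF assms]
  by (simp add: block_row_off_rows[of X n] block_row_off_rows[of Y n] block_row_off_rows[of "X - Y" n])

text \<open>Each off-diagonal block occurs in exactly one block-row, and the diagonal blocks are
  dropped.\<close>

lemma sum_fsq_block_row_le:
  assumes X: "X \<in> carrier_mat (n * (2 * k)) (n * (2 * k))"
  shows "(\<Sum>i<n. fsq (block_row k i X)) \<le> fsq X"
  unfolding fsq_blk[OF X] using fsq_block_row[OF X]
  by (auto intro!: sum_mono sum_mono2 simp: fsq_nonneg)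

text \<open>Reduces facts on block-columns to facts on block-rows.\<close>

lemma block_col_transpose: "block_col k i X = (block_row k i X\<^sup>T)\<^sup>T"
proof -
  have "pick I a < m" if "a < card {i. i < m \<and> i \<in> I}" for a m I
    using that by (rule pick_le)
  then show ?thesis
    by (intro eq_matI) (auto simp: block_col_def block_row_def submatrix_def)
qed

lemma fsq_block_col_residual:
  assumes X: "X \<in> carrier_mat (n * (2 * k)) (n * (2 * k))" and i: "i < n"
    and W: "W \<in> carrier_mat (2 * k) (2 * k)"
  shows "fsq (block_col k i X - block_col k i X * W)
    = (\<Sum>j\<in>{..<n} - {i}. fsq (blk (2 * k) (2 * k) j i X - blk (2 * k) (2 * k) j i X * W))"
proof -
  have d: "dim_row (block_row k i X\<^sup>T) = 2 * k"
    using X i by (simp add: block_row_off_rows[of "X\<^sup>T" n])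
  have "block_col k i X - block_col k i X * W = (block_row k i X\<^sup>T - W\<^sup>T * block_row k i X\<^sup>T)\<^sup>T"
    unfolding block_col_transpose using W d by (simp add: mat_transpose_mult mat_transpose_minus)
  then have "fsq (block_col k i X - block_col k i X * W) = fsq (block_row k i X\<^sup>T - W\<^sup>T * block_row k i X\<^sup>T)"
    by (simp add: fsq_transpose)
  also have "\<dots> = (\<Sum>j\<in>{..<n} - {i}. fsq (blk (2 * k) (2 * k) i j X\<^sup>T - W\<^sup>T * blk (2 * k) (2 * k) i j X\<^sup>T))"
    using assms by (intro fsq_block_row_residual) auto
  also have "\<dots> = (\<Sum>j\<in>{..<n} - {i}. fsq (blk (2 * k) (2 * k) j i X - blk (2 * k) (2 * k) j i X * W))"
  proof (intro sum.cong refl)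
    fix j assume "j \<in> {..<n} - {i}"
    then have "blk (2 * k) (2 * k) i j X\<^sup>T = (blk (2 * k) (2 * k) j i X)\<^sup>T"
      using blk_transpose[OF X, of j i] i by simp
    then have "blk (2 * k) (2 * k) i j X\<^sup>T - W\<^sup>T * blk (2 * k) (2 * k) i j X\<^sup>T
        = (blk (2 * k) (2 * k) j i X - blk (2 * k) (2 * k) j i X * W)\<^sup>T"
      using W by (simp add: mat_transpose_mult mat_transpose_minus)
    then show "fsq (blk (2 * k) (2 * k) i j X\<^sup>T - W\<^sup>T * blk (2 * k) (2 * k) i j X\<^sup>T)
        = fsq (blk (2 * k) (2 * k) j i X - blk (2 * k) (2 * k) j i X * W)"
      by (simp add: fsq_transpose)
  qed
  finally show ?thesis .
qed

text \<open>The diagonal part does not reach the block-row, so what remains is \<open>U i\<close>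
  times a matrix with \<open>k\<close> rows. This is the low-rank property of HSS matrices.\<close>

lemma block_row_HSS:
  assumes C: "C \<in> HSS (Suc l) k" and i: "i < 2 ^ Suc l"
  shows "\<exists>P Z. P \<in> carrier_mat (2 * k) k \<and> Z \<in> carrier_mat k (dim_col (block_row k i C)) \<and> block_row k i C = P * Z"
proof -
  define n :: nat where "n = 2 ^ Suc l"
  obtain U V D B where *: "B \<in> HSS l k" "orthonormal_family k n U" "orthonormal_family k n V"
    "C = bdm n (2 * k) k U * B * (bdm n (2 * k) k V)\<^sup>T + bdm n (2 * k) (2 * k) D"
    using C unfolding n_def by (elim HSS_SucE) blast
  define Y where "Y = B * (bdm n (2 * k) k V)\<^sup>T"
  have B: "B \<in> carrier_mat (n * k) (n * k)" using HSS_carrier[OF *(1)] by (simp add: n_def ac_simps)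
  have Y: "Y \<in> carrier_mat (n * k) (n * (2 * k))" unfolding Y_def using B by auto
  have C': "C = bdm n (2 * k) k U * Y + bdm n (2 * k) (2 * k) D"
    unfolding *(4) Y_def using B by (simp add: mat_assoc)
  have i': "i < n" using i by (simp add: n_def)
  have "block_row k i C = off_rows (2 * k) k i (bdm n (2 * k) k U * Y)"
  proof -
    have "dim_row C = n * (2 * k)" unfolding C' by simp
    show ?thesis
      unfolding block_row_off_rows[OF \<open>dim_row C = n * (2 * k)\<close> i'] unfolding C'
      by (rule off_rows_add_bdm[OF mult_carrier_mat[OF bdm_carrier Y] i'])
  qed
  also have "\<dots> = U i * off_rows k k i Y"
    using orthonormal_familyD(1)[OF *(2) i'] Y i' by (rule off_rows_bdm_mult)
  finally have eq: "block_row k i C = U i * off_rows k k i Y" .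
  have "off_rows k k i Y \<in> carrier_mat k (dim_col (block_row k i C))"
    unfolding eq by (rule carrier_matI) simp_all
  then show ?thesis using orthonormal_familyD(1)[OF *(2) i'] eq by blast
qed

text \<open>\<open>U\<close> and \<open>V\<close> change places at every level; the column estimates
  then follow from the row estimates.\<close>

lemma HSS_transpose: "C \<in> HSS l k \<Longrightarrow> C\<^sup>T \<in> HSS l k"
proof (induction l arbitrary: C)
  case 0
  then show ?case by (auto simp: HSS_0)
next
  case (Suc l)
  define n :: nat where "n = 2 ^ Suc l"
  obtain U V D B where *: "B \<in> HSS l k" "orthonormal_family k n U" "orthonormal_family k n V"
    "\<And>i. i < n \<Longrightarrow> D i \<in> carrier_mat (2 * k) (2 * k)"
    "C = bdm n (2 * k) k U * B * (bdm n (2 * k) k V)\<^sup>T + bdm n (2 * k) (2 * k) D"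
    using Suc.prems unfolding n_def by (elim HSS_SucE) blast
  have B: "B \<in> carrier_mat (n * k) (n * k)" using HSS_carrier[OF *(1)] by (simp add: n_def ac_simps)
  have "C\<^sup>T = bdm n (2 * k) k V * B\<^sup>T * (bdm n (2 * k) k U)\<^sup>T + bdm n (2 * k) (2 * k) (\<lambda>i. (D i)\<^sup>T)"
    unfolding *(5) using B *(4)
    by (simp add: mat_transpose_add mat_transpose_mult mat_assoc transpose_bdm)
  moreover have "\<dots> \<in> HSS (Suc l) k"
    unfolding n_def by (rule HSS_SucI) (use Suc.IH[OF *(1)] *(2-4) in \<open>auto simp: n_def\<close>)
  ultimately show ?case by simp
qed

section \<open>Limits of matrices\<close>

text \<open>Matrix-valued maps on \<open>S\<close> whose entries lie in an algebra \<open>F\<close> of functions. This serves twice: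
  for measurable functions, and for convergent sequences with their limits.\<close>

locale fun_algebra =
  fixes S :: "'p set" and F :: "('p \<Rightarrow> real) set"
  assumes const: "(\<lambda>_. c) \<in> F"
    and add: "f \<in> F \<Longrightarrow> g \<in> F \<Longrightarrow> (\<lambda>p. f p + g p) \<in> F"
    and mult: "f \<in> F \<Longrightarrow> g \<in> F \<Longrightarrow> (\<lambda>p. f p * g p) \<in> F"
    and cong: "f \<in> F \<Longrightarrow> (\<And>p. p \<in> S \<Longrightarrow> f p = g p) \<Longrightarrow> g \<in> F"
begin

lemma sum: "(\<And>i. i \<in> I \<Longrightarrow> f i \<in> F) \<Longrightarrow> (\<lambda>p. \<Sum>i\<in>I. f i p) \<in> F"
  by (induction I rule: infinite_finite_induct) (auto intro: const add)

lemma minus: "f \<in> F \<Longrightarrow> g \<in> F \<Longrightarrow> (\<lambda>p. f p - g p) \<in> F"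
  using add[of f "\<lambda>p. (-1) * g p"] mult[OF const[of "-1"], of g] by simp

definition mfun :: "nat \<Rightarrow> nat \<Rightarrow> ('p \<Rightarrow> real mat) \<Rightarrow> bool" where
  "mfun m n X \<longleftrightarrow> (\<forall>p\<in>S. X p \<in> carrier_mat m n) \<and> (\<forall>i<m. \<forall>j<n. (\<lambda>p. X p $$ (i,j)) \<in> F)"

lemma mfunD:
  assumes "mfun m n X"
  shows "p \<in> S \<Longrightarrow> X p \<in> carrier_mat m n" "i < m \<Longrightarrow> j < n \<Longrightarrow> (\<lambda>p. X p $$ (i,j)) \<in> F"
  using assms by (auto simp: mfun_def)

lemma mfunI:
  assumes "\<And>p. p \<in> S \<Longrightarrow> X p \<in> carrier_mat m n"
    and "\<And>i j. i < m \<Longrightarrow> j < n \<Longrightarrow> f i j \<in> F"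
    and "\<And>i j p. i < m \<Longrightarrow> j < n \<Longrightarrow> p \<in> S \<Longrightarrow> X p $$ (i,j) = f i j p"
  shows "mfun m n X"
  unfolding mfun_def
proof (intro conjI ballI allI impI assms(1))
  fix i j assume ij: "i < m" "j < n"
  show "(\<lambda>p. X p $$ (i,j)) \<in> F"
    by (rule cong[OF assms(2)[OF ij]]) (rule assms(3)[OF ij, symmetric])
qed

lemma mfun_cong:
  assumes X: "mfun m n X" and eq: "\<And>p. p \<in> S \<Longrightarrow> X p = Y p"
  shows "mfun m n Y"
proof (rule mfunI)
  show "Y p \<in> carrier_mat m n" if "p \<in> S" for p
    using mfunD(1)[OF X that] unfolding eq[OF that] .
  show "(\<lambda>p. X p $$ (i,j)) \<in> F" if "i < m" "j < n" for i j
    by (rule mfunD(2)[OF X that])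
  show "Y p $$ (i,j) = X p $$ (i,j)" if "p \<in> S" for i j p
    unfolding eq[OF that] ..
qed

lemma mfun_const: "A \<in> carrier_mat m n \<Longrightarrow> mfun m n (\<lambda>_. A)"
  by (simp add: mfun_def const)

lemma mfun_add:
  assumes X: "mfun m n X" and Y: "mfun m n Y"
  shows "mfun m n (\<lambda>p. X p + Y p)"
proof (rule mfunI)
  show "X p + Y p \<in> carrier_mat m n" if "p \<in> S" for p
    using mfunD(1)[OF Y that] by simp
  show "(\<lambda>p. X p $$ (i,j) + Y p $$ (i,j)) \<in> F" if "i < m" "j < n" for i j
    by (intro add mfunD(2)[OF X that] mfunD(2)[OF Y that])
  show "(X p + Y p) $$ (i,j) = X p $$ (i,j) + Y p $$ (i,j)" if "i < m" "j < n" "p \<in> S" for i j p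
    using that carrier_matD[OF mfunD(1)[OF Y that(3)]] by simp
qed

lemma mfun_minus:
  assumes X: "mfun m n X" and Y: "mfun m n Y"
  shows "mfun m n (\<lambda>p. X p - Y p)"
proof (rule mfunI)
  show "X p - Y p \<in> carrier_mat m n" if "p \<in> S" for p
    by (rule minus_carrier_mat[OF mfunD(1)[OF Y that]])
  show "(\<lambda>p. X p $$ (i,j) - Y p $$ (i,j)) \<in> F" if "i < m" "j < n" for i j
    by (intro minus mfunD(2)[OF X that] mfunD(2)[OF Y that])
  show "(X p - Y p) $$ (i,j) = X p $$ (i,j) - Y p $$ (i,j)" if "i < m" "j < n" "p \<in> S" for i j p
    using that carrier_matD[OF mfunD(1)[OF Y that(3)]] by simp
qed

lemma mfun_transpose:
  assumes X: "mfun m n X"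
  shows "mfun n m (\<lambda>p. (X p)\<^sup>T)"
proof (rule mfunI)
  show "(X p)\<^sup>T \<in> carrier_mat n m" if "p \<in> S" for p
    using mfunD(1)[OF X that] by simp
  show "(\<lambda>p. X p $$ (j,i)) \<in> F" if "i < n" "j < m" for i j
    by (rule mfunD(2)[OF X that(2,1)])
  show "(X p)\<^sup>T $$ (i,j) = X p $$ (j,i)" if "i < n" "j < m" "p \<in> S" for i j p
    using that carrier_matD[OF mfunD(1)[OF X that(3)]] by simp
qed

lemma mfun_mult:
  assumes "mfun m p X" "mfun p n Y"
  shows "mfun m n (\<lambda>\<omega>. X \<omega> * Y \<omega>)"
proof (rule mfunI[where f = "\<lambda>i j \<omega>. \<Sum>c<p. X \<omega> $$ (i,c) * Y \<omega> $$ (c,j)"])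
  show "X \<omega> * Y \<omega> \<in> carrier_mat m n" if "\<omega> \<in> S" for \<omega>
    using mfunD(1)[OF assms(1) that] mfunD(1)[OF assms(2) that] by simp
  show "(\<lambda>\<omega>. \<Sum>c<p. X \<omega> $$ (i,c) * Y \<omega> $$ (c,j)) \<in> F" if "i < m" "j < n" for i j
    using that by (intro sum mult mfunD(2)[OF assms(1)] mfunD(2)[OF assms(2)]) auto
  show "(X \<omega> * Y \<omega>) $$ (i,j) = (\<Sum>c<p. X \<omega> $$ (i,c) * Y \<omega> $$ (c,j))" if "i < m" "j < n" "\<omega> \<in> S" for i j \<omega>
    using mfunD(1)[OF assms(1) that(3)] mfunD(1)[OF assms(2) that(3)] that(1,2) by (rule mult_entry)
qed

lemma mfun_bdm:
  assumes "\<And>i. i < n \<Longrightarrow> mfun m p (\<lambda>\<omega>. f \<omega> i)"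
  shows "mfun (n * m) (n * p) (\<lambda>\<omega>. bdm n m p (f \<omega>))"
proof (rule mfunI[where f = "\<lambda>a b \<omega>. if a div m = b div p then f \<omega> (a div m) $$ (a mod m, b mod p) else 0"])
  fix a b assume ab: "a < n * m" "b < n * p"
  then have "a mod m < m" "b mod p < p" "a div m < n"
    by (auto intro!: mod_less_divisor Nat.gr0I simp: less_mult_imp_div_less)
  then show "(\<lambda>\<omega>. if a div m = b div p then f \<omega> (a div m) $$ (a mod m, b mod p) else 0) \<in> F"
    using mfunD(2)[OF assms[of "a div m"], of "a mod m" "b mod p"] const[of 0]
    by (cases "a div m = b div p") simp_all
qed (auto simp: bdm_def)

lemma mfun_blk:
  assumes "mfun (n * m) (n' * p) X" "i < n" "j < n'"
  shows "mfun m p (\<lambda>\<omega>. blk m p i j (X \<omega>))"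
  by (rule mfunI[where f = "\<lambda>a b \<omega>. X \<omega> $$ (i * m + a, j * p + b)"])
    (auto simp: blk_def assms(2,3) intro!: mfunD(2)[OF assms(1)] block_index_less)

lemma mfun_submatrix:
  assumes "mfun m n X"
  shows "mfun (card {i. i < m \<and> i \<in> I}) (card {j. j < n \<and> j \<in> J}) (\<lambda>\<omega>. submatrix (X \<omega>) I J)"
proof (rule mfunI[where f = "\<lambda>a b \<omega>. X \<omega> $$ (pick I a, pick J b)"])
  fix a b assume "a < card {i. i < m \<and> i \<in> I}" "b < card {j. j < n \<and> j \<in> J}"
  then show "(\<lambda>\<omega>. X \<omega> $$ (pick I a, pick J b)) \<in> F"
    by (intro mfunD(2)[OF assms] pick_le)
  fix \<omega> assume "\<omega> \<in> S"
  then show "submatrix (X \<omega>) I J $$ (a,b) = X \<omega> $$ (pick I a, pick J b)"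
    using \<open>a < _\<close> \<open>b < _\<close> carrier_matD[OF mfunD(1)[OF assms]] by (simp add: submatrix_def)
qed (simp add: submatrix_def carrier_matD[OF mfunD(1)[OF assms]])

lemma fsq_mfun:
  assumes "mfun m n X"
  shows "(\<lambda>\<omega>. fsq (X \<omega>)) \<in> F"
proof (rule cong)
  show "(\<lambda>\<omega>. \<Sum>i<m. \<Sum>j<n. X \<omega> $$ (i,j) * X \<omega> $$ (i,j)) \<in> F"
    by (intro sum mult mfunD(2)[OF assms]) auto
  show "(\<Sum>i<m. \<Sum>j<n. X \<omega> $$ (i,j) * X \<omega> $$ (i,j)) = fsq (X \<omega>)" if "\<omega> \<in> S" for \<omega>
    using mfunD(1)[OF assms that] by (auto simp: fsq_def power2_eq_square)
qed

end

text \<open>A sequence together with its limit is a function on \<open>nat option\<close>, with the limit at \<open>None\<close>.\<close>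

interpretation conv: fun_algebra "UNIV :: nat option set" "{f. (\<lambda>n. f (Some n)) \<longlonglongrightarrow> f None}"
proof
  fix f g :: "nat option \<Rightarrow> real"
  assume "f \<in> {f. (\<lambda>n. f (Some n)) \<longlonglongrightarrow> f None}" "\<And>p. p \<in> UNIV \<Longrightarrow> f p = g p"
  moreover from this have "f = g" by auto
  ultimately show "g \<in> {f. (\<lambda>n. f (Some n)) \<longlonglongrightarrow> f None}" by simp
qed (auto intro: tendsto_intros)

text \<open>An identity between convergent sequences passes to their limits; applied to
  orthonormality and to block-diagonal shape.\<close>

lemma conv_eq:
  assumes "conv.mfun m n X" "conv.mfun m n Y" "\<And>t. X (Some t) = Y (Some t)"
  shows "X None = Y None"
proof (rule eq_matI)
  fix i j assume "i < dim_row (Y None)" "j < dim_col (Y None)"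
  then have ij: "i < m" "j < n" using conv.mfunD(1)[OF assms(2), of None] by auto
  have "(\<lambda>t. X (Some t) $$ (i,j)) \<longlonglongrightarrow> X None $$ (i,j)" "(\<lambda>t. Y (Some t) $$ (i,j)) \<longlonglongrightarrow> Y None $$ (i,j)"
    using conv.mfunD(2)[OF assms(1) ij] conv.mfunD(2)[OF assms(2) ij] by auto
  then show "X None $$ (i,j) = Y None $$ (i,j)"
    unfolding assms(3) by (rule LIMSEQ_unique)
qed (use conv.mfunD(1)[OF assms(1), of None] conv.mfunD(1)[OF assms(2), of None] in auto)

lemma conv_subseq:
  assumes "conv.mfun m n (case_option C X)" "strict_mono r"
  shows "conv.mfun m n (case_option C (X \<circ> r))"
proof (rule conv.mfunI)
  fix p :: "nat option"
  show "case_option C (X \<circ> r) p \<in> carrier_mat m n"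
    using conv.mfunD(1)[OF assms(1), of None] conv.mfunD(1)[OF assms(1), of "Some (r (the p))"]
    by (cases p) auto
next
  fix i j assume ij: "i < m" "j < n"
  show "(\<lambda>p. case_option C (X \<circ> r) p $$ (i,j)) \<in> {f. (\<lambda>n. f (Some n)) \<longlonglongrightarrow> f None}"
    using LIMSEQ_subseq_LIMSEQ[OF _ assms(2)] conv.mfunD(2)[OF assms(1) ij] by (simp add: o_def)
qed simp

text \<open>Bolzano-Weierstrass for finitely many coordinates, by extracting one further subsequence
  for each coordinate.\<close>

lemma bounded_real_subseq:
  fixes X :: "nat \<Rightarrow> 'i \<Rightarrow> real"
  assumes "finite I" "\<And>t i. i \<in> I \<Longrightarrow> \<bar>X t i\<bar> \<le> b"
  shows "\<exists>r L. strict_mono r \<and> (\<forall>i\<in>I. (\<lambda>t. X (r t) i) \<longlonglongrightarrow> L i)"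
  using assms
proof (induction I rule: finite_induct)
  case empty
  then show ?case by (auto intro!: exI[of _ id] simp: strict_mono_def)
next
  case (insert i I)
  have "\<exists>r L. strict_mono r \<and> (\<forall>i\<in>I. (\<lambda>t. X (r t) i) \<longlonglongrightarrow> L i)"
    by (rule insert.IH) (rule insert.prems, simp)
  then obtain r L where r: "strict_mono r" and L: "\<And>i. i \<in> I \<Longrightarrow> (\<lambda>t. X (r t) i) \<longlonglongrightarrow> L i" by blast
  have "bounded (range (\<lambda>t. X (r t) i))"
    unfolding bounded_iff using insert.prems by (intro exI[of _ b]) auto
  then obtain l s where s: "strict_mono s" and l: "((\<lambda>t. X (r t) i) \<circ> s) \<longlonglongrightarrow> l"
    using bounded_imp_convergent_subsequence by blast
  have "(\<lambda>t. X (r (s t)) i') \<longlonglongrightarrow> (L(i := l)) i'" if "i' \<in> insert i I" for i'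
  proof (cases "i' = i")
    case True
    then show ?thesis using l by (simp add: o_def)
  next
    case False
    then have "i' \<in> I" using that by simp
    from LIMSEQ_subseq_LIMSEQ[OF L[OF this] s] show ?thesis using False by (simp add: o_def)
  qed
  then have "\<forall>i'\<in>insert i I. (\<lambda>t. X ((r \<circ> s) t) i') \<longlonglongrightarrow> (L(i := l)) i'" by (simp only: o_apply) blast
  then show ?case using strict_mono_o[OF r s] by blast
qed

section \<open>Closed sets of matrices and existence of minimisers\<close>

lemma fsq_entry_le:
  assumes "X \<in> carrier_mat m n" "i < m" "j < n"
  shows "(X $$ (i,j))\<^sup>2 \<le> fsq X"
proof -
  have "(X $$ (i,j))\<^sup>2 \<le> (\<Sum>j<n. (X $$ (i,j))\<^sup>2)"
    using assms by (intro member_le_sum) auto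
  also have "\<dots> \<le> fsq X"
    unfolding fsq_def carrier_matD[OF assms(1)]
    by (rule member_le_sum) (simp_all add: assms sum_nonneg)
  finally show ?thesis .
qed

text \<open>In finite dimension this amounts to closedness. The formulation by subsequences suits
  sets given by factorizations, since convergence can be arranged for one factor after
  another.\<close>

definition subseq_closed :: "nat \<Rightarrow> nat \<Rightarrow> real mat set \<Rightarrow> bool" where
  "subseq_closed m n S \<longleftrightarrow> S \<subseteq> carrier_mat m n \<and>
    (\<forall>(X :: nat \<Rightarrow> real mat) b. (\<forall>t. X t \<in> S) \<longrightarrow> (\<forall>t. fsq (X t) \<le> b) \<longrightarrow>
      (\<exists>r C. strict_mono r \<and> C \<in> S \<and> conv.mfun m n (case_option C (X \<circ> r))))"

lemma subseq_closed_carrier: "subseq_closed m n (carrier_mat m n)"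
  unfolding subseq_closed_def
proof (intro conjI allI impI order_refl)
  fix X :: "nat \<Rightarrow> real mat" and b assume X: "\<forall>t. X t \<in> carrier_mat m n" and b: "\<forall>t. fsq (X t) \<le> b"
  have "\<bar>X t $$ (i,j)\<bar> \<le> sqrt b" if "i < m" "j < n" for t i j
    using order_trans[OF fsq_entry_le[OF X[rule_format, of t] that] b[rule_format, of t]]
    by (intro real_le_rsqrt) simp
  then have "\<exists>r L. strict_mono r \<and> (\<forall>i\<in>{..<m} \<times> {..<n}. (\<lambda>t. X (r t) $$ i) \<longlonglongrightarrow> L i)"
    by (intro bounded_real_subseq[where b = "sqrt b"]) auto
  then obtain r L where r: "strict_mono r"
    and L': "\<forall>i\<in>{..<m} \<times> {..<n}. (\<lambda>t. X (r t) $$ i) \<longlonglongrightarrow> L i" by blast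
  have L: "(\<lambda>t. X (r t) $$ (i,j)) \<longlonglongrightarrow> L (i,j)" if "i < m" "j < n" for i j
    using L' that by simp
  have "conv.mfun m n (case_option (mat m n L) (X \<circ> r))"
  proof (rule conv.mfunI[where f = "\<lambda>i j. case_option (L (i,j)) (\<lambda>t. X (r t) $$ (i,j))"])
    show "case_option (mat m n L) (X \<circ> r) p \<in> carrier_mat m n" for p
      using X by (cases p) simp_all
    show "case_option (L (i,j)) (\<lambda>t. X (r t) $$ (i,j)) \<in> {f. (\<lambda>n. f (Some n)) \<longlonglongrightarrow> f None}"
      if "i < m" "j < n" for i j using L[OF that] by simp
    show "case_option (mat m n L) (X \<circ> r) p $$ (i,j) = case_option (L (i,j)) (\<lambda>t. X (r t) $$ (i,j)) p"
      if "i < m" "j < n" for i j p using that by (cases p) simp_all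
  qed
  then show "\<exists>r C. strict_mono r \<and> C \<in> carrier_mat m n \<and> conv.mfun m n (case_option C (X \<circ> r))"
    using r mat_carrier by blast
qed

lemma subseq_closedD:
  fixes X :: "nat \<Rightarrow> real mat"
  assumes "subseq_closed m n S" "\<And>t. X t \<in> S" "\<And>t. fsq (X t) \<le> b"
  obtains r C where "strict_mono r" "C \<in> S" "conv.mfun m n (case_option C (X \<circ> r))"
proof -
  have "\<exists>r C. strict_mono r \<and> C \<in> S \<and> conv.mfun m n (case_option C (X \<circ> r))"
    using assms(1)[unfolded subseq_closed_def, THEN conjunct2, THEN spec[of _ X], THEN spec[of _ b]]
      assms(2,3) by simp
  then show ?thesis by (elim exE conjE) (rule that)
qed

lemma subseq_closed_transpose:
  assumes "subseq_closed m n S"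
  shows "subseq_closed n m (transpose_mat ` S)"
  unfolding subseq_closed_def
proof (intro conjI allI impI)
  show "transpose_mat ` S \<subseteq> carrier_mat n m"
    using assms by (auto simp: subseq_closed_def)
  fix X :: "nat \<Rightarrow> real mat" and b
  assume X: "\<forall>t. X t \<in> transpose_mat ` S" and b: "\<forall>t. fsq (X t) \<le> b"
  have "(X t)\<^sup>T \<in> S" for t using X[rule_format, of t] by auto
  moreover have "fsq (X t)\<^sup>T \<le> b" for t using b by (simp add: fsq_transpose)
  ultimately obtain r C where r: "strict_mono r" "C \<in> S" "conv.mfun m n (case_option C ((\<lambda>t. (X t)\<^sup>T) \<circ> r))"
    by (rule subseq_closedD[OF assms])
  have "conv.mfun n m (case_option C\<^sup>T (X \<circ> r))"
    by (rule conv.mfun_cong[OF conv.mfun_transpose[OF r(3)]]) (simp split: option.split)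
  then show "\<exists>r C. strict_mono r \<and> C \<in> transpose_mat ` S \<and> conv.mfun n m (case_option C (X \<circ> r))"
    using r by blast
qed

text \<open>The direct method: a minimising sequence is bounded, a subsequence converges to a point
  of \<open>S\<close>, and the objective is continuous.\<close>

lemma subseq_closed_minimiser:
  assumes S: "subseq_closed m n S" "S \<noteq> {}" and A: "A \<in> carrier_mat m n"
  shows "\<exists>C\<in>S. \<forall>C'\<in>S. fsq (A - C) \<le> fsq (A - C')"
proof -
  define d where "d = (INF C\<in>S. fsq (A - C))"
  have bdd: "bdd_below ((\<lambda>C. fsq (A - C)) ` S)"
    by (rule bdd_belowI[of _ 0]) (auto simp: fsq_nonneg)
  have Sc: "C \<in> carrier_mat m n" if "C \<in> S" for C using S that by (auto simp: subseq_closed_def)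
  have "\<exists>C\<in>S. fsq (A - C) < d + 1 / real (Suc t)" for t
    using cInf_lessD[of "(\<lambda>C. fsq (A - C)) ` S" "d + 1 / real (Suc t)"] S(2) by (auto simp: d_def)
  then obtain X where X: "\<And>t. X t \<in> S" and Xd: "\<And>t. fsq (A - X t) < d + 1 / real (Suc t)" by metis
  have bound: "fsq (X t) \<le> 2 * fsq A + 2 * (d + 1)" for t
  proof -
    have "fsq (X t) = (\<Sum>i<m. \<Sum>j<n. (X t $$ (i,j))\<^sup>2)"
      by (simp add: fsq_def carrier_matD[OF Sc[OF X[of t]]])
    also have "\<dots> \<le> (\<Sum>i<m. \<Sum>j<n. 2 * (A $$ (i,j))\<^sup>2 + 2 * (A $$ (i,j) - X t $$ (i,j))\<^sup>2)"
    proof (intro sum_mono)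
      fix i j
      \<comment> \<open>This square is exactly the difference of the two sides of the
        inequality.\<close>
      have "0 \<le> (2 * A $$ (i,j) - X t $$ (i,j))\<^sup>2" by simp
      then show "(X t $$ (i,j))\<^sup>2 \<le> 2 * (A $$ (i,j))\<^sup>2 + 2 * (A $$ (i,j) - X t $$ (i,j))\<^sup>2"
        by (simp add: power2_eq_square algebra_simps)
    qed
    also have "\<dots> = 2 * fsq A + 2 * fsq (A - X t)"
      using carrier_matD[OF Sc[OF X[of t]]] carrier_matD[OF A] by (simp add: fsq_def sum.distrib sum_distrib_left)
    also have "fsq (A - X t) \<le> d + 1"
      using Xd[of t] by (rule order_trans[OF less_imp_le]) simp
    finally show ?thesis by simp
  qed
  obtain r C where r: "strict_mono r" "C \<in> S" "conv.mfun m n (case_option C (X \<circ> r))"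
    using subseq_closedD[OF S(1) X bound] .
  have "(\<lambda>t. fsq (A - X (r t))) \<longlonglongrightarrow> fsq (A - C)"
    using conv.fsq_mfun[OF conv.mfun_minus[OF conv.mfun_const[OF A] r(3)]] by simp
  moreover have "(\<lambda>t. d + 1 / real (Suc t)) \<longlonglongrightarrow> d + 0"
    by (intro tendsto_intros LIMSEQ_Suc[OF lim_1_over_n])
  from LIMSEQ_subseq_LIMSEQ[OF this r(1)] have "(\<lambda>t. d + 1 / real (Suc (r t))) \<longlonglongrightarrow> d"
    by (simp add: o_def)
  ultimately have "fsq (A - C) \<le> d"
    by (rule LIMSEQ_le) (use Xd less_imp_le in blast)
  moreover have "d \<le> fsq (A - C')" if "C' \<in> S" for C'
    unfolding d_def using bdd that by (rule cINF_lower)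
  ultimately show ?thesis using r(2) by (meson order_trans)
qed

section \<open>Existence of best approximations\<close>

text \<open>Orthonormal factors are bounded automatically, so they always have convergent
  subsequences.\<close>

lemma fsq_orthonormal:
  assumes "Q \<in> carrier_mat m k" "Q\<^sup>T * Q = 1\<^sub>m k"
  shows "fsq Q = fsq (1\<^sub>m k)"
  using fsq_isometry[OF assms one_carrier_mat] assms(1) by simp

lemma conv_orthonormal:
  assumes "conv.mfun m k (case_option Q X)" "\<And>t. (X t)\<^sup>T * X t = 1\<^sub>m k"
  shows "Q\<^sup>T * Q = 1\<^sub>m k"
  using conv_eq[OF conv.mfun_mult[OF conv.mfun_transpose[OF assms(1)] assms(1)] conv.mfun_const[OF one_carrier_mat]]
  by (simp add: assms(2))

text \<open>The factors of a bounded product need not be bounded. Replacing \<open>P\<close> by its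
  orthonormal QR factor cures this: then the second factor has the norm of the product. QR is the
  reason for \<open>k \<le> m\<close>.\<close>

lemma subseq_closed_low_rank:
  assumes "k \<le> m"
  shows "subseq_closed m n {P * Z | P Z. P \<in> carrier_mat m k \<and> Z \<in> carrier_mat k n}" (is "subseq_closed m n ?S")
  unfolding subseq_closed_def
proof (intro conjI allI impI)
  show "?S \<subseteq> carrier_mat m n" by auto
  fix X :: "nat \<Rightarrow> real mat" and b
  assume X: "\<forall>t. X t \<in> ?S" and b: "\<forall>t. fsq (X t) \<le> b"
  have "\<exists>Q Z. Q \<in> carrier_mat m k \<and> Q\<^sup>T * Q = 1\<^sub>m k \<and> Z \<in> carrier_mat k n \<and> X t = Q * Z" for t
  proof -
    obtain P Z where PZ: "P \<in> carrier_mat m k" "Z \<in> carrier_mat k n" "X t = P * Z" using X by blast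
    obtain Q T where "Q \<in> carrier_mat m k" "T \<in> carrier_mat k k" "Q\<^sup>T * Q = 1\<^sub>m k" "P = Q * T"
      using qr_exists[OF PZ(1) assms] by blast
    then show ?thesis using PZ by (intro exI[of _ Q] exI[of _ "T * Z"]) (auto simp: mat_assoc)
  qed
  then obtain Q Z where Q: "\<And>t. Q t \<in> carrier_mat m k" and QQ: "\<And>t. (Q t)\<^sup>T * Q t = 1\<^sub>m k"
    and Z: "\<And>t. Z t \<in> carrier_mat k n" and eq: "\<And>t. X t = Q t * Z t" by metis
  obtain r1 Q' where r1: "strict_mono r1" "Q' \<in> carrier_mat m k" "conv.mfun m k (case_option Q' (Q \<circ> r1))"
    using subseq_closedD[OF subseq_closed_carrier Q eq_refl[OF fsq_orthonormal[OF Q QQ]]] .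
  have Zb: "fsq ((Z \<circ> r1) t) \<le> b" and Zc: "(Z \<circ> r1) t \<in> carrier_mat k n" for t
    using fsq_isometry[OF Q[of "r1 t"] QQ[of "r1 t"] Z[of "r1 t"]] b[rule_format, of "r1 t"] Z
    by (simp_all add: eq)
  obtain r2 Z' where r2: "strict_mono r2" "Z' \<in> carrier_mat k n" "conv.mfun k n (case_option Z' ((Z \<circ> r1) \<circ> r2))"
    using subseq_closedD[OF subseq_closed_carrier Zc Zb] .
  have "conv.mfun m n (case_option (Q' * Z') (X \<circ> (r1 \<circ> r2)))"
    by (rule conv.mfun_cong[OF conv.mfun_mult[OF conv_subseq[OF r1(3) r2(1)] r2(3)]])
      (simp add: eq split: option.split)
  then show "\<exists>r C. strict_mono r \<and> C \<in> ?S \<and> conv.mfun m n (case_option C (X \<circ> r))"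
    using strict_mono_o[OF r1(1) r2(1)] r1(2) r2(2) by blast
qed

text \<open>\<open>arg_min\<close> is a minimiser only if one exists, which closedness of the
  low-rank set provides. The disjunction covers block-rows, which have \<open>2 * k\<close> rows,
  and block-columns, which have \<open>2 * k\<close> columns.\<close>

lemma best_rank_approx_le:
  assumes R: "R \<in> carrier_mat m n" and k: "k \<le> m \<or> k \<le> n"
    and P: "P \<in> carrier_mat m k" and Z: "Z \<in> carrier_mat k n"
  shows "fsq (R - best_rank_approx k R) \<le> fsq (R - P * Z)"
proof -
  define S where "S = {P * Z | (P :: real mat) Z. P \<in> carrier_mat m k \<and> Z \<in> carrier_mat k n}"
  have S: "Y \<in> S \<longleftrightarrow> Y \<in> carrier_mat m n \<and> vec_space.rank m Y \<le> k" for Y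
    using rank_factorization[of Y m n k] rank_mult_le[of _ m k _ n] by (auto simp: S_def)
  have PZ: "P * Z \<in> S" using P Z by (auto simp: S_def)
  have "subseq_closed m n S"
  proof (cases "k \<le> m")
    case True
    then show ?thesis unfolding S_def by (rule subseq_closed_low_rank)
  next
    case False
    then have "k \<le> n" using k by simp
    \<comment> \<open>With fewer than \<open>k\<close> rows the QR argument is applied to the
      transposes, which have at least \<open>k\<close> rows.\<close>
    have "S = transpose_mat ` {P * Z | (P :: real mat) Z. P \<in> carrier_mat n k \<and> Z \<in> carrier_mat k m}" (is "_ = _ ` ?T")
    proof (intro equalityI subsetI)
      fix Y assume "Y \<in> S"
      then obtain P Z where "P \<in> carrier_mat m k" "Z \<in> carrier_mat k n" "Y = P * Z" by (auto simp: S_def)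
      then have "Z\<^sup>T \<in> carrier_mat n k" "P\<^sup>T \<in> carrier_mat k m" "Y = (Z\<^sup>T * P\<^sup>T)\<^sup>T"
        by (auto simp: mat_transpose_mult)
      then show "Y \<in> transpose_mat ` ?T" by blast
    next
      fix Y assume "Y \<in> transpose_mat ` ?T"
      then obtain P Z where "P \<in> carrier_mat n k" "Z \<in> carrier_mat k m" "Y = (P * Z)\<^sup>T" by auto
      then have "Y = Z\<^sup>T * P\<^sup>T" "Z\<^sup>T \<in> carrier_mat m k" "P\<^sup>T \<in> carrier_mat k n" by (auto simp: mat_transpose_mult)
      then show "Y \<in> S" unfolding S_def by blast
    qed
    then show ?thesis using subseq_closed_transpose[OF subseq_closed_low_rank[OF \<open>k \<le> n\<close>]] by simp
  qed
  then obtain Y where Y: "Y \<in> S" "\<And>Y'. Y' \<in> S \<Longrightarrow> fsq (R - Y) \<le> fsq (R - Y')"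
    using subseq_closed_minimiser[OF _ _ R, of S] PZ by blast
  have frob_le: "frob_norm X \<le> frob_norm X' \<longleftrightarrow> fsq X \<le> fsq X'" for X X'
    by (simp add: frob_norm_def fsq_def)
  have "is_arg_min (\<lambda>Y. frob_norm (R - Y)) (\<lambda>Y. Y \<in> carrier_mat (dim_row R) (dim_col R) \<and> vec_space.rank (dim_row R) Y \<le> k) Y"
    unfolding is_arg_min_linorder using Y R S by (auto simp: frob_le)
  then have "is_arg_min (\<lambda>Y. frob_norm (R - Y)) (\<lambda>Y. Y \<in> carrier_mat (dim_row R) (dim_col R) \<and> vec_space.rank (dim_row R) Y \<le> k) (best_rank_approx k R)"
    unfolding best_rank_approx_def arg_min_def by (rule someI)
  then have "frob_norm (R - best_rank_approx k R) \<le> frob_norm (R - P * Z)"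
    unfolding is_arg_min_linorder using PZ S[of "P * Z"] R by auto
  then show ?thesis by (simp add: frob_le)
qed

text \<open>Limits are taken of the assembled matrices, so one subsequence serves all blocks; the
  limit is again block-diagonal and its blocks are the limits of the blocks.\<close>

lemma conv_bdm:
  assumes C: "conv.mfun (n * m) (n * p) (case_option C (\<lambda>t. bdm n m p (f t)))"
    and f: "\<And>t i. i < n \<Longrightarrow> f t i \<in> carrier_mat m p"
  shows "C = bdm n m p (\<lambda>i. blk m p i i C)"
    and "i < n \<Longrightarrow> conv.mfun m p (case_option (blk m p i i C) (\<lambda>t. f t i))"
proof -
  let ?X = "case_option C (\<lambda>t. bdm n m p (f t))"
  have blk: "blk m p i i (bdm n m p (f t)) = f t i" if "i < n" for i t
    using f[OF that] that by (simp add: blk_bdm)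
  have "?X None = bdm n m p (\<lambda>i. blk m p i i (?X None))"
    by (rule conv_eq[OF C conv.mfun_bdm[OF conv.mfun_blk[OF C]]])
      (auto simp: blk intro!: bdm_cong)
  then show "C = bdm n m p (\<lambda>i. blk m p i i C)" by simp
  show "conv.mfun m p (case_option (blk m p i i C) (\<lambda>t. f t i))" if "i < n"
    by (rule conv.mfun_cong[OF conv.mfun_blk[OF C that that]]) (simp add: blk[OF that] split: option.split)
qed

text \<open>One telescoping step as a single predicate, so that its factors can be chosen
  simultaneously for all terms of a sequence.\<close>

definition hss_step :: "nat \<Rightarrow> nat \<Rightarrow> real mat \<Rightarrow> (nat \<Rightarrow> real mat) \<Rightarrow> (nat \<Rightarrow> real mat) \<Rightarrow> (nat \<Rightarrow> real mat) \<Rightarrow> real mat \<Rightarrow> bool" where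
  "hss_step l k C U V D B \<longleftrightarrow> B \<in> HSS l k \<and> orthonormal_family k (2 ^ Suc l) U \<and> orthonormal_family k (2 ^ Suc l) V \<and>
     (\<forall>i<2 ^ Suc l. D i \<in> carrier_mat (2 * k) (2 * k)) \<and>
     C = bdm (2 ^ Suc l) (2 * k) k U * B * (bdm (2 ^ Suc l) (2 * k) k V)\<^sup>T + bdm (2 ^ Suc l) (2 * k) (2 * k) D"

text \<open>The diagonal part can be normalised to be orthogonal to the compressed part; this makes all
  factors bounded in terms of \<open>C\<close>.\<close>

lemma HSS_normal_step:
  assumes C: "C \<in> HSS (Suc l) k"
  shows "\<exists>U V D B. hss_step l k C U V D B \<and> fsq B \<le> fsq C \<and> fsq (bdm (2 ^ Suc l) (2 * k) (2 * k) D) \<le> fsq C"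
proof -
  define n :: nat where "n = 2 ^ Suc l"
  obtain U V D B where *: "B \<in> HSS l k" "orthonormal_family k n U" "orthonormal_family k n V"
    "\<And>i. i < n \<Longrightarrow> D i \<in> carrier_mat (2 * k) (2 * k)"
    "C = bdm n (2 * k) k U * B * (bdm n (2 * k) k V)\<^sup>T + bdm n (2 * k) (2 * k) D"
    using C unfolding n_def by (elim HSS_SucE) blast
  have B: "B \<in> carrier_mat (n * k) (n * k)" using HSS_carrier[OF *(1)] by (simp add: n_def ac_simps)
  have Cc: "C \<in> carrier_mat (n * (2 * k)) (n * (2 * k))" using HSS_carrier[OF C] by (simp add: n_def)
  define bU bV bD where "bU = bdm n (2 * k) k U" and "bV = bdm n (2 * k) k V" and "bD = bdm n (2 * k) (2 * k) D"
  have bc: "bU \<in> carrier_mat (n * (2 * k)) (n * k)" "bV \<in> carrier_mat (n * (2 * k)) (n * k)"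
    "bD \<in> carrier_mat (n * (2 * k)) (n * (2 * k))"
    by (simp_all add: bU_def bV_def bD_def)
  have UU: "bU\<^sup>T * bU = 1\<^sub>m (n * k)" and VV: "bV\<^sup>T * bV = 1\<^sub>m (n * k)"
    unfolding bU_def bV_def using *(2,3) by (simp_all add: orthonormal_familyD(3))
  \<comment> \<open>Compressing all of \<open>C\<close> moves into \<open>B'\<close> the portion of
    the diagonal part seen by \<open>U\<close> and \<open>V\<close>; \<open>E\<close> keeps the
    remainder of each diagonal block.\<close>
  define B' where "B' = bU\<^sup>T * C * bV"
  have B'c: "B' \<in> carrier_mat (n * k) (n * k)" unfolding B'_def using bc Cc by auto
  define E where "E i = D i - U i * ((U i)\<^sup>T * D i * V i) * (V i)\<^sup>T" for i
  note d = carrier_matD[OF bc(1)] carrier_matD[OF bc(2)] carrier_matD[OF bc(3)] carrier_matD[OF B] carrier_matD[OF B'c]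
  have o: "U i \<in> carrier_mat (2 * k) k" "V i \<in> carrier_mat (2 * k) k" if "i < n" for i
    using that *(2,3) by (auto dest: orthonormal_familyD)
  have Ec: "E i \<in> carrier_mat (2 * k) (2 * k)" if "i < n" for i
    using o[OF that] unfolding E_def carrier_mat_def by simp
  have UDV: "bU\<^sup>T * bD * bV = bdm n k k (\<lambda>i. (U i)\<^sup>T * D i * V i)"
  proof -
    have "(U i)\<^sup>T * D i \<in> carrier_mat k (2 * k)" if "i < n" for i
      using o[OF that] *(4)[OF that] unfolding carrier_mat_def by simp
    then show ?thesis
      unfolding bU_def bV_def bD_def using o *(4) by (simp add: transpose_bdm bdm_mult)
  qed
  have "bU * bdm n k k (\<lambda>i. (U i)\<^sup>T * D i * V i) * bV\<^sup>T = bdm n (2 * k) (2 * k) (\<lambda>i. U i * ((U i)\<^sup>T * D i * V i) * (V i)\<^sup>T)"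
  proof -
    have "(U i)\<^sup>T * D i * V i \<in> carrier_mat k k" "U i * ((U i)\<^sup>T * D i * V i) \<in> carrier_mat (2 * k) k" if "i < n" for i
      using o[OF that] *(4)[OF that] unfolding carrier_mat_def by simp_all
    then show ?thesis
      unfolding bU_def bV_def using o by (simp add: transpose_bdm bdm_mult)
  qed
  moreover have "U i * ((U i)\<^sup>T * D i * V i) * (V i)\<^sup>T \<in> carrier_mat (2 * k) (2 * k)" if "i < n" for i
    using o[OF that] unfolding carrier_mat_def by simp
  ultimately have bE: "bD - bU * (bU\<^sup>T * bD * bV) * bV\<^sup>T = bdm n (2 * k) (2 * k) E"
    unfolding UDV unfolding bD_def E_def using *(4) by (simp add: bdm_minus)
  have WW: "bU\<^sup>T * (bU * Y) = Y" if "dim_row Y = n * k" for Y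
    using that d UU mat_assoc[of "bU\<^sup>T" bU Y] by simp
  have CC: "C = bU * B * bV\<^sup>T + bD" unfolding *(5) bU_def bV_def bD_def ..
  have "B' = bU\<^sup>T * (bU * B * bV\<^sup>T) * bV + bU\<^sup>T * bD * bV"
    unfolding B'_def CC by (simp add: mat_distrib d)
  also have "bU\<^sup>T * (bU * B * bV\<^sup>T) * bV = B"
    using B by (simp add: mat_assoc d WW VV)
  finally have B'B: "B' = B + bU\<^sup>T * bD * bV" .
  \<comment> \<open>\<open>B'\<close> differs from \<open>B\<close> by
    \<open>k\<close>-by-\<open>k\<close> diagonal blocks, which pair up to a diagonal update of
    level \<open>l\<close>.\<close>
  have "B' \<in> HSS l k"
  proof -
    have n2: "n = 2 * 2 ^ l" by (simp add: n_def)
    show ?thesis unfolding B'B UDV unfolding n2 bdm_pair by (rule HSS_add_bdm[OF *(1)]) simp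
  qed
  have "bU * B' * bV\<^sup>T = bU * B * bV\<^sup>T + bU * (bU\<^sup>T * bD * bV) * bV\<^sup>T"
    unfolding B'B by (simp add: mat_distrib d)
  then have C_E: "C - bU * B' * bV\<^sup>T = bdm n (2 * k) (2 * k) E" and C_eq: "C = bU * B' * bV\<^sup>T + bdm n (2 * k) (2 * k) E"
    unfolding CC bE[symmetric] by (auto intro!: eq_matI simp: d)
  have step: "hss_step l k C U V E B'"
    unfolding hss_step_def n_def[symmetric] using \<open>B' \<in> HSS l k\<close> *(2,3) Ec C_eq by (simp add: bU_def bV_def)
  have "fsq (bdm n (2 * k) (2 * k) E + bU * B' * bV\<^sup>T) = fsq (bdm n (2 * k) (2 * k) E) + fsq B'"
    using residual_orthogonal[OF bc(1) UU bc(2) VV Cc, folded B'_def, unfolded C_E]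
    by (intro fsq_pythagoras[OF bc(1) UU bc(2) VV] bdm_carrier B'c)
  moreover have "bdm n (2 * k) (2 * k) E + bU * B' * bV\<^sup>T = C"
    unfolding C_eq by (rule comm_add_mat[of _ "n * (2 * k)" "n * (2 * k)"]) (use bc B'c in auto)
  ultimately have "fsq B' \<le> fsq C" "fsq (bdm n (2 * k) (2 * k) E) \<le> fsq C"
    using fsq_nonneg[of B'] fsq_nonneg[of "bdm n (2 * k) (2 * k) E"] by auto
  then show ?thesis using step unfolding n_def by blast
qed

text \<open>After normalisation the coarse matrix is handled by the induction hypothesis and
  \<open>U\<close>, \<open>V\<close>, \<open>D\<close> by compactness, along successively refined
  subsequences. The telescoping step is continuous and its constraints survive the limit.\<close>

lemma subseq_closed_HSS: "subseq_closed (2 ^ l * (2 * k)) (2 ^ l * (2 * k)) (HSS l k)"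
proof (induction l)
  case 0
  then show ?case using subseq_closed_carrier by (simp add: HSS_0)
next
  case (Suc l)
  define n :: nat where "n = 2 ^ Suc l"
  have nk: "2 ^ l * (2 * k) = n * k" by (simp add: n_def)
  show ?case
    unfolding subseq_closed_def n_def[symmetric]
  proof (intro conjI allI impI)
    show "HSS (Suc l) k \<subseteq> carrier_mat (n * (2 * k)) (n * (2 * k))"
      using HSS_carrier[of _ "Suc l"] by (auto simp: n_def)
    fix X :: "nat \<Rightarrow> real mat" and b
    assume X: "\<forall>t. X t \<in> HSS (Suc l) k" and b: "\<forall>t. fsq (X t) \<le> b"
    have "\<forall>t. \<exists>U V D B. hss_step l k (X t) U V D B \<and> fsq B \<le> fsq (X t) \<and> fsq (bdm n (2 * k) (2 * k) D) \<le> fsq (X t)"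
      unfolding n_def using X HSS_normal_step by blast
    then obtain U V D B where step: "\<And>t. hss_step l k (X t) (U t) (V t) (D t) (B t)"
      and Bb: "\<And>t. fsq (B t) \<le> fsq (X t)" and Db: "\<And>t. fsq (bdm n (2 * k) (2 * k) (D t)) \<le> fsq (X t)"
      by metis
    have *: "B t \<in> HSS l k" "orthonormal_family k n (U t)" "orthonormal_family k n (V t)"
      "\<And>i. i < n \<Longrightarrow> D t i \<in> carrier_mat (2 * k) (2 * k)"
      "X t = bdm n (2 * k) k (U t) * B t * (bdm n (2 * k) k (V t))\<^sup>T + bdm n (2 * k) (2 * k) (D t)" for t
      using step[of t] unfolding hss_step_def n_def[symmetric] by auto
    obtain r1 B' where r1: "strict_mono r1" "B' \<in> HSS l k" "conv.mfun (n * k) (n * k) (case_option B' (B \<circ> r1))"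
      using subseq_closedD[OF Suc.IH[unfolded nk] *(1) order_trans[OF Bb b[rule_format]]] .
    let ?U = "\<lambda>t. bdm n (2 * k) k (U (r1 t))"
    obtain r2 U' where r2: "strict_mono r2" "U' \<in> carrier_mat (n * (2 * k)) (n * k)"
      "conv.mfun (n * (2 * k)) (n * k) (case_option U' (?U \<circ> r2))"
      by (rule subseq_closedD[OF subseq_closed_carrier, of ?U])
        (rule bdm_carrier, rule eq_refl[OF fsq_orthonormal[OF bdm_carrier orthonormal_familyD(3)[OF *(2)]]])
    let ?V = "\<lambda>t. bdm n (2 * k) k (V (r1 (r2 t)))"
    obtain r3 V' where r3: "strict_mono r3" "V' \<in> carrier_mat (n * (2 * k)) (n * k)"
      "conv.mfun (n * (2 * k)) (n * k) (case_option V' (?V \<circ> r3))"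
      by (rule subseq_closedD[OF subseq_closed_carrier, of ?V])
        (rule bdm_carrier, rule eq_refl[OF fsq_orthonormal[OF bdm_carrier orthonormal_familyD(3)[OF *(3)]]])
    let ?D = "\<lambda>t. bdm n (2 * k) (2 * k) (D (r1 (r2 (r3 t))))"
    obtain r4 D' where r4: "strict_mono r4" "D' \<in> carrier_mat (n * (2 * k)) (n * (2 * k))"
      "conv.mfun (n * (2 * k)) (n * (2 * k)) (case_option D' (?D \<circ> r4))"
      by (rule subseq_closedD[OF subseq_closed_carrier, of ?D])
        (rule bdm_carrier, rule order_trans[OF Db b[rule_format]])
    define r where "r t = r1 (r2 (r3 (r4 t)))" for t
    have r: "strict_mono r"
      using strict_mono_o[OF r1(1) strict_mono_o[OF r2(1) strict_mono_o[OF r3(1) r4(1)]]]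
      by (simp add: r_def[abs_def] o_def)
    have cB: "conv.mfun (n * k) (n * k) (case_option B' (\<lambda>t. B (r t)))"
      using conv_subseq[OF conv_subseq[OF conv_subseq[OF r1(3) r2(1)] r3(1)] r4(1)] by (simp add: o_def r_def)
    have cU: "conv.mfun (n * (2 * k)) (n * k) (case_option U' (\<lambda>t. bdm n (2 * k) k (U (r t))))"
      using conv_subseq[OF conv_subseq[OF r2(3) r3(1)] r4(1)] by (simp add: o_def r_def)
    have cV: "conv.mfun (n * (2 * k)) (n * k) (case_option V' (\<lambda>t. bdm n (2 * k) k (V (r t))))"
      using conv_subseq[OF r3(3) r4(1)] by (simp add: o_def r_def)
    have cD: "conv.mfun (n * (2 * k)) (n * (2 * k)) (case_option D' (\<lambda>t. bdm n (2 * k) (2 * k) (D (r t))))"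
      using r4(3) by (simp add: o_def r_def)
    have oU: "orthonormal_family k n (\<lambda>i. blk (2 * k) k i i U')"
      unfolding orthonormal_family_def
      using conv_orthonormal[OF conv_bdm(2)[OF cU orthonormal_familyD(1)[OF *(2)]]]
        orthonormal_familyD(2)[OF *(2)] by simp
    have oV: "orthonormal_family k n (\<lambda>i. blk (2 * k) k i i V')"
      unfolding orthonormal_family_def
      using conv_orthonormal[OF conv_bdm(2)[OF cV orthonormal_familyD(1)[OF *(3)]]]
        orthonormal_familyD(2)[OF *(3)] by simp
    have limits: "U' = bdm n (2 * k) k (\<lambda>i. blk (2 * k) k i i U')"
      "V' = bdm n (2 * k) k (\<lambda>i. blk (2 * k) k i i V')"
      "D' = bdm n (2 * k) (2 * k) (\<lambda>i. blk (2 * k) (2 * k) i i D')"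
      by (rule conv_bdm(1)[OF cU], erule orthonormal_familyD(1)[OF *(2)])
        (rule conv_bdm(1)[OF cV], erule orthonormal_familyD(1)[OF *(3)],
         rule conv_bdm(1)[OF cD], erule *(4))
    have "U' * B' * V'\<^sup>T + D' \<in> HSS (Suc l) k"
      using HSS_SucI[OF r1(2) oU[unfolded n_def] oV[unfolded n_def], of "\<lambda>i. blk (2 * k) (2 * k) i i D'"]
      unfolding n_def[symmetric] limits[symmetric] by simp
    moreover have "conv.mfun (n * (2 * k)) (n * (2 * k)) (case_option (U' * B' * V'\<^sup>T + D') (X \<circ> r))"
      by (rule conv.mfun_cong[OF conv.mfun_add[OF conv.mfun_mult[OF conv.mfun_mult[OF cU cB] conv.mfun_transpose[OF cV]] cD]])
        (simp add: *(5) split: option.split)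
    ultimately show "\<exists>r C. strict_mono r \<and> C \<in> HSS (Suc l) k \<and>
        conv.mfun (n * (2 * k)) (n * (2 * k)) (case_option C (X \<circ> r))"
      using r by blast
  qed
qed

section \<open>The greedy procedure\<close>

lemma hss_factors_level:
  assumes "hss_factors L k U V D" "l \<in> {1..L}"
  shows "orthonormal_family k (2 ^ l) (U l)" "orthonormal_family k (2 ^ l) (V l)"
    "\<And>i. i < 2 ^ l \<Longrightarrow> D l i \<in> carrier_mat (2 * k) (2 * k)"
    "blockdiag U l = bdm (2 ^ l) (2 * k) k (U l)" "blockdiag V l = bdm (2 ^ l) (2 * k) k (V l)"
    "blockdiag D l = bdm (2 ^ l) (2 * k) (2 * k) (D l)"
proof -
  have *: "U l i \<in> carrier_mat (2 * k) k \<and> orthonormal_cols (U l i) \<and>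
      V l i \<in> carrier_mat (2 * k) k \<and> orthonormal_cols (V l i) \<and> D l i \<in> carrier_mat (2 * k) (2 * k)"
    if "i < 2 ^ l" for i
    using assms that unfolding hss_factors_def by blast
  then show "orthonormal_family k (2 ^ l) (U l)" "orthonormal_family k (2 ^ l) (V l)"
    by (auto simp: orthonormal_family_def orthonormal_cols_def)
  show D: "D l i \<in> carrier_mat (2 * k) (2 * k)" if "i < 2 ^ l" for i using *[OF that] by blast
  show "blockdiag U l = bdm (2 ^ l) (2 * k) k (U l)" "blockdiag V l = bdm (2 ^ l) (2 * k) k (V l)"
    "blockdiag D l = bdm (2 ^ l) (2 * k) (2 * k) (D l)"
    using * by (blast intro: blockdiag_bdm)+
qed

lemma greedy_level_top: "greedy_level L A U V D (Suc L) = A"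
  by (simp add: greedy_level.simps)

lemma greedy_level_step:
  assumes "hss_factors L k U V D" "l \<in> {1..L}"
  shows "greedy_level L A U V D l = (bdm (2 ^ l) (2 * k) k (U l))\<^sup>T *
    (greedy_level L A U V D (Suc l) - bdm (2 ^ l) (2 * k) (2 * k) (D l)) * bdm (2 ^ l) (2 * k) k (V l)"
  using assms(2) greedy_level.simps[of L A U V D l] hss_factors_level(4-6)[OF assms] by simp

lemma greedy_level_carrier:
  assumes A: "A \<in> carrier_mat (2 ^ L * (2 * k)) (2 ^ L * (2 * k))" and h: "hss_factors L k U V D" and l: "l \<le> L"
  shows "greedy_level L A U V D (Suc l) \<in> carrier_mat (2 ^ l * (2 * k)) (2 ^ l * (2 * k))"
proof (cases "l = L")
  case True
  then show ?thesis using A by (simp add: greedy_level_top)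
next
  case False
  then have "Suc l \<in> {1..L}" using l by simp
  from greedy_level_step[OF h this] show ?thesis unfolding carrier_mat_def by simp
qed

text \<open>Each level contributes its residual, orthogonal to the lifted error of the coarser
  levels; at the coarsest level \<open>D0\<close> equals the matrix, so nothing is lost there.
  \<open>telescope\<close> at \<open>j\<close> belongs to level \<open>j + 1\<close>, hence
  \<open>Suc j\<close> on the left.\<close>

lemma greedy_error:
  assumes A: "A \<in> carrier_mat (2 ^ L * (2 * k)) (2 ^ L * (2 * k))" and h: "hss_factors L k U V D" and "j \<le> L"
  shows "telescope (greedy_level L A U V D 1) U V D j \<in> carrier_mat (2 ^ j * (2 * k)) (2 ^ j * (2 * k))"
    and "fsq (greedy_level L A U V D (Suc j) - telescope (greedy_level L A U V D 1) U V D j) =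
    (\<Sum>l=1..j. let H = greedy_level L A U V D (Suc l) - bdm (2 ^ l) (2 * k) (2 * k) (D l) in
      fsq (H - bdm (2 ^ l) (2 * k) k (U l) * ((bdm (2 ^ l) (2 * k) k (U l))\<^sup>T * H * bdm (2 ^ l) (2 * k) k (V l))
        * (bdm (2 ^ l) (2 * k) k (V l))\<^sup>T))"
  using \<open>j \<le> L\<close>
proof (induction j)
  case 0
  {
    case 1
    show ?case using greedy_level_carrier[OF A h, of 0] by simp
  next
    case 2
    show ?case using greedy_level_carrier[OF A h, of 0] by (simp add: fsq_def)
  }
next
  case (Suc j)
  define n :: nat where "n = 2 ^ Suc j"
  define bU bV bD where "bU = bdm n (2 * k) k (U (Suc j))" and "bV = bdm n (2 * k) k (V (Suc j))"
    and "bD = bdm n (2 * k) (2 * k) (D (Suc j))"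
  have eq: "telescope (greedy_level L A U V D 1) U V D (Suc j)
      = bU * telescope (greedy_level L A U V D 1) U V D j * bV\<^sup>T + bD" if "Suc j \<le> L"
    using hss_factors_level(4-6)[OF h, of "Suc j"] that by (simp add: bU_def bV_def bD_def n_def)
  {
    case 1
    have "X + bD \<in> carrier_mat (n * (2 * k)) (n * (2 * k))" for X by (simp add: bD_def)
    then show ?case unfolding eq[OF 1] unfolding n_def .
  next
    case 2
    have l: "Suc j \<in> {1..L}" using 2 by simp
    define T where "T = telescope (greedy_level L A U V D 1) U V D j"
    define G G' where "G = greedy_level L A U V D (Suc j)" and "G' = greedy_level L A U V D (Suc (Suc j))"
    define H where "H = G' - bD"
    have nk: "2 ^ j * (2 * k) = n * k" by (simp add: n_def)
    have Tc: "T \<in> carrier_mat (n * k) (n * k)" using Suc(1) 2 unfolding T_def nk by simp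
    have Gc: "G \<in> carrier_mat (n * k) (n * k)"
      using greedy_level_carrier[OF A h, of j] 2 unfolding G_def nk by simp
    have G'c: "G' \<in> carrier_mat (n * (2 * k)) (n * (2 * k))"
      using greedy_level_carrier[OF A h, of "Suc j"] 2 unfolding G'_def n_def by simp
    have bc: "bU \<in> carrier_mat (n * (2 * k)) (n * k)" "bV \<in> carrier_mat (n * (2 * k)) (n * k)"
      "bD \<in> carrier_mat (n * (2 * k)) (n * (2 * k))"
      by (simp_all add: bU_def bV_def bD_def)
    have Hc: "H \<in> carrier_mat (n * (2 * k)) (n * (2 * k))" unfolding H_def by (rule minus_carrier_mat[OF bc(3)])
    have UU: "bU\<^sup>T * bU = 1\<^sub>m (n * k)" and VV: "bV\<^sup>T * bV = 1\<^sub>m (n * k)"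
      using hss_factors_level(1,2)[OF h l] by (simp_all only: bU_def bV_def n_def orthonormal_familyD(3))
    have G: "G = bU\<^sup>T * H * bV"
      using greedy_level_step[OF h l, of A] unfolding G_def G'_def H_def bU_def bV_def bD_def n_def .
    define E where "E = H - bU * G * bV\<^sup>T"
    have Ec: "E \<in> carrier_mat (n * (2 * k)) (n * (2 * k))" unfolding E_def carrier_mat_def using bc by simp
    \<comment> \<open>Inserting \<open>bU * G * bV\<^sup>T\<close> separates the residual of this
      level from the lifted error of the coarser ones.\<close>
    have "G' - (bU * T * bV\<^sup>T + bD) = E + bU * (G - T) * bV\<^sup>T"
    proof -
      have "bU * (G - T) * bV\<^sup>T = bU * G * bV\<^sup>T - bU * T * bV\<^sup>T"
        using carrier_matD[OF bc(1)] carrier_matD[OF bc(2)] carrier_matD[OF Gc] carrier_matD[OF Tc] by (simp add: mat_distrib)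
      then show ?thesis
        unfolding E_def H_def
        using carrier_matD[OF bc(1)] carrier_matD[OF bc(2)] carrier_matD[OF bc(3)] carrier_matD[OF G'c]
        by (intro eq_matI) simp_all
    qed
    then have "fsq (G' - (bU * T * bV\<^sup>T + bD)) = fsq E + fsq (G - T)"
      using residual_orthogonal[OF bc(1) UU bc(2) VV Hc, folded G, folded E_def]
      by (simp only:) (rule fsq_pythagoras[OF bc(1) UU bc(2) VV Ec minus_carrier_mat[OF Tc]])
    moreover have "fsq (G - T) = (\<Sum>l=1..j. let H = greedy_level L A U V D (Suc l) - bdm (2 ^ l) (2 * k) (2 * k) (D l) in
      fsq (H - bdm (2 ^ l) (2 * k) k (U l) * ((bdm (2 ^ l) (2 * k) k (U l))\<^sup>T * H * bdm (2 ^ l) (2 * k) k (V l))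
        * (bdm (2 ^ l) (2 * k) k (V l))\<^sup>T))"
      using Suc(2) 2 unfolding G_def T_def by simp
    ultimately show ?case
      unfolding eq[OF 2] T_def[symmetric] G'_def[symmetric]
      by (simp add: Let_def E_def G) (simp add: G'_def H_def bU_def bV_def bD_def n_def)
  }
qed

section \<open>The error of one level, and its comparison with the optimum\<close>

lemma diag_block_blk:
  assumes "X \<in> carrier_mat (n * (2 * k)) (n * (2 * k))" "i < n"
  shows "diag_block k i X = blk (2 * k) (2 * k) i i X"
  unfolding diag_block_def submatrix_def blk_def carrier_matD[OF assms(1)] block_idx_within[OF assms(2)] card_block_idx
  by (intro cong_mat refl) (simp add: pick_block_idx)

text \<open>Since \<open>D\<close> touches only diagonal blocks, block \<open>(i,j)\<close> off the
  diagonal is the two-sided residual of the original block for \<open>U i\<close> and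
  \<open>V j\<close>. It costs its share of the error of block-row \<open>i\<close> plus its share
  of the error of block-column \<open>j\<close>, and orthogonality spares a factor 2.\<close>

lemma level_error_le:
  fixes k :: nat and U V D :: "nat \<Rightarrow> real mat" and G :: "real mat" and re ce de :: "nat \<Rightarrow> real"
  defines "re i \<equiv> (let R = block_row k i G in fsq (R - U i * (U i)\<^sup>T * R))"
    and "ce i \<equiv> (let C = block_col k i G in fsq (C - C * V i * (V i)\<^sup>T))"
    and "de i \<equiv> (let E = diag_block k i G - D i in fsq (E - U i * (U i)\<^sup>T * E * V i * (V i)\<^sup>T))"
  assumes G: "G \<in> carrier_mat (n * (2 * k)) (n * (2 * k))"
    and U: "orthonormal_family k n U" and V: "orthonormal_family k n V"
    and D: "\<And>i. i < n \<Longrightarrow> D i \<in> carrier_mat (2 * k) (2 * k)"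
  shows "(let H = G - bdm n (2 * k) (2 * k) D in
      fsq (H - bdm n (2 * k) k U * ((bdm n (2 * k) k U)\<^sup>T * H * bdm n (2 * k) k V) * (bdm n (2 * k) k V)\<^sup>T))
    \<le> (\<Sum>i<n. de i + re i + ce i)"
proof -
  define bU bV bD where "bU = bdm n (2 * k) k U" and "bV = bdm n (2 * k) k V" and "bD = bdm n (2 * k) (2 * k) D"
  define H where "H = G - bD"
  have bc: "bU \<in> carrier_mat (n * (2 * k)) (n * k)" "bV \<in> carrier_mat (n * (2 * k)) (n * k)"
    "bD \<in> carrier_mat (n * (2 * k)) (n * (2 * k))"
    by (simp_all add: bU_def bV_def bD_def)
  have Hc: "H \<in> carrier_mat (n * (2 * k)) (n * (2 * k))" unfolding H_def by (rule minus_carrier_mat[OF bc(3)])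
  note u = orthonormal_familyD(1,2)[OF U] and v = orthonormal_familyD(1,2)[OF V]
  define X where "X = bU * (bU\<^sup>T * H * bV) * bV\<^sup>T"
  have Xc: "X \<in> carrier_mat (n * (2 * k)) (n * (2 * k))" unfolding X_def carrier_mat_def using bc by simp
  define b where "b i j = blk (2 * k) (2 * k) i j G" for i j
  have bX: "blk (2 * k) (2 * k) i j X = U i * (U i)\<^sup>T * blk (2 * k) (2 * k) i j H * V j * (V j)\<^sup>T"
    if ij: "i < n" "j < n" for i j
  proof -
    have 1: "bU\<^sup>T * H \<in> carrier_mat (n * k) (n * (2 * k))" and 2: "bU\<^sup>T * H * bV \<in> carrier_mat (n * k) (n * k)"
      and 3: "bU * (bU\<^sup>T * H * bV) \<in> carrier_mat (n * (2 * k)) (n * k)"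
      using bc Hc by auto
    have UT: "(U i)\<^sup>T \<in> carrier_mat k (2 * k)" using u(1)[OF ij(1)] by simp
    have "blk (2 * k) (2 * k) i j X = blk (2 * k) k i j (bU * (bU\<^sup>T * H * bV)) * (V j)\<^sup>T"
      unfolding X_def bV_def by (rule blk_mult_bdm_transpose[OF v(1)]) (use 3 ij in \<open>simp_all add: bV_def\<close>)
    also have "blk (2 * k) k i j (bU * (bU\<^sup>T * H * bV)) = U i * blk k k i j (bU\<^sup>T * H * bV)"
      using blk_bdm_mult[of U i, OF u(1)[OF ij(1)] 2 ij] unfolding bU_def .
    also have "blk k k i j (bU\<^sup>T * H * bV) = blk k (2 * k) i j (bU\<^sup>T * H) * V j"
      using blk_mult_bdm[OF v(1) 1 ij] unfolding bV_def by simp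
    also have "blk k (2 * k) i j (bU\<^sup>T * H) = (U i)\<^sup>T * blk (2 * k) (2 * k) i j H"
    proof -
      have "bU\<^sup>T = bdm n k (2 * k) (\<lambda>i. (U i)\<^sup>T)" unfolding bU_def by (rule transpose_bdm[OF u(1)])
      then show ?thesis using blk_bdm_mult[of "\<lambda>i. (U i)\<^sup>T", OF UT Hc ij] by simp
    qed
    finally show ?thesis
      using carrier_matD[OF u(1)[OF ij(1)]] carrier_matD[OF v(1)[OF ij(2)]] by (simp add: mat_assoc)
  qed
  have bH: "blk (2 * k) (2 * k) i j H = (if i = j then b i i - D i else b i j)" if ij: "i < n" "j < n" for i j
  proof -
    have "blk (2 * k) (2 * k) i j H = b i j - (if i = j then D i else 0\<^sub>m (2 * k) (2 * k))"
      unfolding H_def b_def using blk_minus[OF G bc(3) ij] blk_bdm[of i n j D, OF ij D[OF ij(1)]] unfolding bD_def by simp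
    moreover have "b i j - 0\<^sub>m (2 * k) (2 * k) = b i j" by (intro eq_matI) (simp_all add: b_def)
    ultimately show ?thesis by (cases "i = j") simp_all
  qed
  define rij where "rij i j = fsq (b i j - U i * (U i)\<^sup>T * b i j)" for i j
  define cij where "cij i j = fsq (b i j - b i j * V j * (V j)\<^sup>T)" for i j
  have UU: "U i * (U i)\<^sup>T \<in> carrier_mat (2 * k) (2 * k)" and VV: "V i * (V i)\<^sup>T \<in> carrier_mat (2 * k) (2 * k)"
    if "i < n" for i
    using u(1)[OF that] v(1)[OF that] unfolding carrier_mat_def by simp_all
  have re: "re i = (\<Sum>j\<in>{..<n} - {i}. rij i j)" if "i < n" for i
    unfolding re_def Let_def rij_def b_def by (rule fsq_block_row_residual[OF G that UU[OF that]])
  have ce: "ce j = (\<Sum>i\<in>{..<n} - {j}. cij i j)" if j: "j < n" for j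
  proof -
    have assoc: "X * V j * (V j)\<^sup>T = X * (V j * (V j)\<^sup>T)" if "dim_col X = 2 * k" for X
      using carrier_matD[OF v(1)[OF j]] that by (intro mat_assoc) simp_all
    have "dim_row (block_row k j G\<^sup>T) = 2 * k"
      using block_row_off_rows[of "G\<^sup>T" n k j] carrier_matD[OF G] j by simp
    then have "dim_col (block_col k j G) = 2 * k" by (simp add: block_col_transpose)
    then show ?thesis
      unfolding ce_def Let_def cij_def assoc[OF \<open>dim_col (block_col k j G) = 2 * k\<close>]
        fsq_block_col_residual[OF G j VV[OF j]] b_def
      by (simp add: assoc)
  qed
  have le: "fsq (blk (2 * k) (2 * k) i j (H - X)) \<le> (if i = j then de i else rij i j + cij i j)"
    if ij: "i < n" "j < n" for i j
  proof (cases "i = j")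
    case True
    then have ji: "j = i" by simp
    have "b i i = diag_block k i G" unfolding b_def by (rule diag_block_blk[OF G ij(1), symmetric])
    then show ?thesis
      unfolding blk_minus[OF Hc Xc ij] bX[OF ij] unfolding bH[OF ij] unfolding ji de_def Let_def
      by (simp only: if_True simp_thms order_refl)
  next
    case False
    then have "fsq (blk (2 * k) (2 * k) i j (H - X)) = fsq (b i j - U i * (U i)\<^sup>T * b i j * V j * (V j)\<^sup>T)"
      unfolding blk_minus[OF Hc Xc ij] bX[OF ij] unfolding bH[OF ij] by simp
    also have "\<dots> \<le> rij i j + cij i j"
      unfolding rij_def cij_def
      by (rule fsq_two_sided_le[OF u(1)[OF ij(1)] u(2)[OF ij(1)] v(1)[OF ij(2)]]) (simp add: b_def)
    finally show ?thesis using False by simp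
  qed
  have split: "(\<Sum>j<n. if i = j then de i else f j) = de i + (\<Sum>j\<in>{..<n} - {i}. f j)"
    if "i < n" for i and f :: "nat \<Rightarrow> real"
  proof -
    have "(\<Sum>j<n. if i = j then de i else f j) = de i + (\<Sum>j\<in>{..<n} - {i}. if i = j then de i else f j)"
      using sum.remove[of "{..<n}" i "\<lambda>j. if i = j then de i else f j"] that by simp
    also have "(\<Sum>j\<in>{..<n} - {i}. if i = j then de i else f j) = (\<Sum>j\<in>{..<n} - {i}. f j)"
      by (rule sum.cong) auto
    finally show ?thesis .
  qed
  have "fsq (H - X) = (\<Sum>i<n. \<Sum>j<n. fsq (blk (2 * k) (2 * k) i j (H - X)))"
    by (rule fsq_blk[OF minus_carrier_mat[OF Xc]])
  also have "\<dots> \<le> (\<Sum>i<n. \<Sum>j<n. if i = j then de i else rij i j + cij i j)"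
    by (intro sum_mono le) simp_all
  also have "\<dots> = (\<Sum>i<n. de i + re i + (\<Sum>j\<in>{..<n} - {i}. cij i j))"
  proof (rule sum.cong[OF refl])
    fix i assume "i \<in> {..<n}"
    then have i: "i < n" by simp
    show "(\<Sum>j<n. if i = j then de i else rij i j + cij i j) = de i + re i + (\<Sum>j\<in>{..<n} - {i}. cij i j)"
      unfolding split[OF i] re[OF i] sum.distrib by (rule add.assoc[symmetric])
  qed
  also have "\<dots> = (\<Sum>i<n. de i + re i) + (\<Sum>i<n. \<Sum>j\<in>{..<n} - {i}. cij i j)"
    by (rule sum.distrib)
  \<comment> \<open>The off-diagonal pairs are regrouped by column, because a block-column error
    collects the blocks above and below the diagonal.\<close>
  also have "(\<Sum>i<n. \<Sum>j\<in>{..<n} - {i}. cij i j) = (\<Sum>j<n. \<Sum>i\<in>{..<n} - {j}. cij i j)"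
  proof -
    have *: "(\<Sum>j\<in>{..<n} - {i}. f j) = (\<Sum>j<n. if i = j then 0 else f j)" for i and f :: "nat \<Rightarrow> real"
      by (rule sum.mono_neutral_cong_left) auto
    show ?thesis unfolding *
      by (subst sum.swap) (intro sum.cong refl if_cong, blast)
  qed
  also have "\<dots> = (\<Sum>j<n. ce j)" by (rule sum.cong[OF refl]) (rule ce[symmetric], simp)
  finally show ?thesis
    unfolding Let_def bU_def[symmetric] bV_def[symmetric] bD_def[symmetric] H_def[symmetric] X_def[symmetric]
    by (simp only: sum.distrib)
qed

text \<open>The competitor \<open>C'\<close> is \<open>C\<close> pushed through the same
  compressions as \<open>A\<close>. It depends on the chosen factors, but the bound on the right
  does not; this is what makes a deterministic bound possible for random factors.\<close>

lemma greedy_opt_le: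
  assumes A: "A \<in> carrier_mat (2 ^ L * (2 * k)) (2 ^ L * (2 * k))" and h: "hss_factors L k U V D"
    and C: "C \<in> HSS L k" and "l \<le> L"
  shows "\<exists>C'\<in>HSS l k. fsq (greedy_level L A U V D (Suc l) - C') \<le> fsq (A - C)"
  using \<open>l \<le> L\<close>
proof (induction rule: inc_induct)
  case base
  then show ?case using C by (auto simp: greedy_level_top)
next
  case (step l)
  define n :: nat where "n = 2 ^ Suc l"
  define bU bV bD where "bU = bdm n (2 * k) k (U (Suc l))" and "bV = bdm n (2 * k) k (V (Suc l))"
    and "bD = bdm n (2 * k) (2 * k) (D (Suc l))"
  have l: "Suc l \<in> {1..L}" using step by simp
  obtain C' where C': "C' \<in> HSS (Suc l) k" "fsq (greedy_level L A U V D (Suc (Suc l)) - C') \<le> fsq (A - C)"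
    using step by blast
  define G' where "G' = greedy_level L A U V D (Suc (Suc l))"
  note f = hss_factors_level[OF h l]
  have C'c: "C' \<in> carrier_mat (n * (2 * k)) (n * (2 * k))" using HSS_carrier[OF C'(1)] by (simp add: n_def)
  have G'c: "G' \<in> carrier_mat (n * (2 * k)) (n * (2 * k))"
    using greedy_level_carrier[OF A h, of "Suc l"] l unfolding G'_def n_def by simp
  have bc: "bU \<in> carrier_mat (n * (2 * k)) (n * k)" "bV \<in> carrier_mat (n * (2 * k)) (n * k)"
    "bD \<in> carrier_mat (n * (2 * k)) (n * (2 * k))"
    by (simp_all add: bU_def bV_def bD_def)
  have UU: "bU\<^sup>T * bU = 1\<^sub>m (n * k)" and VV: "bV\<^sup>T * bV = 1\<^sub>m (n * k)"
    using f(1,2) by (simp_all only: bU_def bV_def n_def orthonormal_familyD(3))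
  have G: "greedy_level L A U V D (Suc l) = bU\<^sup>T * (G' - bD) * bV"
    using greedy_level_step[OF h l, of A] unfolding G'_def bU_def bV_def bD_def n_def .
  have mem: "bU\<^sup>T * (C' - bD) * bV \<in> HSS l k"
    unfolding bU_def bV_def bD_def n_def by (rule HSS_compress[OF C'(1) f(1,2,3)])
  have "bU\<^sup>T * X * bV - bU\<^sup>T * Y * bV = bU\<^sup>T * (X - Y) * bV"
    if "X \<in> carrier_mat (n * (2 * k)) (n * (2 * k))" "Y \<in> carrier_mat (n * (2 * k)) (n * (2 * k))" for X Y
    using carrier_matD[OF bc(1)] carrier_matD[OF bc(2)] carrier_matD[OF that(1)] carrier_matD[OF that(2)]
    by (simp add: mat_distrib)
  note this[OF minus_carrier_mat[OF bc(3), of G'] minus_carrier_mat[OF bc(3), of C']]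
  \<comment> \<open>The diagonal part is subtracted from both matrices and cancels, so its quality
    is irrelevant to this comparison.\<close>
  also have "G' - bD - (C' - bD) = G' - C'"
    using carrier_matD[OF bc(3)] carrier_matD[OF G'c] carrier_matD[OF C'c] by (intro eq_matI) simp_all
  finally have "fsq (greedy_level L A U V D (Suc l) - bU\<^sup>T * (C' - bD) * bV) \<le> fsq (G' - C')"
    unfolding G using fsq_compress_le[OF bc(1) UU bc(2) VV minus_carrier_mat[OF C'c]] by simp
  then show ?case using C'(2) mem unfolding G'_def by (meson order_trans)
qed

text \<open>The block-rows of \<open>C\<close> are admissible competitors of rank at most
  \<open>k\<close>, and the block-rows of \<open>G - C\<close> are disjoint pieces of it.\<close>

lemma best_block_row_le:
  assumes G: "G \<in> carrier_mat (2 ^ Suc l * (2 * k)) (2 ^ Suc l * (2 * k))" and C: "C \<in> HSS (Suc l) k"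
  shows "(\<Sum>i<2 ^ Suc l. fsq (block_row k i G - best_rank_approx k (block_row k i G))) \<le> fsq (G - C)"
proof -
  define n :: nat where "n = 2 ^ Suc l"
  have Gc: "G \<in> carrier_mat (n * (2 * k)) (n * (2 * k))" using G by (simp add: n_def)
  have Cc: "C \<in> carrier_mat (n * (2 * k)) (n * (2 * k))" using HSS_carrier[OF C] by (simp add: n_def)
  have "fsq (block_row k i G - best_rank_approx k (block_row k i G)) \<le> fsq (block_row k i (G - C))" if i: "i < n" for i
  proof -
    obtain P Z where PZ: "P \<in> carrier_mat (2 * k) k" "Z \<in> carrier_mat k (dim_col (block_row k i C))" "block_row k i C = P * Z"
      using block_row_HSS[OF C] i unfolding n_def by blast
    have d: "block_row k i G \<in> carrier_mat (2 * k) (dim_col (block_row k i C))"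
      unfolding block_row_off_rows[OF carrier_matD(1)[OF Gc] i] block_row_off_rows[OF carrier_matD(1)[OF Cc] i]
      unfolding carrier_mat_def using carrier_matD[OF Gc] carrier_matD[OF Cc] by simp
    have "fsq (block_row k i G - best_rank_approx k (block_row k i G)) \<le> fsq (block_row k i G - P * Z)"
      by (rule best_rank_approx_le[OF d _ PZ(1,2)]) simp
    then show ?thesis unfolding PZ(3)[symmetric] block_row_minus[OF Gc Cc i] .
  qed
  then have "(\<Sum>i<n. fsq (block_row k i G - best_rank_approx k (block_row k i G))) \<le> (\<Sum>i<n. fsq (block_row k i (G - C)))"
    by (intro sum_mono) simp
  also have "\<dots> \<le> fsq (G - C)" by (rule sum_fsq_block_row_le[OF minus_carrier_mat[OF Cc]])
  finally show ?thesis by (simp add: n_def)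
qed

lemma best_block_col_le:
  assumes G: "G \<in> carrier_mat (2 ^ Suc l * (2 * k)) (2 ^ Suc l * (2 * k))" and C: "C \<in> HSS (Suc l) k"
  shows "(\<Sum>i<2 ^ Suc l. fsq (block_col k i G - best_rank_approx k (block_col k i G))) \<le> fsq (G - C)"
proof -
  define n :: nat where "n = 2 ^ Suc l"
  have Gc: "G\<^sup>T \<in> carrier_mat (n * (2 * k)) (n * (2 * k))" using G by (simp add: n_def)
  have Cc: "C\<^sup>T \<in> carrier_mat (n * (2 * k)) (n * (2 * k))" using HSS_carrier[OF C] by (simp add: n_def)
  have "fsq (block_col k i G - best_rank_approx k (block_col k i G)) \<le> fsq (block_row k i (G\<^sup>T - C\<^sup>T))" if i: "i < n" for i
  proof -
    obtain P Z where PZ: "P \<in> carrier_mat (2 * k) k" "Z \<in> carrier_mat k (dim_col (block_row k i C\<^sup>T))"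
      "block_row k i C\<^sup>T = P * Z"
      using block_row_HSS[OF HSS_transpose[OF C]] i unfolding n_def by blast
    have d: "block_row k i G\<^sup>T \<in> carrier_mat (2 * k) (dim_col (block_row k i C\<^sup>T))"
      unfolding block_row_off_rows[OF carrier_matD(1)[OF Gc] i] block_row_off_rows[OF carrier_matD(1)[OF Cc] i]
      unfolding carrier_mat_def using carrier_matD[OF Gc] carrier_matD[OF Cc] by simp
    have d': "block_col k i G \<in> carrier_mat (dim_col (block_row k i C\<^sup>T)) (2 * k)"
      unfolding block_col_transpose using d by simp
    have "fsq (block_col k i G - best_rank_approx k (block_col k i G)) \<le> fsq (block_col k i G - Z\<^sup>T * P\<^sup>T)"
      by (rule best_rank_approx_le[OF d']) (simp, use PZ(1,2) in simp_all)
    also have "block_col k i G - Z\<^sup>T * P\<^sup>T = (block_row k i G\<^sup>T - P * Z)\<^sup>T"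
      unfolding block_col_transpose using carrier_matD[OF d] carrier_matD[OF PZ(1)] carrier_matD[OF PZ(2)]
      by (simp add: mat_transpose_minus mat_transpose_mult)
    finally show ?thesis unfolding fsq_transpose PZ(3)[symmetric] block_row_minus[OF Gc Cc i] .
  qed
  then have "(\<Sum>i<n. fsq (block_col k i G - best_rank_approx k (block_col k i G))) \<le> (\<Sum>i<n. fsq (block_row k i (G\<^sup>T - C\<^sup>T)))"
    by (intro sum_mono) simp
  also have "\<dots> \<le> fsq (G\<^sup>T - C\<^sup>T)" by (rule sum_fsq_block_row_le[OF minus_carrier_mat[OF Cc]])
  also have "G\<^sup>T - C\<^sup>T = (G - C)\<^sup>T"
    using carrier_matD[OF G] carrier_matD[OF HSS_carrier[OF C]] by (simp add: mat_transpose_minus)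
  finally show ?thesis by (simp add: n_def fsq_transpose)
qed

section \<open>Random factors\<close>

lemma fun_algebra_borel: "fun_algebra (space M) (borel_measurable M)"
proof
  fix f g :: "'a \<Rightarrow> real"
  assume "f \<in> borel_measurable M" "\<And>p. p \<in> space M \<Longrightarrow> f p = g p"
  then show "g \<in> borel_measurable M" by (simp cong: measurable_cong)
qed simp_all

text \<open>The generators are preimages of Borel sets under single entries. So measurability is an
  entrywise matter and the closure rules for \<open>mfun\<close> apply to random matrices.\<close>

lemma measurable_mat_borel:
  "X \<in> measurable M (mat_borel m n) \<longleftrightarrow> fun_algebra.mfun (space M) (borel_measurable M) m n X"
proof -
  interpret meas: fun_algebra "space M" "borel_measurable M" by (rule fun_algebra_borel)
  define G where "G = {{X \<in> carrier_mat m n. X $$ (i,j) \<in> S} | i j S. i < m \<and> j < n \<and> S \<in> sets (borel :: real measure)}"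
  have G: "G \<subseteq> Pow (carrier_mat m n)" by (auto simp: G_def)
  have mb: "mat_borel m n = sigma (carrier_mat m n) G" by (simp add: mat_borel_def G_def)
  show ?thesis
  proof
    assume X: "X \<in> measurable M (mat_borel m n)"
    have c: "X \<omega> \<in> carrier_mat m n" if "\<omega> \<in> space M" for \<omega>
      using measurable_space[OF X that] G by (simp add: mb space_measure_of)
    have "(\<lambda>\<omega>. X \<omega> $$ (i,j)) \<in> borel_measurable M" if "i < m" "j < n" for i j
    proof (rule measurableI)
      fix S :: "real set" assume S: "S \<in> sets borel"
      have "{Y \<in> carrier_mat m n. Y $$ (i,j) \<in> S} \<in> sets (mat_borel m n)"
        unfolding mb using G S that by (intro in_measure_of) (auto simp: G_def)
      from measurable_sets[OF X this]
      show "(\<lambda>\<omega>. X \<omega> $$ (i,j)) -` S \<inter> space M \<in> sets M"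
        by (rule back_subst[where P = "\<lambda>A. A \<in> sets M"]) (use c in auto)
    qed simp
    then show "meas.mfun m n X" using c by (simp add: meas.mfun_def)
  next
    assume X: "meas.mfun m n X"
    show "X \<in> measurable M (mat_borel m n)"
      unfolding mb
    proof (rule measurable_measure_of[OF G])
      show "X \<in> space M \<rightarrow> carrier_mat m n" using meas.mfunD(1)[OF X] by blast
      fix Y assume "Y \<in> G"
      then obtain i j S where Y: "Y = {X \<in> carrier_mat m n. X $$ (i,j) \<in> S}" "i < m" "j < n" "S \<in> sets borel"
        by (auto simp: G_def)
      from measurable_sets[OF meas.mfunD(2)[OF X Y(2,3)] Y(4)]
      show "X -` Y \<inter> space M \<in> sets M"
        by (rule back_subst[where P = "\<lambda>A. A \<in> sets M"]) (use meas.mfunD(1)[OF X] in \<open>auto simp: Y(1)\<close>)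
    qed
  qed
qed

section \<open>Conditional expectations\<close>

lemma measurable_cond_nn_expectation: "cond_nn_expectation M N X f \<in> borel_measurable M"
  unfolding cond_nn_expectation_def by (rule borel_measurable_nn_cond_exp2)

text \<open>The law of total expectation: the defining property of conditional expectation with test
  function 1.\<close>

lemma nn_integral_cond_nn_expectation:
  assumes "prob_space M" and X: "X \<in> measurable M N" and f: "f \<in> borel_measurable M"
  shows "(\<integral>\<^sup>+ \<omega>. cond_nn_expectation M N X f \<omega> \<partial>M) = (\<integral>\<^sup>+ \<omega>. ennreal (f \<omega>) \<partial>M)"
proof -
  interpret prob_space M by fact
  define F where "F = vimage_algebra (space M) X N"
  have "subalgebra M F"
    unfolding subalgebra_def F_def using sets_image_in_sets[OF refl X] by simp
  then interpret finite_measure_subalgebra M F by unfold_locales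
  have "(\<integral>\<^sup>+ \<omega>. 1 * nn_cond_exp M F (\<lambda>\<omega>. ennreal (f \<omega>)) \<omega> \<partial>M) = (\<integral>\<^sup>+ \<omega>. 1 * ennreal (f \<omega>) \<partial>M)"
    by (rule nn_cond_exp_intg) (use f in measurable)
  then show ?thesis by (simp add: cond_nn_expectation_def F_def)
qed

lemma nn_integral_le_of_cond_le:
  assumes "prob_space M" and "X \<in> measurable M N" and "f \<in> borel_measurable M"
    and "AE \<omega> in M. cond_nn_expectation M N X f \<omega> \<le> g \<omega>"
  shows "(\<integral>\<^sup>+ \<omega>. ennreal (f \<omega>) \<partial>M) \<le> (\<integral>\<^sup>+ \<omega>. g \<omega> \<partial>M)"
  using nn_integral_mono_AE[OF assms(4)] nn_integral_cond_nn_expectation[OF assms(1-3)] by simp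

text \<open>The bounds \<open>g i\<close> are added up pointwise to a constant before integrating,
  so the integral of a single best-rank error never occurs. No individual \<open>g i\<close> is
  controlled, only their sum.\<close>

lemma sum_nn_integral_le_of_cond_le:
  assumes "prob_space M" and "finite I" and X: "X \<in> measurable M N"
    and f: "\<And>i. i \<in> I \<Longrightarrow> f i \<in> borel_measurable M"
    and le: "\<And>i. i \<in> I \<Longrightarrow> AE \<omega> in M. cond_nn_expectation M N X (f i) \<omega> \<le> ennreal (g i \<omega>)"
    and g: "\<And>i \<omega>. 0 \<le> g i \<omega>" and b: "\<And>\<omega>. \<omega> \<in> space M \<Longrightarrow> (\<Sum>i\<in>I. g i \<omega>) \<le> b"
  shows "(\<Sum>i\<in>I. \<integral>\<^sup>+ \<omega>. ennreal (f i \<omega>) \<partial>M) \<le> ennreal b"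
proof -
  interpret prob_space M by fact
  have "(\<Sum>i\<in>I. \<integral>\<^sup>+ \<omega>. ennreal (f i \<omega>) \<partial>M) = (\<Sum>i\<in>I. \<integral>\<^sup>+ \<omega>. cond_nn_expectation M N X (f i) \<omega> \<partial>M)"
    using nn_integral_cond_nn_expectation[OF assms(1) X f] by simp
  also have "\<dots> = (\<integral>\<^sup>+ \<omega>. (\<Sum>i\<in>I. cond_nn_expectation M N X (f i) \<omega>) \<partial>M)"
    by (rule nn_integral_sum[symmetric]) (rule measurable_cond_nn_expectation)
  also have "\<dots> \<le> (\<integral>\<^sup>+ \<omega>. ennreal b \<partial>M)"
  proof (rule nn_integral_mono_AE)
    have "AE \<omega> in M. \<forall>i\<in>I. cond_nn_expectation M N X (f i) \<omega> \<le> ennreal (g i \<omega>)"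
      using AE_finite_allI[OF \<open>finite I\<close> le] by simp
    then show "AE \<omega> in M. (\<Sum>i\<in>I. cond_nn_expectation M N X (f i) \<omega>) \<le> ennreal b"
      using AE_space
    proof eventually_elim
      case (elim \<omega>)
      then have "(\<Sum>i\<in>I. cond_nn_expectation M N X (f i) \<omega>) \<le> (\<Sum>i\<in>I. ennreal (g i \<omega>))"
        by (intro sum_mono) blast
      also have "\<dots> = ennreal (\<Sum>i\<in>I. g i \<omega>)" by (rule sum_ennreal) (rule g)
      also have "\<dots> \<le> ennreal b" by (rule ennreal_leI[OF b[OF elim(2)]])
      finally show ?case .
    qed
  qed
  also have "\<dots> = ennreal b" by (simp add: emeasure_space_1)
  finally show ?thesis .
qed

section \<open>The bound in expectation\<close>

theorem theorem3p1:
  fixes M :: "'w measure"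
    and k L :: nat
    and A :: "real mat"
    and \<Gamma>\<^sub>r \<Gamma>\<^sub>c \<Gamma>\<^sub>d :: real
    and U V D :: "'w \<Rightarrow> nat \<Rightarrow> nat \<Rightarrow> real mat"
    and A' :: "nat \<Rightarrow> 'w \<Rightarrow> real mat"
    and B :: "'w \<Rightarrow> real mat"
    and rowerr colerr diagerr :: "nat \<Rightarrow> nat \<Rightarrow> 'w \<Rightarrow> real"
  defines "A' l \<omega> \<equiv> greedy_level L A (U \<omega>) (V \<omega>) (D \<omega>) l"
    and "B \<omega> \<equiv> greedy_output L A (U \<omega>) (V \<omega>) (D \<omega>)"
    and "rowerr l i \<omega> \<equiv>
      (let R = block_row k i (A' (l + 1) \<omega>)
       in (frob_norm (R - U \<omega> l i * (U \<omega> l i)\<^sup>T * R))\<^sup>2)"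
    and "colerr l i \<omega> \<equiv>
      (let C = block_col k i (A' (l + 1) \<omega>)
       in (frob_norm (C - C * V \<omega> l i * (V \<omega> l i)\<^sup>T))\<^sup>2)"
    and "diagerr l i \<omega> \<equiv>
      (let E = diag_block k i (A' (l + 1) \<omega>) - D \<omega> l i
       in (frob_norm (E - U \<omega> l i * (U \<omega> l i)\<^sup>T * E * V \<omega> l i * (V \<omega> l i)\<^sup>T))\<^sup>2)"
  assumes "prob_space M"
    and "k \<ge> 1" and "L \<ge> 1"
    and "A \<in> carrier_mat (2 ^ (L + 1) * k) (2 ^ (L + 1) * k)"
    and "\<Gamma>\<^sub>r \<ge> 0" and "\<Gamma>\<^sub>c \<ge> 0" and "\<Gamma>\<^sub>d \<ge> 0"
    and factors: "\<And>\<omega>. \<omega> \<in> space M \<Longrightarrow> hss_factors L k (U \<omega>) (V \<omega>) (D \<omega>)"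
    and measurable_U: "\<And>l i. l \<in> {1..L} \<Longrightarrow> i < 2 ^ l \<Longrightarrow>
      (\<lambda>\<omega>. U \<omega> l i) \<in> measurable M (mat_borel (2 * k) k)"
    and measurable_V: "\<And>l i. l \<in> {1..L} \<Longrightarrow> i < 2 ^ l \<Longrightarrow>
      (\<lambda>\<omega>. V \<omega> l i) \<in> measurable M (mat_borel (2 * k) k)"
    and measurable_D: "\<And>l i. l \<in> {1..L} \<Longrightarrow> i < 2 ^ l \<Longrightarrow>
      (\<lambda>\<omega>. D \<omega> l i) \<in> measurable M (mat_borel (2 * k) (2 * k))"
    and row_bound: "\<And>l i. l \<in> {1..L} \<Longrightarrow> i < 2 ^ l \<Longrightarrow>
      AE \<omega> in M.
        cond_nn_expectation M (mat_borel (2 ^ (l + 1) * k) (2 ^ (l + 1) * k)) (A' (l + 1))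
          (rowerr l i) \<omega>
        \<le> (let R = block_row k i (A' (l + 1) \<omega>)
           in ennreal (\<Gamma>\<^sub>r * (frob_norm (R - best_rank_approx k R))\<^sup>2))"
    and col_bound: "\<And>l i. l \<in> {1..L} \<Longrightarrow> i < 2 ^ l \<Longrightarrow>
      AE \<omega> in M.
        cond_nn_expectation M (mat_borel (2 ^ (l + 1) * k) (2 ^ (l + 1) * k)) (A' (l + 1))
          (colerr l i) \<omega>
        \<le> (let C = block_col k i (A' (l + 1) \<omega>)
           in ennreal (\<Gamma>\<^sub>c * (frob_norm (C - best_rank_approx k C))\<^sup>2))"
    and diag_bound: "\<And>l i. l \<in> {1..L} \<Longrightarrow> i < 2 ^ l \<Longrightarrow>
      AE \<omega> in M.
        cond_nn_expectation M
          (mat_borel (2 ^ (l + 1) * k) (2 ^ (l + 1) * k)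
             \<Otimes>\<^sub>M mat_borel (2 * k) k \<Otimes>\<^sub>M mat_borel (2 * k) k)
          (\<lambda>\<omega>. (A' (l + 1) \<omega>, U \<omega> l i, V \<omega> l i))
          (diagerr l i) \<omega>
        \<le> ennreal (\<Gamma>\<^sub>d * (rowerr l i \<omega> + colerr l i \<omega>))"
  shows "\<exists>C. is_arg_min (\<lambda>C. (frob_norm (A - C))\<^sup>2) (\<lambda>C. C \<in> HSS L k) C \<and>
    (\<integral>\<^sup>+ \<omega>. ennreal ((frob_norm (A - B \<omega>))\<^sup>2) \<partial>M)
      \<le> ennreal ((\<Gamma>\<^sub>r + \<Gamma>\<^sub>c) * (1 + \<Gamma>\<^sub>d) * real L * (frob_norm (A - C))\<^sup>2)"
proof -
  interpret prob_space M by fact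
  interpret meas: fun_algebra "space M" "borel_measurable M" by (rule fun_algebra_borel)
  have dim: "2 ^ (l + 1) * k = 2 ^ l * (2 * k)" for l by simp
  have A: "A \<in> carrier_mat (2 ^ L * (2 * k)) (2 ^ L * (2 * k))"
    using \<open>A \<in> carrier_mat _ _\<close> unfolding dim .
  \<comment> \<open>A probability space has a point, and the output of the procedure there shows
    that the class is nonempty, as the existence of a minimiser requires.\<close>
  obtain \<omega>0 where "\<omega>0 \<in> space M" using not_empty by blast
  then have "HSS L k \<noteq> {}" using greedy_output_in_HSS[OF factors \<open>L \<ge> 1\<close>] by blast
  then obtain C where C: "C \<in> HSS L k" and C_min: "\<And>C'. C' \<in> HSS L k \<Longrightarrow> fsq (A - C) \<le> fsq (A - C')"
    using subseq_closed_minimiser[OF subseq_closed_HSS _ A] by blast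
  define opt where "opt = fsq (A - C)"
  have opt: "opt \<ge> 0" unfolding opt_def by (rule fsq_nonneg)

  have mU: "meas.mfun (2 * k) k (\<lambda>\<omega>. U \<omega> l i)" and mV: "meas.mfun (2 * k) k (\<lambda>\<omega>. V \<omega> l i)"
    and mD: "meas.mfun (2 * k) (2 * k) (\<lambda>\<omega>. D \<omega> l i)" if "l \<in> {1..L}" "i < 2 ^ l" for l i
    using measurable_U[OF that] measurable_V[OF that] measurable_D[OF that]
    unfolding measurable_mat_borel by blast+
  \<comment> \<open>Measurability descends from the constant matrix at the top, since each level is
    a polynomial in the entries of the factors and of the level above.\<close>
  have mA: "meas.mfun (2 ^ l * (2 * k)) (2 ^ l * (2 * k)) (A' (Suc l))" if "l \<le> L" for l
    using that
  proof (induction rule: inc_induct)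
    case base
    have "A' (Suc L) = (\<lambda>_. A)" by (rule ext) (simp add: A'_def greedy_level_top)
    then show ?case using meas.mfun_const[OF A] by simp
  next
    case (step l)
    then have l: "Suc l \<in> {1..L}" by simp
    have dl: "2 ^ Suc l * k = 2 ^ l * (2 * k)" by simp
    note bU = meas.mfun_bdm[OF mU[OF l], where n = "2 ^ Suc l"]
      and bV = meas.mfun_bdm[OF mV[OF l], where n = "2 ^ Suc l"]
      and bD = meas.mfun_bdm[OF mD[OF l], where n = "2 ^ Suc l"]
    have "meas.mfun (2 ^ Suc l * k) (2 ^ Suc l * k) (A' (Suc l))"
      by (rule meas.mfun_cong[OF meas.mfun_mult[OF meas.mfun_mult[OF
            meas.mfun_transpose[OF bU] meas.mfun_minus[OF step.IH bD]] bV]])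
        (simp_all only: A'_def greedy_level_step[OF factors l])
    then show ?case unfolding dl .
  qed
  have mA': "A' (l + 1) \<in> measurable M (mat_borel (2 ^ (l + 1) * k) (2 ^ (l + 1) * k))" if "l \<in> {1..L}" for l
    using mA[of l] that unfolding measurable_mat_borel dim by simp

  have rowerr: "rowerr l i \<omega> = (let R = block_row k i (A' (Suc l) \<omega>) in fsq (R - U \<omega> l i * (U \<omega> l i)\<^sup>T * R))"
    and colerr: "colerr l i \<omega> = (let C = block_col k i (A' (Suc l) \<omega>) in fsq (C - C * V \<omega> l i * (V \<omega> l i)\<^sup>T))"
    and diagerr: "diagerr l i \<omega> = (let E = diag_block k i (A' (Suc l) \<omega>) - D \<omega> l i in
      fsq (E - U \<omega> l i * (U \<omega> l i)\<^sup>T * E * V \<omega> l i * (V \<omega> l i)\<^sup>T))" for l i \<omega>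
    by (simp_all add: rowerr_def colerr_def diagerr_def frob_norm_sq Let_def)
  have nonneg: "rowerr l i \<omega> \<ge> 0" "colerr l i \<omega> \<ge> 0" "diagerr l i \<omega> \<ge> 0" for l i \<omega>
    by (simp_all add: rowerr_def colerr_def diagerr_def Let_def)

  have m_row: "rowerr l i \<in> borel_measurable M" and m_col: "colerr l i \<in> borel_measurable M"
    and m_diag: "diagerr l i \<in> borel_measurable M" if l: "l \<in> {1..L}" and i: "i < 2 ^ l" for l i
  proof -
    have mA: "meas.mfun (2 ^ l * (2 * k)) (2 ^ l * (2 * k)) (A' (Suc l))" using mA l by simp
    note sub = meas.mfun_submatrix[OF mA]
    note rows = block_idx_within[OF i, of k] card_block_idx
    note mU = mU[OF l i] and mV = mV[OF l i] and mD = mD[OF l i]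
    have R: "meas.mfun (2 * k) (card {j. j < 2 ^ l * (2 * k) \<and> j \<in> - block_idx k i}) (\<lambda>\<omega>. block_row k i (A' (Suc l) \<omega>))"
      using sub[of "block_idx k i" "- block_idx k i"] unfolding rows block_row_def .
    have Cc: "meas.mfun (card {j. j < 2 ^ l * (2 * k) \<and> j \<in> - block_idx k i}) (2 * k) (\<lambda>\<omega>. block_col k i (A' (Suc l) \<omega>))"
      using sub[of "- block_idx k i" "block_idx k i"] unfolding rows block_col_def .
    have E: "meas.mfun (2 * k) (2 * k) (\<lambda>\<omega>. diag_block k i (A' (Suc l) \<omega>) - D \<omega> l i)"
      using meas.mfun_minus[OF sub[of "block_idx k i" "block_idx k i", unfolded rows, folded diag_block_def] mD] .
    note UU = meas.mfun_mult[OF mU meas.mfun_transpose[OF mU]]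
    show "rowerr l i \<in> borel_measurable M"
      unfolding rowerr[abs_def] Let_def by (rule meas.fsq_mfun[OF meas.mfun_minus[OF R meas.mfun_mult[OF UU R]]])
    show "colerr l i \<in> borel_measurable M"
      unfolding colerr[abs_def] Let_def
      by (rule meas.fsq_mfun[OF meas.mfun_minus[OF Cc meas.mfun_mult[OF meas.mfun_mult[OF Cc mV] meas.mfun_transpose[OF mV]]]])
    show "diagerr l i \<in> borel_measurable M"
      unfolding diagerr[abs_def] Let_def
      by (rule meas.fsq_mfun[OF meas.mfun_minus[OF E meas.mfun_mult[OF meas.mfun_mult[OF
                meas.mfun_mult[OF UU E] mV] meas.mfun_transpose[OF mV]]]])
  qed

  define r c d where "r l i = (\<integral>\<^sup>+ \<omega>. ennreal (rowerr l i \<omega>) \<partial>M)"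
    and "c l i = (\<integral>\<^sup>+ \<omega>. ennreal (colerr l i \<omega>) \<partial>M)"
    and "d l i = (\<integral>\<^sup>+ \<omega>. ennreal (diagerr l i \<omega>) \<partial>M)" for l i

  \<comment> \<open>This holds at every point of the space: the competitor varies with
    \<open>\<omega>\<close>, the bound \<open>opt\<close> is constant.\<close>
  have best: "(\<Sum>i<2 ^ l. (frob_norm (block_row k i (A' (l + 1) \<omega>) - best_rank_approx k (block_row k i (A' (l + 1) \<omega>))))\<^sup>2) \<le> opt"
    "(\<Sum>i<2 ^ l. (frob_norm (block_col k i (A' (l + 1) \<omega>) - best_rank_approx k (block_col k i (A' (l + 1) \<omega>))))\<^sup>2) \<le> opt"
    if l: "l \<in> {1..L}" and \<omega>: "\<omega> \<in> space M" for l \<omega>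
  proof -
    obtain l' where l': "l = Suc l'" using l by (cases l) auto
    obtain C' where C': "C' \<in> HSS l k" "fsq (A' (Suc l) \<omega> - C') \<le> opt"
      using greedy_opt_le[OF A factors[OF \<omega>] C, of l] l unfolding A'_def opt_def by auto
    have "A' (Suc l) \<omega> \<in> carrier_mat (2 ^ l * (2 * k)) (2 ^ l * (2 * k))"
      using meas.mfunD(1)[OF mA \<omega>, of l] l by simp
    from best_block_row_le[OF this[unfolded l'] C'(1)[unfolded l']]
      best_block_col_le[OF this[unfolded l'] C'(1)[unfolded l']] C'(2)
    show "(\<Sum>i<2 ^ l. (frob_norm (block_row k i (A' (l + 1) \<omega>) - best_rank_approx k (block_row k i (A' (l + 1) \<omega>))))\<^sup>2) \<le> opt"
      "(\<Sum>i<2 ^ l. (frob_norm (block_col k i (A' (l + 1) \<omega>) - best_rank_approx k (block_col k i (A' (l + 1) \<omega>))))\<^sup>2) \<le> opt"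
      unfolding frob_norm_sq l' by simp_all
  qed

  have sum_r: "(\<Sum>i<2 ^ l. r l i) \<le> ennreal (\<Gamma>\<^sub>r * opt)" if l: "l \<in> {1..L}" for l
    unfolding r_def
  proof (rule sum_nn_integral_le_of_cond_le[OF \<open>prob_space M\<close> _ mA'[OF l]])
    show "AE \<omega> in M. cond_nn_expectation M (mat_borel (2 ^ (l + 1) * k) (2 ^ (l + 1) * k)) (A' (l + 1)) (rowerr l i) \<omega>
      \<le> ennreal (\<Gamma>\<^sub>r * (frob_norm (block_row k i (A' (l + 1) \<omega>) - best_rank_approx k (block_row k i (A' (l + 1) \<omega>))))\<^sup>2)"
      if "i \<in> {..<2 ^ l}" for i
      using row_bound[OF l, of i] that by (simp add: Let_def)
    show "(\<Sum>i<2 ^ l. \<Gamma>\<^sub>r * (frob_norm (block_row k i (A' (l + 1) \<omega>) - best_rank_approx k (block_row k i (A' (l + 1) \<omega>))))\<^sup>2) \<le> \<Gamma>\<^sub>r * opt"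
      if "\<omega> \<in> space M" for \<omega>
      unfolding sum_distrib_left[symmetric] using best(1)[OF l that] \<open>\<Gamma>\<^sub>r \<ge> 0\<close> by (rule mult_left_mono)
  qed (use m_row[OF l] \<open>\<Gamma>\<^sub>r \<ge> 0\<close> in auto)
  have sum_c: "(\<Sum>i<2 ^ l. c l i) \<le> ennreal (\<Gamma>\<^sub>c * opt)" if l: "l \<in> {1..L}" for l
    unfolding c_def
  proof (rule sum_nn_integral_le_of_cond_le[OF \<open>prob_space M\<close> _ mA'[OF l]])
    show "AE \<omega> in M. cond_nn_expectation M (mat_borel (2 ^ (l + 1) * k) (2 ^ (l + 1) * k)) (A' (l + 1)) (colerr l i) \<omega>
      \<le> ennreal (\<Gamma>\<^sub>c * (frob_norm (block_col k i (A' (l + 1) \<omega>) - best_rank_approx k (block_col k i (A' (l + 1) \<omega>))))\<^sup>2)"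
      if "i \<in> {..<2 ^ l}" for i
      using col_bound[OF l, of i] that by (simp add: Let_def)
    show "(\<Sum>i<2 ^ l. \<Gamma>\<^sub>c * (frob_norm (block_col k i (A' (l + 1) \<omega>) - best_rank_approx k (block_col k i (A' (l + 1) \<omega>))))\<^sup>2) \<le> \<Gamma>\<^sub>c * opt"
      if "\<omega> \<in> space M" for \<omega>
      unfolding sum_distrib_left[symmetric] using best(2)[OF l that] \<open>\<Gamma>\<^sub>c \<ge> 0\<close> by (rule mult_left_mono)
  qed (use m_col[OF l] \<open>\<Gamma>\<^sub>c \<ge> 0\<close> in auto)
  \<comment> \<open>The bound on the diagonal error is itself random; integrating it turns it into
    the expected row and column errors, which are controlled above.\<close>
  have d_le: "d l i \<le> ennreal \<Gamma>\<^sub>d * (r l i + c l i)" if l: "l \<in> {1..L}" and i: "i < 2 ^ l" for l i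
  proof -
    have "d l i \<le> (\<integral>\<^sup>+ \<omega>. ennreal (\<Gamma>\<^sub>d * (rowerr l i \<omega> + colerr l i \<omega>)) \<partial>M)"
      unfolding d_def
      by (rule nn_integral_le_of_cond_le[OF \<open>prob_space M\<close> _ m_diag[OF l i] diag_bound[OF l i]])
        (intro measurable_Pair mA'[OF l] measurable_U[OF l i] measurable_V[OF l i])
    also have "\<dots> = (\<integral>\<^sup>+ \<omega>. ennreal \<Gamma>\<^sub>d * (ennreal (rowerr l i \<omega>) + ennreal (colerr l i \<omega>)) \<partial>M)"
      using nonneg \<open>\<Gamma>\<^sub>d \<ge> 0\<close> by (intro nn_integral_cong) (simp add: ennreal_mult)
    also have "\<dots> = ennreal \<Gamma>\<^sub>d * (r l i + c l i)"
      unfolding r_def c_def using m_row[OF l i] m_col[OF l i]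
      by (subst nn_integral_cmult) (auto simp: nn_integral_add)
    finally show ?thesis .
  qed
  \<comment> \<open>The diagonal error is at most \<open>\<Gamma>\<^sub>d\<close> times the sum of
    the one-sided errors, which themselves enter once more through the off-diagonal blocks: this is
    the factor \<open>1 + \<Gamma>\<^sub>d\<close>.\<close>
  have level: "(\<Sum>i<2 ^ l. d l i + r l i + c l i) \<le> ennreal ((\<Gamma>\<^sub>r + \<Gamma>\<^sub>c) * (1 + \<Gamma>\<^sub>d) * opt)" if l: "l \<in> {1..L}" for l
  proof -
    have "(\<Sum>i<2 ^ l. d l i + r l i + c l i) \<le> (\<Sum>i<2 ^ l. ennreal (1 + \<Gamma>\<^sub>d) * (r l i + c l i))"
    proof (intro sum_mono)
      fix i assume "i \<in> {..<(2::nat) ^ l}"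
      then have "d l i + r l i + c l i \<le> ennreal \<Gamma>\<^sub>d * (r l i + c l i) + (r l i + c l i)"
        using d_le[OF l, of i] by (simp add: add.assoc add_right_mono)
      also have "\<dots> = ennreal (1 + \<Gamma>\<^sub>d) * (r l i + c l i)"
        using ennreal_plus[OF \<open>\<Gamma>\<^sub>d \<ge> 0\<close>, of 1] by (simp add: add.commute[of 1] distrib_right)
      finally show "d l i + r l i + c l i \<le> ennreal (1 + \<Gamma>\<^sub>d) * (r l i + c l i)" .
    qed
    also have "\<dots> = ennreal (1 + \<Gamma>\<^sub>d) * ((\<Sum>i<2 ^ l. r l i) + (\<Sum>i<2 ^ l. c l i))"
      by (subst sum_distrib_left[symmetric], subst sum.distrib, rule refl)
    also have "\<dots> \<le> ennreal (1 + \<Gamma>\<^sub>d) * (ennreal (\<Gamma>\<^sub>r * opt) + ennreal (\<Gamma>\<^sub>c * opt))"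
      by (intro mult_left_mono add_mono sum_r[OF l] sum_c[OF l]) simp
    also have "\<dots> = ennreal ((1 + \<Gamma>\<^sub>d) * (\<Gamma>\<^sub>r * opt + \<Gamma>\<^sub>c * opt))"
      using opt \<open>\<Gamma>\<^sub>r \<ge> 0\<close> \<open>\<Gamma>\<^sub>c \<ge> 0\<close> \<open>\<Gamma>\<^sub>d \<ge> 0\<close> by (simp add: ennreal_mult ennreal_plus)
    also have "(1 + \<Gamma>\<^sub>d) * (\<Gamma>\<^sub>r * opt + \<Gamma>\<^sub>c * opt) = (\<Gamma>\<^sub>r + \<Gamma>\<^sub>c) * (1 + \<Gamma>\<^sub>d) * opt"
      by (simp add: algebra_simps)
    finally show ?thesis .
  qed

  have error: "(frob_norm (A - B \<omega>))\<^sup>2 \<le> (\<Sum>l=1..L. \<Sum>i<2 ^ l. diagerr l i \<omega> + rowerr l i \<omega> + colerr l i \<omega>)"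
    if \<omega>: "\<omega> \<in> space M" for \<omega>
  proof -
    have h: "hss_factors L k (U \<omega>) (V \<omega>) (D \<omega>)" using factors \<omega> .
    have "(frob_norm (A - B \<omega>))\<^sup>2 = fsq (greedy_level L A (U \<omega>) (V \<omega>) (D \<omega>) (Suc L)
        - telescope (greedy_level L A (U \<omega>) (V \<omega>) (D \<omega>) 1) (U \<omega>) (V \<omega>) (D \<omega>) L)"
      by (simp add: frob_norm_sq B_def greedy_output_def greedy_level_top)
    also have "\<dots> \<le> (\<Sum>l=1..L. \<Sum>i<2 ^ l. diagerr l i \<omega> + rowerr l i \<omega> + colerr l i \<omega>)"
      unfolding greedy_error(2)[OF A h order_refl]
    proof (rule sum_mono)
      fix l assume l: "l \<in> {1..L}"
      have "greedy_level L A (U \<omega>) (V \<omega>) (D \<omega>) (Suc l) \<in> carrier_mat (2 ^ l * (2 * k)) (2 ^ l * (2 * k))"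
        using greedy_level_carrier[OF A h, of l] l by simp
      from level_error_le[OF this hss_factors_level(1-3)[OF h l]]
      show "(let H = greedy_level L A (U \<omega>) (V \<omega>) (D \<omega>) (Suc l) - bdm (2 ^ l) (2 * k) (2 * k) (D \<omega> l) in
          fsq (H - bdm (2 ^ l) (2 * k) k (U \<omega> l) * ((bdm (2 ^ l) (2 * k) k (U \<omega> l))\<^sup>T * H * bdm (2 ^ l) (2 * k) k (V \<omega> l))
            * (bdm (2 ^ l) (2 * k) k (V \<omega> l))\<^sup>T))
        \<le> (\<Sum>i<2 ^ l. diagerr l i \<omega> + rowerr l i \<omega> + colerr l i \<omega>)"
        unfolding rowerr colerr diagerr A'_def .
    qed
    finally show ?thesis .
  qed
  have "(\<integral>\<^sup>+ \<omega>. ennreal ((frob_norm (A - B \<omega>))\<^sup>2) \<partial>M)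
      \<le> (\<integral>\<^sup>+ \<omega>. (\<Sum>l=1..L. \<Sum>i<2 ^ l. ennreal (diagerr l i \<omega>) + ennreal (rowerr l i \<omega>) + ennreal (colerr l i \<omega>)) \<partial>M)"
  proof (rule nn_integral_mono)
    fix \<omega> assume "\<omega> \<in> space M"
    then have "ennreal ((frob_norm (A - B \<omega>))\<^sup>2)
        \<le> ennreal (\<Sum>l=1..L. \<Sum>i<2 ^ l. diagerr l i \<omega> + rowerr l i \<omega> + colerr l i \<omega>)"
      by (intro ennreal_leI error)
    also have "\<dots> = (\<Sum>l=1..L. ennreal (\<Sum>i<2 ^ l. diagerr l i \<omega> + rowerr l i \<omega> + colerr l i \<omega>))"
      by (intro sum_ennreal[symmetric] sum_nonneg add_nonneg_nonneg nonneg)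
    also have "\<dots> = (\<Sum>l=1..L. \<Sum>i<2 ^ l. ennreal (diagerr l i \<omega> + rowerr l i \<omega> + colerr l i \<omega>))"
      by (intro sum.cong refl sum_ennreal[symmetric] add_nonneg_nonneg nonneg)
    also have "\<dots> = (\<Sum>l=1..L. \<Sum>i<2 ^ l. ennreal (diagerr l i \<omega>) + ennreal (rowerr l i \<omega>) + ennreal (colerr l i \<omega>))"
      by (intro sum.cong refl) (simp add: nonneg)
    finally show "ennreal ((frob_norm (A - B \<omega>))\<^sup>2)
      \<le> (\<Sum>l=1..L. \<Sum>i<2 ^ l. ennreal (diagerr l i \<omega>) + ennreal (rowerr l i \<omega>) + ennreal (colerr l i \<omega>))" .
  qed
  also have "\<dots> = (\<Sum>l=1..L. \<integral>\<^sup>+ \<omega>. (\<Sum>i<2 ^ l. ennreal (diagerr l i \<omega>) + ennreal (rowerr l i \<omega>) + ennreal (colerr l i \<omega>)) \<partial>M)"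
    using m_row m_col m_diag by (intro nn_integral_sum borel_measurable_sum) auto
  also have "\<dots> = (\<Sum>l=1..L. \<Sum>i<2 ^ l. d l i + r l i + c l i)"
  proof (rule sum.cong[OF refl])
    fix l assume l: "l \<in> {1..L}"
    have "(\<integral>\<^sup>+ \<omega>. (\<Sum>i<2 ^ l. ennreal (diagerr l i \<omega>) + ennreal (rowerr l i \<omega>) + ennreal (colerr l i \<omega>)) \<partial>M)
        = (\<Sum>i<2 ^ l. \<integral>\<^sup>+ \<omega>. ennreal (diagerr l i \<omega>) + ennreal (rowerr l i \<omega>) + ennreal (colerr l i \<omega>) \<partial>M)"
      using m_row[OF l] m_col[OF l] m_diag[OF l] by (intro nn_integral_sum) auto
    also have "\<dots> = (\<Sum>i<2 ^ l. d l i + r l i + c l i)"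
      unfolding d_def r_def c_def using m_row[OF l] m_col[OF l] m_diag[OF l]
      by (intro sum.cong refl) (simp add: nn_integral_add)
    finally show "(\<integral>\<^sup>+ \<omega>. (\<Sum>i<2 ^ l. ennreal (diagerr l i \<omega>) + ennreal (rowerr l i \<omega>) + ennreal (colerr l i \<omega>)) \<partial>M)
        = (\<Sum>i<2 ^ l. d l i + r l i + c l i)" .
  qed
  \<comment> \<open>The level bound does not depend on \<open>l\<close>, so summation over the
    levels merely contributes the factor \<open>L\<close>.\<close>
  also have "\<dots> \<le> (\<Sum>l=1..L. ennreal ((\<Gamma>\<^sub>r + \<Gamma>\<^sub>c) * (1 + \<Gamma>\<^sub>d) * opt))"
    by (rule sum_mono) (rule level)
  also have "\<dots> = ennreal ((\<Gamma>\<^sub>r + \<Gamma>\<^sub>c) * (1 + \<Gamma>\<^sub>d) * real L * opt)"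
    using opt \<open>\<Gamma>\<^sub>r \<ge> 0\<close> \<open>\<Gamma>\<^sub>c \<ge> 0\<close> \<open>\<Gamma>\<^sub>d \<ge> 0\<close>
    by (simp add: ennreal_of_nat_eq_real_of_nat ennreal_mult[symmetric] ac_simps)
  finally have "(\<integral>\<^sup>+ \<omega>. ennreal ((frob_norm (A - B \<omega>))\<^sup>2) \<partial>M)
      \<le> ennreal ((\<Gamma>\<^sub>r + \<Gamma>\<^sub>c) * (1 + \<Gamma>\<^sub>d) * real L * (frob_norm (A - C))\<^sup>2)"
    unfolding opt_def frob_norm_sq .
  moreover have "is_arg_min (\<lambda>C. (frob_norm (A - C))\<^sup>2) (\<lambda>C. C \<in> HSS L k) C"
    unfolding is_arg_min_linorder frob_norm_sq using C C_min by blast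
  ultimately show ?thesis by blast
qed

end
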